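(* Let $n\ge1$ and let $\alpha\in(0,n+2)$, $\lambda$, $\sigma$ be constants with $0<\lambda<\frac{n+2-\alpha}{n}$ and $0\le\sigma\le\frac{n+2}{n}$. Suppose $u$ is a nonnegative function with $u\in C^{2,1}(\mathbb{R}^n\times(0,16))\cap L^\lambda(\mathbb{R}^n\times(0,16))$ satisfying $$0\le u_t-\Delta u\le \Big(\iint_{\mathbb{R}^n\times(0,16)}\Phi(x-y,t-s)^{\alpha/n}u(y,s)^\lambda\,dy\,ds\Big)\,u(x,t)^\sigma\quad\text{in }B_4(0)\times(0,16).$$ Then $\max_{|x|\le1}u(x,t)=O(t^{-n/2})$ as $t\to0^+$.
   Context: $\Phi$ is the heat kernel: $\Phi(x,t)=(4\pi t)^{-n/2}e^{-|x|^2/(4t)}$ for $t>0$ and $\Phi(x,t)=0$ for $t\le0$. $B_r(0)$ is the open ball of radius $r$ centered at the origin of $\mathbb{R}^n$. *)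

theory Defs
  imports "HOL-Analysis.Analysis" "HOL-Library.Landau_Symbols"
begin

definition heat_kernel :: "'a::euclidean_space \<Rightarrow> real \<Rightarrow> real" where
  "heat_kernel x t =
     (if t > 0 then (4 * pi * t) powr (- real DIM('a) / 2) * exp (- (norm x)\<^sup>2 / (4 * t)) else 0)"

text \<open>Nonnegative real power with the convention x^0 = 1 (also for x = 0).\<close>
definition nnpow :: "real \<Rightarrow> real \<Rightarrow> real" where
  "nnpow x a = (if a = 0 then 1 else x powr a)"

definition pdx :: "('a::euclidean_space \<Rightarrow> real) \<Rightarrow> 'a \<Rightarrow> 'a \<Rightarrow> real" where
  "pdx f i x = deriv (\<lambda>h. f (x + h *\<^sub>R i)) 0"

definition dt :: "('a \<Rightarrow> real \<Rightarrow> real) \<Rightarrow> 'a \<Rightarrow> real \<Rightarrow> real" where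
  "dt u x t = deriv (\<lambda>s. u x s) t"

definition lap :: "('a::euclidean_space \<Rightarrow> real \<Rightarrow> real) \<Rightarrow> 'a \<Rightarrow> real \<Rightarrow> real" where
  "lap u x t = (\<Sum>i\<in>Basis. pdx (\<lambda>y. pdx (\<lambda>z. u z t) i y) i x)"

definition C21 :: "('a::euclidean_space \<Rightarrow> real \<Rightarrow> real) \<Rightarrow> ('a \<times> real) set \<Rightarrow> bool" where
  "C21 u \<Omega> \<longleftrightarrow>
     continuous_on \<Omega> (\<lambda>(x,t). u x t) \<and>
     (\<forall>(x,t)\<in>\<Omega>. (\<lambda>s. u x s) differentiable (at t)) \<and>
     continuous_on \<Omega> (\<lambda>(x,t). dt u x t) \<and>
     (\<forall>i\<in>Basis.
        (\<forall>(x,t)\<in>\<Omega>. (\<lambda>h. u (x + h *\<^sub>R i) t) differentiable (at 0)) \<and>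
        continuous_on \<Omega> (\<lambda>(x,t). pdx (\<lambda>z. u z t) i x) \<and>
        (\<forall>j\<in>Basis.
           (\<forall>(x,t)\<in>\<Omega>. (\<lambda>h. pdx (\<lambda>z. u z t) i (x + h *\<^sub>R j)) differentiable (at 0)) \<and>
           continuous_on \<Omega> (\<lambda>(x,t). pdx (\<lambda>y. pdx (\<lambda>z. u z t) i y) j x)))"

end

theory Submission
  imports Defs "HOL-Probability.Distributions"
begin

text \<open>
  Write \<open>f = u_t - \<Delta>u \<ge> 0\<close>. Testing the equation with \<open>exp (C s) * max 0 (12 - |x|^2)^3\<close>, whose backward heat
  operator is nonnegative, bounds the local mass of \<open>u\<close> uniformly in time and shows that \<open>f\<close> is integrable up
  to \<open>t = 0\<close>. Testing with a cut-off heat kernel then dominates \<open>u\<close> by heat potentials of these finite measures,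
  so \<open>u\<close> is locally in \<open>L^p\<close> for every \<open>p < (n + 2) / n\<close>. By Young's inequality and
  \<open>\<alpha> / (n + 2) + n \<lambda> / (n + 2) < 1\<close> the nonlocal factor is bounded near the origin, which leaves
  \<open>f \<le> C (1 + u^((n + 2) / n))\<close>. Maximising \<open>u\<close> times the \<open>n\<close>-th power of a parabolic distance, and using
  that the mass of \<open>f\<close> near \<open>t = 0\<close> is small, gives the rate \<open>t^(-n / 2)\<close>.
\<close>

section \<open>Integrals of compactly supported functions\<close>

text \<open>Nothing is assumed about \<open>u\<close> at time 0, so every estimate must come from
  interior times and be uniform as time decreases to 0. The first test provides this: its pairing
  with \<open>u\<close> is nondecreasing in time, hence bounded by its value at time 1, and its
  increment controls the mass of the source. An exact representation formula would need an initial
  trace and a limit at the kernel singularity. An upper bound up to a constant suffices, so the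
  kernel test runs from an arbitrary early time to a time just before \<open>t\<close>, where a
  local average bounds the pairing from below. The critical exponents come from one fact: a positive
  power \<open>\<Phi>^\<beta>\<close> is integrable in space-time near 0 exactly for
  \<open>\<beta> < (n + 2) / n\<close>. Potentials of finite measures inherit this range, so in
  Young's inequality \<open>\<Phi>^(\<alpha> / n)\<close> uses the fraction
  \<open>\<alpha> / (n + 2)\<close> of the available integrability and \<open>u^lam\<close> the
  fraction \<open>n * lam / (n + 2)\<close>; the upper bound on \<open>lam\<close> says that these
  fractions add up to less than 1.\<close>

lemma compact_support_integral:
  fixes f :: "'a::euclidean_space \<Rightarrow> real"
  assumes "continuous_on UNIV f" and "\<And>x. R < norm x \<Longrightarrow> f x = 0" and "cball 0 R \<subseteq> cbox a b"
  shows "integrable lborel f" and "integral\<^sup>L lborel f = integral (cbox a b) f"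
proof -
  have eq: "(\<lambda>x. indicator (cbox a b) x *\<^sub>R f x) = f"
  proof
    fix x show "indicator (cbox a b) x *\<^sub>R f x = f x"
      using assms(2)[of x] assms(3) by (cases "R < norm x"; cases "x \<in> cbox a b") (auto simp: subset_iff not_le)
  qed
  have *: "integrable lborel (\<lambda>x. indicator (cbox a b) x *\<^sub>R f x)"
    by (rule borel_integrable_compact) (use assms in \<open>auto intro: continuous_on_subset\<close>)
  then show "integrable lborel f" by (simp only: eq)
  have "set_integrable lborel (cbox a b) f"
    using * by (simp only: set_integrable_def)
  from set_borel_integral_eq_integral(2)[OF this]
  show "integral\<^sup>L lborel f = integral (cbox a b) f"
    by (simp only: set_lebesgue_integral_def eq)
qed

lemma continuous_on_slices:
  assumes "continuous_on (UNIV \<times> S) (\<lambda>(x, s). q x s)"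
  shows "s \<in> S \<Longrightarrow> continuous_on UNIV (\<lambda>x. q x s)"
    and "continuous_on (S \<times> B) (\<lambda>(s, x). q x s)"
proof -
  show "continuous_on UNIV (\<lambda>x. q x s)" if "s \<in> S"
    using continuous_on_compose2[OF assms, of UNIV "\<lambda>x. (x, s)"] that
    by (simp add: image_subset_iff continuous_on_Pair continuous_on_id continuous_on_const)
  show "continuous_on (S \<times> B) (\<lambda>(s, x). q x s)"
    using continuous_on_compose2[OF assms, of "S \<times> B" "\<lambda>p. (snd p, fst p)"]
    by (simp add: continuous_on_Pair continuous_on_fst continuous_on_snd continuous_on_id image_subset_iff case_prod_beta)
qed

lemma obtain_cbox_around_cball:
  obtains a b :: "'a::euclidean_space" where "cball 0 R \<subseteq> cbox a b"
  by (rule bounded_subset_cbox_symmetric[OF bounded_cball[of "0::'a" R]]) (rule that)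

lemma compact_support_integral_continuous:
  fixes q :: "'a::euclidean_space \<Rightarrow> real \<Rightarrow> real"
  assumes cont: "continuous_on (UNIV \<times> S) (\<lambda>(x, s). q x s)"
    and supp: "\<And>x s. s \<in> S \<Longrightarrow> R < norm x \<Longrightarrow> q x s = 0"
  shows "continuous_on S (\<lambda>s. \<integral>x. q x s \<partial>lborel)"
proof -
  obtain a b :: 'a where ab: "cball 0 R \<subseteq> cbox a b" by (rule obtain_cbox_around_cball)
  have "continuous_on S (\<lambda>s. integral (cbox a b) (\<lambda>x. q x s))"
    by (rule integral_continuous_on_param) (rule continuous_on_slices(2)[OF cont])
  then show ?thesis
    by (rule continuous_on_cong[THEN iffD1, rotated -1])
      (auto intro!: compact_support_integral(2)[symmetric, OF continuous_on_slices(1)[OF cont] _ ab] supp)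
qed

text \<open>One box contains all the supports, so Leibniz's rule over that box transfers to the
  whole space. Since \<open>S\<close> is open, \<open>q\<close> vanishes near each time outside the
  support, and \<open>q'\<close> therefore vanishes there too.\<close>

lemma compact_support_integral_DERIV:
  fixes q q' :: "'a::euclidean_space \<Rightarrow> real \<Rightarrow> real"
  assumes S: "open S" "convex S" "s0 \<in> S"
    and cont: "continuous_on (UNIV \<times> S) (\<lambda>(x, s). q x s)"
    and cont': "continuous_on (UNIV \<times> S) (\<lambda>(x, s). q' x s)"
    and deriv: "\<And>x s. s \<in> S \<Longrightarrow> ((\<lambda>s. q x s) has_real_derivative q' x s) (at s)"
    and supp: "\<And>x s. s \<in> S \<Longrightarrow> R < norm x \<Longrightarrow> q x s = 0"
  shows "((\<lambda>s. \<integral>x. q x s \<partial>lborel) has_real_derivative (\<integral>x. q' x s0 \<partial>lborel)) (at s0)"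
proof -
  obtain a b :: 'a where ab: "cball 0 R \<subseteq> cbox a b" by (rule obtain_cbox_around_cball)
  have supp': "q' x s = 0" if "s \<in> S" "R < norm x" for x s
  proof -
    have "((\<lambda>s. 0) has_real_derivative q' x s) (at s)"
      by (rule has_field_derivative_transform_within_open[OF deriv[OF that(1)] S(1) that(1)])
        (use supp that in auto)
    then show ?thesis using DERIV_unique DERIV_const by blast
  qed
  have "((\<lambda>s. integral (cbox a b) (\<lambda>x. q x s)) has_real_derivative integral (cbox a b) (\<lambda>x. q' x s0)) (at s0 within S)"
  proof (rule leibniz_rule_field_derivative)
    show "(\<lambda>x. q x s) integrable_on cbox a b" if "s \<in> S" for s
      by (rule integrable_continuous, rule continuous_on_subset[OF continuous_on_slices(1)[OF cont that]]) auto
    show "((\<lambda>s. q x s) has_real_derivative q' x s) (at s within S)" if "s \<in> S" for x s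
      by (rule has_field_derivative_at_within[OF deriv[OF that]])
  qed (use S continuous_on_slices(2)[OF cont'] in \<open>simp_all only:\<close>)
  then have "((\<lambda>s. integral (cbox a b) (\<lambda>x. q x s)) has_real_derivative integral (cbox a b) (\<lambda>x. q' x s0)) (at s0)"
    by (simp only: at_within_open[OF S(3,1)])
  moreover have "integral (cbox a b) (\<lambda>x. q' x s0) = (\<integral>x. q' x s0 \<partial>lborel)"
    by (rule compact_support_integral(2)[symmetric, OF continuous_on_slices(1)[OF cont' S(3)] supp'[OF S(3)] ab])
  moreover have "integral (cbox a b) (\<lambda>x. q x s) = (\<integral>x. q x s \<partial>lborel)" if "s \<in> S" for s
    by (rule compact_support_integral(2)[symmetric, OF continuous_on_slices(1)[OF cont that] supp[OF that] ab])
  ultimately show ?thesis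
    using has_field_derivative_transform_within_open[OF _ S(1,3),
        of "\<lambda>s. integral (cbox a b) (\<lambda>x. q x s)" _ "\<lambda>s. \<integral>x. q x s \<partial>lborel"] by simp
qed

lemma lborel_integral_translate:
  fixes g :: "'a::euclidean_space \<Rightarrow> real"
  assumes "g \<in> borel_measurable borel"
  shows "(\<integral>x. g (x + c) \<partial>lborel) = (\<integral>x. g x \<partial>lborel)"
proof -
  have "(\<integral>x. g x \<partial>lborel) = (\<integral>x. g x \<partial>distr lborel borel ((+) c))"
    by (simp add: lborel_distr_plus)
  also have "\<dots> = (\<integral>x. g (c + x) \<partial>lborel)"
    by (rule integral_distr) (use assms in auto)
  finally show ?thesis by (simp add: add.commute)
qed

lemma lborel_nn_integral_translate:
  fixes g :: "'a::euclidean_space \<Rightarrow> ennreal"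
  assumes "g \<in> borel_measurable borel"
  shows "(\<integral>\<^sup>+x. g (x + c) \<partial>lborel) = (\<integral>\<^sup>+x. g x \<partial>lborel)"
proof -
  have "(\<integral>\<^sup>+x. g x \<partial>lborel) = (\<integral>\<^sup>+x. g x \<partial>distr lborel borel ((+) c))"
    by (simp add: lborel_distr_plus)
  also have "\<dots> = (\<integral>\<^sup>+x. g (c + x) \<partial>lborel)"
    by (rule nn_integral_distr) (use assms in auto)
  finally show ?thesis by (simp add: add.commute)
qed

text \<open>The derivative at parameter \<open>s\<close> is the derivative at 0 from a shifted base
  point. Partial derivatives are encoded at parameter 0, while differentiation under the integral
  needs them along a segment.\<close>

lemma DERIV_along_line:
  fixes g :: "'a::real_normed_vector \<Rightarrow> real"
  assumes "\<And>x. ((\<lambda>h. g (x + h *\<^sub>R i)) has_real_derivative g' x) (at 0)"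
  shows "((\<lambda>h. g (x + h *\<^sub>R i)) has_real_derivative g' (x + s *\<^sub>R i)) (at s)"
proof -
  have "((\<lambda>h. g (x + s *\<^sub>R i + (h - s) *\<^sub>R i)) has_real_derivative g' (x + s *\<^sub>R i) * (1 - 0)) (at s)"
    by (rule DERIV_chain2[where f="\<lambda>h. g (x + s *\<^sub>R i + h *\<^sub>R i)"])
      (use assms[of "x + s *\<^sub>R i"] in \<open>simp, intro DERIV_diff DERIV_ident DERIV_const\<close>)
  moreover have "x + s *\<^sub>R i + (h - s) *\<^sub>R i = x + h *\<^sub>R i" for h
    by (simp add: algebra_simps)
  ultimately show ?thesis by simp
qed

text \<open>The integral of a translate does not depend on the translation, so its derivative vanishes.\<close>

lemma compact_support_integral_partial_derivative:
  fixes g g' :: "'a::euclidean_space \<Rightarrow> real"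
  assumes deriv: "\<And>x. ((\<lambda>h. g (x + h *\<^sub>R i)) has_real_derivative g' x) (at 0)"
    and cont: "continuous_on UNIV g" "continuous_on UNIV g'"
    and supp: "\<And>x. R < norm x \<Longrightarrow> g x = 0"
  shows "(\<integral>x. g' x \<partial>lborel) = 0"
proof -
  have "((\<lambda>h. \<integral>x. g (x + h *\<^sub>R i) \<partial>lborel) has_real_derivative (\<integral>x. g' (x + 0 *\<^sub>R i) \<partial>lborel)) (at 0)"
  \<comment> \<open>Shifts of size below 1 keep all translates supported in a common ball.\<close>
  proof (rule compact_support_integral_DERIV[where S="{-1<..<1}" and R="R + norm i"])
    show "continuous_on (UNIV \<times> {-1<..<1}) (\<lambda>(x, s). g (x + s *\<^sub>R i))"
      "continuous_on (UNIV \<times> {-1<..<1}) (\<lambda>(x, s). g' (x + s *\<^sub>R i))"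
      unfolding case_prod_beta
      by (intro continuous_on_compose2[OF cont(1)] continuous_on_compose2[OF cont(2)] continuous_intros, auto)+
    show "((\<lambda>h. g (x + h *\<^sub>R i)) has_real_derivative g' (x + s *\<^sub>R i)) (at s)" for x s
      by (rule DERIV_along_line[OF deriv])
    show "g (x + s *\<^sub>R i) = 0" if "s \<in> {-1<..<1}" "R + norm i < norm x" for x s
    proof (rule supp)
      have "norm (s *\<^sub>R i) \<le> norm i" using that by (auto intro!: mult_left_le_one_le)
      moreover have "norm x \<le> norm (x + s *\<^sub>R i) + norm (s *\<^sub>R i)"
        by (metis add_diff_cancel_right' norm_triangle_ineq4)
      ultimately show "R < norm (x + s *\<^sub>R i)" using that by linarith
    qed
  qed auto
  moreover have "g \<in> borel_measurable borel" by (rule borel_measurable_continuous_onI[OF cont(1)])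
  ultimately have "((\<lambda>h. \<integral>x. g x \<partial>lborel) has_real_derivative (\<integral>x. g' x \<partial>lborel)) (at (0::real))"
    by (simp add: lborel_integral_translate)
  then show ?thesis using DERIV_unique DERIV_const by blast
qed

text \<open>The fundamental theorem of calculus yields iterated integrals of the source; this turns
  them into space-time integrals in \<open>ennreal\<close>, where domain changes and monotone limits
  need no integrability.\<close>

lemma nn_integral_space_time_compact_support:
  fixes q :: "'a::euclidean_space \<Rightarrow> real \<Rightarrow> real"
  assumes cont: "continuous_on (UNIV \<times> {a..b}) (\<lambda>(x, s). q x s)"
    and supp: "\<And>x s. s \<in> {a..b} \<Longrightarrow> R < norm x \<Longrightarrow> q x s = 0"
    and nonneg: "\<And>x s. s \<in> {a..b} \<Longrightarrow> 0 \<le> q x s"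
  shows "(\<integral>\<^sup>+p\<in>UNIV \<times> {a..b}. ennreal (q (fst p) (snd p)) \<partial>lborel)
    = ennreal (integral {a..b} (\<lambda>s. \<integral>x. q x s \<partial>lborel))"
proof -
  obtain c d :: 'a where cd: "cball 0 R \<subseteq> cbox c d" by (rule obtain_cbox_around_cball)
  let ?Q = "\<lambda>p. ennreal (q (fst p) (snd p)) * indicator (UNIV \<times> {a..b}) p"
  have "(\<lambda>p. indicator (UNIV \<times> {a..b}) p *\<^sub>R (\<lambda>(x, s). q x s) p) \<in> borel_measurable borel"
    by (rule borel_measurable_continuous_on_indicator[OF _ cont]) (auto intro!: borel_closed closed_Times)
  then have "(\<lambda>p. ennreal (indicator (UNIV \<times> {a..b}) p *\<^sub>R (\<lambda>(x, s). q x s) p)) \<in> borel_measurable borel"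
    by measurable
  also have "(\<lambda>p. ennreal (indicator (UNIV \<times> {a..b}) p *\<^sub>R (\<lambda>(x, s). q x s) p)) = ?Q"
    by (auto simp: fun_eq_iff indicator_def)
  finally have Q: "?Q \<in> borel_measurable (lborel \<Otimes>\<^sub>M lborel)"
    by (simp add: lborel_prod)
  have slice: "integrable lborel (\<lambda>x. q x s)" if "s \<in> {a..b}" for s
    by (rule compact_support_integral(1)[OF continuous_on_slices(1)[OF cont that] supp[OF that] cd])
  have c: "continuous_on {a..b} (\<lambda>s. \<integral>x. q x s \<partial>lborel)"
    by (rule compact_support_integral_continuous[OF cont supp])
  have nn: "0 \<le> (\<integral>x. q x s \<partial>lborel)" if "s \<in> {a..b}" for s
    using nonneg[OF that] by (simp add: integral_nonneg_AE)
  have "(\<integral>\<^sup>+p. ?Q p \<partial>lborel) = (\<integral>\<^sup>+p. ?Q p \<partial>(lborel \<Otimes>\<^sub>M lborel))"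
    by (simp add: lborel_prod)
  also have "\<dots> = (\<integral>\<^sup>+s. (\<integral>\<^sup>+x. ?Q (x, s) \<partial>lborel) \<partial>lborel)"
    by (rule lborel_pair.nn_integral_snd[symmetric]) (rule Q)
  also have "\<dots> = (\<integral>\<^sup>+s. ennreal (indicator {a..b} s *\<^sub>R (\<integral>x. q x s \<partial>lborel)) \<partial>lborel)"
  proof (rule nn_integral_cong)
    fix s :: real
    show "(\<integral>\<^sup>+x. ?Q (x, s) \<partial>lborel) = ennreal (indicator {a..b} s *\<^sub>R (\<integral>x. q x s \<partial>lborel))"
      using nn_integral_eq_integral[OF slice, of s] nonneg[of s]
      by (cases "s \<in> {a..b}") auto
  qed
  also have "\<dots> = ennreal (\<integral>s. indicator {a..b} s *\<^sub>R (\<integral>x. q x s \<partial>lborel) \<partial>lborel)"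
    by (rule nn_integral_eq_integral)
      (use borel_integrable_compact[OF compact_Icc c] nn in \<open>auto simp: indicator_def\<close>)
  also have "(\<integral>s. indicator {a..b} s *\<^sub>R (\<integral>x. q x s \<partial>lborel) \<partial>lborel) = integral {a..b} (\<lambda>s. \<integral>x. q x s \<partial>lborel)"
    using set_borel_integral_eq_integral(2)[OF borel_integrable_atLeastAtMost'[OF c]]
    by (simp add: set_lebesgue_integral_def)
  finally show ?thesis .
qed

section \<open>The heat kernel\<close>

lemma heat_kernel_nonneg [simp]: "0 \<le> heat_kernel x s"
  by (simp add: heat_kernel_def)

lemma heat_kernel_nonpos_time [simp]: "s \<le> 0 \<Longrightarrow> heat_kernel x s = 0"
  by (simp add: heat_kernel_def)

lemma heat_kernel_le_time:
  fixes x :: "'a::euclidean_space"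
  assumes "0 < s"
  shows "heat_kernel x s \<le> (4 * pi * s) powr (- real DIM('a) / 2)"
proof -
  have "exp (- (norm x)\<^sup>2 / (4 * s)) \<le> 1" using assms by simp
  then show ?thesis using assms by (simp add: heat_kernel_def mult_left_le)
qed

lemma borel_measurable_heat_kernel [measurable]:
  "(\<lambda>p. heat_kernel (fst p) (snd p)) \<in> borel_measurable (borel :: ('a::euclidean_space \<times> real) measure)"
  unfolding heat_kernel_def borel_prod[symmetric] by measurable

text \<open>With \<open>z = \<rho>^2 / (4 * s)\<close> the claim becomes
  \<open>z^m * exp (- z) \<le> m^m\<close>, which is the \<open>m\<close>-th power of
  \<open>z / m \<le> exp (z / m)\<close>. The bound is uniform in \<open>s\<close>.\<close>

lemma powr_neg_mult_exp_le:
  fixes m \<rho> s :: real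
  assumes "0 < m" "0 < \<rho>" "0 < s" "\<rho> \<le> r"
  shows "s powr (- m) * exp (- r\<^sup>2 / (4 * s)) \<le> (4 * m) powr m * \<rho> powr (- 2 * m)"
proof -
  define z where "z = \<rho>\<^sup>2 / (4 * s)"
  have z: "0 < z" using assms by (simp add: z_def)
  have "z / m \<le> exp (z / m)" using exp_ge_add_one_self[of "z / m"] by linarith
  then have "z \<le> m * exp (z / m)" using assms by (simp add: field_simps)
  then have "z powr m \<le> (m * exp (z / m)) powr m" using z assms by (intro powr_mono2) auto
  also have "\<dots> = m powr m * exp z" using assms by (simp add: powr_mult exp_powr_real)
  finally have "z powr m * exp (- z) \<le> m powr m"
    by (simp add: exp_minus field_simps)
  moreover have "1 / s = 4 * z * \<rho> powr (-2)"
    using assms by (simp add: z_def field_simps powr_minus powr_numeral)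
  then have "s powr (- m) = (4 * z * \<rho> powr (-2)) powr m"
    using assms powr_divide[of 1 s m] by (simp add: powr_minus_divide del: powr_neg_numeral)
  then have "s powr (- m) = 4 powr m * z powr m * \<rho> powr (- 2 * m)"
    using assms z by (simp add: powr_mult powr_powr)
  moreover have "4 powr m * \<rho> powr (- 2 * m) * (z powr m * exp (- z)) \<le> 4 powr m * \<rho> powr (- 2 * m) * m powr m"
    by (rule mult_left_mono[OF calculation(1)]) simp
  ultimately have "s powr (- m) * exp (- z) \<le> 4 powr m * m powr m * \<rho> powr (- 2 * m)"
    by (simp only: mult_ac)
  moreover have "exp (- r\<^sup>2 / (4 * s)) \<le> exp (- z)"
    using assms by (auto simp: z_def divide_right_mono power_mono)
  then have "s powr (- m) * exp (- r\<^sup>2 / (4 * s)) \<le> s powr (- m) * exp (- z)"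
    by (intro mult_left_mono) auto
  ultimately have "s powr (- m) * exp (- r\<^sup>2 / (4 * s)) \<le> 4 powr m * m powr m * \<rho> powr (- 2 * m)"
    by (rule order_trans[rotated])
  moreover have "(4 * m) powr m = 4 powr m * m powr m" using assms by (simp add: powr_mult)
  ultimately show ?thesis by (simp only:)
qed

text \<open>At spatial distance \<open>\<rho>\<close> the Gaussian factor beats the time
  singularity; at time lag \<open>\<rho>^2\<close> the prefactor alone is small enough. The two
  summands of the constant serve the two cases.\<close>

lemma heat_kernel_off_diagonal:
  obtains C where "0 < C" and "\<And>\<rho> (x::'a::euclidean_space) s. 0 < \<rho> \<Longrightarrow> \<rho> \<le> norm x \<or> \<rho>\<^sup>2 \<le> s \<Longrightarrow>
    heat_kernel x s \<le> C * \<rho> powr (- real DIM('a))"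
proof
  let ?n = "real DIM('a)"
  let ?C = "(4 * pi) powr (- ?n / 2) * (1 + (2 * ?n) powr (?n / 2))"
  show "0 < ?C" by (simp add: add_pos_nonneg)
  show "heat_kernel x s \<le> ?C * \<rho> powr (- ?n)"
    if "0 < \<rho>" and *: "\<rho> \<le> norm x \<or> \<rho>\<^sup>2 \<le> s" for \<rho> s and x :: 'a
  proof (cases "0 < s")
    case True
    have "s powr (- ?n / 2) * exp (- (norm x)\<^sup>2 / (4 * s)) \<le> (1 + (2 * ?n) powr (?n / 2)) * \<rho> powr (- ?n)"
    proof (cases "\<rho> \<le> norm x")
      case t: True
      have "0 \<le> \<rho> powr (- ?n)" by simp
      moreover have "s powr (- ?n / 2) * exp (- (norm x)\<^sup>2 / (4 * s)) \<le> (2 * ?n) powr (?n / 2) * \<rho> powr (- ?n)"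
        using powr_neg_mult_exp_le[of "?n / 2" \<rho> s "norm x"] True t that(1) by simp
      ultimately show ?thesis unfolding distrib_right by linarith
    next
      case False
      then have "(\<rho>\<^sup>2) powr (?n / 2) \<le> s powr (?n / 2)" using * that by (intro powr_mono2) auto
      moreover have "(\<rho>\<^sup>2) powr (?n / 2) = \<rho> powr ?n"
        using that(1) powr_powr[of \<rho> 2 "?n / 2"] by (simp add: powr_numeral)
      ultimately have "s powr (- ?n / 2) \<le> \<rho> powr (- ?n)"
        using that(1) True by (simp add: powr_minus le_imp_inverse_le)
      moreover have "exp (- (norm x)\<^sup>2 / (4 * s)) \<le> 1" using True by simp
      ultimately have "s powr (- ?n / 2) * exp (- (norm x)\<^sup>2 / (4 * s)) \<le> \<rho> powr (- ?n) * 1"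
        by (intro mult_mono) auto
      also have "\<dots> \<le> (1 + (2 * ?n) powr (?n / 2)) * \<rho> powr (- ?n)"
        by (simp add: distrib_right)
      finally show ?thesis .
    qed
    then have "(4 * pi) powr (- ?n / 2) * (s powr (- ?n / 2) * exp (- (norm x)\<^sup>2 / (4 * s)))
        \<le> (4 * pi) powr (- ?n / 2) * ((1 + (2 * ?n) powr (?n / 2)) * \<rho> powr (- ?n))"
      by (intro mult_left_mono) auto
    then show ?thesis using True by (simp add: heat_kernel_def powr_mult mult.assoc)
  qed (simp add: that)
qed

text \<open>The extra \<open>1 / s\<close> raises the exponent in
  \<open>powr_neg_mult_exp_le\<close> to \<open>n / 2 + 1\<close>. It is needed because the gradient
  of the kernel carries a factor \<open>1 / s\<close>, and this gradient meets the gradient of the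
  cut-off.\<close>

lemma heat_kernel_over_time_off_diagonal:
  obtains C where "0 < C" and "\<And>\<rho> (x::'a::euclidean_space) s. 0 < \<rho> \<Longrightarrow> 0 < s \<Longrightarrow> \<rho> \<le> norm x \<Longrightarrow>
    heat_kernel x s / s \<le> C * \<rho> powr (- real DIM('a) - 2)"
proof
  let ?n = "real DIM('a)"
  let ?C = "(4 * pi) powr (- ?n / 2) * (2 * ?n + 4) powr (?n / 2 + 1)"
  show "0 < ?C" using DIM_positive[where 'a='a] by simp
  show "heat_kernel x s / s \<le> ?C * \<rho> powr (- ?n - 2)"
    if "0 < \<rho>" "0 < s" "\<rho> \<le> norm x" for \<rho> s and x :: 'a
  proof -
    have "- 2 * (?n / 2 + 1) = - ?n - 2" "4 * (?n / 2 + 1) = 2 * ?n + 4" by simp_all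
    then have *: "s powr (- (?n / 2 + 1)) * exp (- (norm x)\<^sup>2 / (4 * s)) \<le> (2 * ?n + 4) powr (?n / 2 + 1) * \<rho> powr (- ?n - 2)"
      using powr_neg_mult_exp_le[of "?n / 2 + 1" \<rho> s "norm x"] that by (simp only:)
    have "- (?n / 2 + 1) = - ?n / 2 - 1" by simp
    then have "s powr (- (?n / 2 + 1)) = s powr (- ?n / 2) / s"
      using that by (simp only: powr_diff) simp
    with * have "s powr (- ?n / 2) / s * exp (- (norm x)\<^sup>2 / (4 * s)) \<le> (2 * ?n + 4) powr (?n / 2 + 1) * \<rho> powr (- ?n - 2)"
      by simp
    then have "(4 * pi) powr (- ?n / 2) * (s powr (- ?n / 2) / s * exp (- (norm x)\<^sup>2 / (4 * s)))
      \<le> (4 * pi) powr (- ?n / 2) * ((2 * ?n + 4) powr (?n / 2 + 1) * \<rho> powr (- ?n - 2))"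
      by (intro mult_left_mono) auto
    then show ?thesis using that by (simp add: heat_kernel_def powr_mult mult.assoc)
  qed
qed

section \<open>Integrals of powers of the heat kernel\<close>

lemma nn_integral_gaussian:
  fixes c :: real
  assumes "0 < c"
  shows "(\<integral>\<^sup>+x. ennreal (exp (- c * x\<^sup>2)) \<partial>lborel) = ennreal (sqrt (pi / c))"
proof -
  define d where "d = sqrt (1 / (2 * c))"
  have d: "0 < d" "d\<^sup>2 = 1 / (2 * c)" using assms by (auto simp: d_def)
  have "normal_density 0 d x = sqrt (c / pi) * exp (- c * x\<^sup>2)" for x
    unfolding normal_density_def d(2) using assms by (simp add: field_simps real_sqrt_divide)
  then have "exp (- c * x\<^sup>2) = sqrt (pi / c) * normal_density 0 d x" for x
    using assms by (simp add: real_sqrt_divide)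
  then have "(\<integral>\<^sup>+x. ennreal (exp (- c * x\<^sup>2)) \<partial>lborel) = (\<integral>\<^sup>+x. ennreal (sqrt (pi / c) * normal_density 0 d x) \<partial>lborel)"
    by simp
  also have "\<dots> = ennreal (\<integral>x. sqrt (pi / c) * normal_density 0 d x \<partial>lborel)"
    by (rule nn_integral_eq_integral) (use d assms in auto)
  also have "\<dots> = ennreal (sqrt (pi / c))" using d by simp
  finally show ?thesis .
qed

text \<open>A power of the kernel is a product of one-dimensional Gaussians of rate
  \<open>\<beta> / (4 * s)\<close>. The power of \<open>s\<close> that remains decides integrability
  in space-time.\<close>

lemma nn_integral_heat_kernel_powr:
  assumes "0 < s" "0 < \<beta>"
  shows "(\<integral>\<^sup>+x. ennreal (heat_kernel (x::'a::euclidean_space) s powr \<beta>) \<partial>lborel)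
    = ennreal (\<beta> powr (- real DIM('a) / 2) * (4 * pi * s) powr (real DIM('a) * (1 - \<beta>) / 2))"
proof -
  let ?n = "real DIM('a)"
  let ?A = "(4 * pi * s) powr (- ?n * \<beta> / 2)"
  define c where "c = \<beta> / (4 * s)"
  have c: "0 < c" using assms by (simp add: c_def)
  have "(norm x)\<^sup>2 = (\<Sum>b\<in>Basis. (x \<bullet> b)\<^sup>2)" for x :: 'a
    by (subst power2_norm_eq_inner, subst euclidean_inner) (simp add: power2_eq_square)
  then have hk: "heat_kernel x s powr \<beta> = ?A * (\<Prod>b\<in>Basis. exp (- c * (x \<bullet> b)\<^sup>2))" for x :: 'a
    using assms by (simp add: heat_kernel_def powr_mult powr_powr exp_powr_real c_def exp_sum[symmetric]
        sum_distrib_left sum_distrib_right sum_divide_distrib sum_negf mult.commute)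
  have "(\<integral>\<^sup>+x. ennreal (heat_kernel (x::'a) s powr \<beta>) \<partial>lborel)
    = (\<integral>\<^sup>+x. ennreal ?A * (\<Prod>b\<in>Basis. ennreal (exp (- c * ((x::'a) \<bullet> b)\<^sup>2))) \<partial>lborel)"
    by (simp add: hk ennreal_mult' prod_nonneg prod_ennreal)
  also have "\<dots> = ennreal ?A * (\<integral>\<^sup>+x. (\<Prod>b\<in>Basis. ennreal (exp (- c * ((x::'a) \<bullet> b)\<^sup>2))) \<partial>lborel)"
    by (rule nn_integral_cmult) simp
  also have "(\<integral>\<^sup>+x. (\<Prod>b\<in>Basis. ennreal (exp (- c * ((x::'a) \<bullet> b)\<^sup>2))) \<partial>lborel)
     = (\<Prod>b\<in>(Basis::'a set). (\<integral>\<^sup>+x. ennreal (exp (- c * x\<^sup>2)) \<partial>lborel))"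
    by (rule nn_integral_lborel_prod) auto
  also have "\<dots> = ennreal (sqrt (pi / c) ^ DIM('a))"
    using c by (simp add: nn_integral_gaussian[OF c, simplified] ennreal_power)
  also have "ennreal ?A * \<dots> = ennreal (?A * sqrt (pi / c) ^ DIM('a))"
    by (simp add: ennreal_mult')
  also have "sqrt (pi / c) ^ DIM('a) = (4 * pi * s) powr (?n / 2) * \<beta> powr (- ?n / 2)"
  proof -
    have "sqrt (pi / c) ^ DIM('a) = (pi / c) powr (?n / 2)"
      using c by (simp add: powr_half_sqrt[symmetric] powr_realpow[symmetric] powr_powr)
    also have "(pi / c) powr (?n / 2) = (4 * pi * s * (1 / \<beta>)) powr (?n / 2)" by (simp add: c_def mult.left_commute mult.commute)
    also have "\<dots> = (4 * pi * s) powr (?n / 2) * \<beta> powr (- ?n / 2)"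
      using assms by (simp only: powr_mult) (simp add: powr_minus_divide powr_divide)
    finally show ?thesis .
  qed
  also have "?A * ((4 * pi * s) powr (?n / 2) * \<beta> powr (- ?n / 2))
    = \<beta> powr (- ?n / 2) * (4 * pi * s) powr (?n * (1 - \<beta>) / 2)"
  proof -
    have "?n * (1 - \<beta>) / 2 = - ?n * \<beta> / 2 + ?n / 2" by (simp add: field_simps)
    then show ?thesis using assms by (simp only: powr_add mult_ac)
  qed
  finally show ?thesis .
qed

lemma nn_integral_space_time_Tonelli:
  fixes g :: "'a::euclidean_space \<times> real \<Rightarrow> ennreal"
  assumes "g \<in> borel_measurable borel" "T \<in> sets borel"
  shows "(\<integral>\<^sup>+p\<in>UNIV \<times> T. g p \<partial>lborel) = (\<integral>\<^sup>+s\<in>T. (\<integral>\<^sup>+x. g (x, s) \<partial>lborel) \<partial>lborel)"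
proof -
  have [measurable]: "g \<in> borel_measurable (borel \<Otimes>\<^sub>M borel)" using assms(1) by (simp add: borel_prod)
  note [measurable] = assms(2)
  have "(\<integral>\<^sup>+p\<in>UNIV \<times> T. g p \<partial>lborel) = (\<integral>\<^sup>+p. g p * indicator T (snd p) \<partial>(lborel \<Otimes>\<^sub>M lborel))"
    unfolding lborel_prod by (intro nn_integral_cong) (auto simp: indicator_def)
  also have "\<dots> = (\<integral>\<^sup>+s. (\<integral>\<^sup>+x. g (x, s) * indicator T s \<partial>lborel) \<partial>lborel)"
    by (subst lborel_pair.nn_integral_snd[symmetric]) simp_all
  also have "\<dots> = (\<integral>\<^sup>+s\<in>T. (\<integral>\<^sup>+x. g (x, s) \<partial>lborel) \<partial>lborel)"
    by (simp add: nn_integral_multc)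
  finally show ?thesis .
qed

lemma nn_integral_heat_kernel_space_time:
  assumes "0 \<le> T"
  shows "(\<integral>\<^sup>+p\<in>UNIV \<times> {0<..<T}. ennreal (heat_kernel (fst p :: 'a::euclidean_space) (snd p)) \<partial>lborel) = ennreal T"
proof -
  have "(\<integral>\<^sup>+x. ennreal (heat_kernel (x::'a) s) \<partial>lborel) * indicator {0<..<T} s = indicator {0<..<T} s" for s
    using nn_integral_heat_kernel_powr[of s 1, where 'a='a] by (auto simp: indicator_def)
  then show ?thesis using assms by (subst nn_integral_space_time_Tonelli) simp_all
qed

text \<open>The threshold is \<open>n * (1 - \<beta>) / 2 > -1\<close>, which makes the remaining power of the time integrable at 0.\<close>

lemma nn_integral_heat_kernel_powr_space_time_finite:
  assumes "0 < \<beta>" "\<beta> < (real DIM('a) + 2) / real DIM('a)"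
  shows "(\<integral>\<^sup>+p\<in>UNIV \<times> {0<..<1}. ennreal (heat_kernel (fst p :: 'a::euclidean_space) (snd p) powr \<beta>) \<partial>lborel) < \<infinity>"
proof -
  let ?n = "real DIM('a)"
  define e where "e = ?n * (1 - \<beta>) / 2"
  have e: "-1 < e" using assms by (simp add: e_def field_simps)
  define B where "B = \<beta> powr (- ?n / 2) * (4 * pi) powr e"
  have "(\<integral>\<^sup>+p\<in>UNIV \<times> {0<..<1}. ennreal (heat_kernel (fst p :: 'a) (snd p) powr \<beta>) \<partial>lborel)
     = (\<integral>\<^sup>+s\<in>{0<..<1}. (\<integral>\<^sup>+x. ennreal (heat_kernel (x::'a) s powr \<beta>) \<partial>lborel) \<partial>lborel)"
    by (subst nn_integral_space_time_Tonelli) simp_all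
  also have "\<dots> \<le> (\<integral>\<^sup>+s. ennreal (B * (s powr e * indicator {0..1} s)) \<partial>lborel)"
    by (intro nn_integral_mono)
      (auto simp: indicator_def nn_integral_heat_kernel_powr assms(1) B_def e_def powr_mult)
  also have "\<dots> = ennreal B * (\<integral>\<^sup>+s. ennreal (s powr e * indicator {0..1} s) \<partial>lborel)"
    by (subst nn_integral_cmult[symmetric]) (auto simp: B_def ennreal_mult')
  also have "(\<integral>\<^sup>+s. ennreal (s powr e * indicator {0..1} s) \<partial>lborel) = ennreal (1 powr (e + 1) / (e + 1))"
  proof (rule nn_integral_has_integral_lborel)
    have "((\<lambda>s. if s \<in> {0..1} then s powr e else 0) has_integral 1 powr (e + 1) / (e + 1)) UNIV"
      using has_integral_powr_from_0[OF e, of 1] by (subst has_integral_restrict_UNIV) auto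
    then show "((\<lambda>s. s powr e * indicator {0..1} s) has_integral 1 powr (e + 1) / (e + 1)) UNIV"
      by (rule has_integral_eq[rotated]) auto
  qed auto
  also have "ennreal B * \<dots> < \<infinity>" by (simp add: ennreal_mult_less_top)
  finally show ?thesis .
qed

text \<open>On the ball of radius \<open>sqrt e\<close> the Gaussian exponent is at least
  \<open>- 1 / 4\<close>, and the kernel height \<open>e^(- n / 2)\<close> cancels the volume of the
  ball. Hence \<open>c\<close> does not depend on \<open>e\<close>.\<close>

lemma heat_kernel_average_lower_bound:
  obtains c where "0 < c" and "\<And>(x::'a::euclidean_space) e m w. 0 < e \<Longrightarrow> 0 \<le> m \<Longrightarrow>
    w \<in> borel_measurable borel \<Longrightarrow> (\<And>y. y \<in> ball x (sqrt e) \<Longrightarrow> m \<le> w y) \<Longrightarrow>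
    ennreal (c * m) \<le> (\<integral>\<^sup>+y. ennreal (heat_kernel (x - y) e * w y) \<partial>lborel)"
proof
  let ?n = "real DIM('a)"
  let ?c = "(4 * pi) powr (- ?n / 2) * exp (- 1 / 4) * unit_ball_vol ?n"
  show "0 < ?c" by simp
  show "ennreal (?c * m) \<le> (\<integral>\<^sup>+y. ennreal (heat_kernel (x - y) e * w y) \<partial>lborel)"
    if "0 < e" "0 \<le> m" "w \<in> borel_measurable borel" and w: "\<And>y. y \<in> ball x (sqrt e) \<Longrightarrow> m \<le> w y"
    for x :: 'a and e m w
  proof -
    let ?k = "(4 * pi * e) powr (- ?n / 2) * exp (- 1 / 4)"
    have "e powr (- ?n / 2) * sqrt e ^ DIM('a) = 1"
      using that(1) by (simp add: powr_half_sqrt[symmetric] powr_realpow[symmetric] powr_powr powr_add[symmetric])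
    then have "?c * m = (4 * pi) powr (- ?n / 2) * (e powr (- ?n / 2) * sqrt e ^ DIM('a)) * exp (- 1 / 4) * unit_ball_vol ?n * m"
      by (simp only: mult_1_right)
    also have "\<dots> = ?k * m * (unit_ball_vol ?n * sqrt e ^ DIM('a))"
      using that(1) by (simp add: powr_mult mult_ac)
    finally have "ennreal (?c * m) = ennreal (?k * m * (unit_ball_vol ?n * sqrt e ^ DIM('a)))"
      by (simp only:)
    also have "\<dots> = ennreal (?k * m) * emeasure lborel (ball x (sqrt e))"
      using that by (simp add: emeasure_ball ennreal_mult)
    also have "\<dots> = (\<integral>\<^sup>+y\<in>ball x (sqrt e). ennreal (?k * m) \<partial>lborel)"
      by (simp add: nn_integral_cmult_indicator)
    also have "\<dots> \<le> (\<integral>\<^sup>+y. ennreal (heat_kernel (x - y) e * w y) \<partial>lborel)"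
    proof (intro nn_integral_mono)
      fix y
      show "ennreal (?k * m) * indicator (ball x (sqrt e)) y \<le> ennreal (heat_kernel (x - y) e * w y)"
      proof (cases "y \<in> ball x (sqrt e)")
        case True
        then have "(norm (x - y))\<^sup>2 \<le> (sqrt e)\<^sup>2" by (intro power_mono) (auto simp: dist_norm)
        then have "(norm (x - y))\<^sup>2 \<le> e" using that(1) by simp
        then have "- 1 / 4 \<le> - (norm (x - y))\<^sup>2 / (4 * e)" using that(1) by (simp add: field_simps)
        then have "?k \<le> heat_kernel (x - y) e"
          using that(1) by (simp add: heat_kernel_def)
        then have "?k * m \<le> heat_kernel (x - y) e * w y"
          using w[OF True] that(2) by (intro mult_mono) auto
        then show ?thesis using True by (simp add: ennreal_leI)
      qed simp
    qed
    finally show ?thesis .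
  qed
qed

section \<open>Derivatives of the heat kernel in reversed time\<close>

lemma continuous_on_heat_kernel_reversed:
  "continuous_on (UNIV \<times> {..<t}) (\<lambda>(y::'a::euclidean_space, s). heat_kernel (x - y) (t - s))"
proof -
  have "continuous_on (UNIV \<times> {..<t}) (\<lambda>(y::'a, s). (4 * pi * (t - s)) powr (- real DIM('a) / 2) * exp (- (norm (x - y))\<^sup>2 / (4 * (t - s))))"
    unfolding case_prod_beta by (intro continuous_intros) auto
  then show ?thesis
    by (rule continuous_on_cong[THEN iffD1, rotated -1]) (auto simp: heat_kernel_def)
qed

lemma heat_kernel_DERIV_time:
  fixes x y :: "'a::euclidean_space"
  assumes "s < t"
  shows "((\<lambda>s. heat_kernel (x - y) (t - s)) has_real_derivative
    heat_kernel (x - y) (t - s) * (real DIM('a) / (2 * (t - s)) - (norm (x - y))\<^sup>2 / (4 * (t - s)\<^sup>2))) (at s)"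
proof -
  let ?n = "real DIM('a)"
  let ?g = "\<lambda>s. (4 * pi * (t - s)) powr (- ?n / 2) * exp (- (norm (x - y))\<^sup>2 / (4 * (t - s)))"
  have "(?g has_real_derivative
    ?g s * (?n / (2 * (t - s)) - (norm (x - y))\<^sup>2 / (4 * (t - s)\<^sup>2))) (at s)"
  proof -
    have d1: "((\<lambda>s. (4 * pi * (t - s)) powr (- ?n / 2)) has_real_derivative
        (4 * pi * (t - s)) powr (- ?n / 2) * (?n / (2 * (t - s)))) (at s)"
      by (rule DERIV_cong, rule DERIV_fun_powr[where g="\<lambda>s. 4 * pi * (t - s)" and m="- 4 * pi"])
        (use assms in \<open>auto intro!: derivative_eq_intros simp: powr_diff, simp add: field_simps\<close>)
    have "((\<lambda>s. - (norm (x - y))\<^sup>2 / (4 * (t - s))) has_real_derivative - (norm (x - y))\<^sup>2 / (4 * (t - s)\<^sup>2)) (at s)"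
      proof (rule DERIV_cong, rule DERIV_divide[OF DERIV_const])
      show "((\<lambda>s. 4 * (t - s)) has_real_derivative - 4) (at s)" by (auto intro!: derivative_eq_intros)
      show "4 * (t - s) \<noteq> 0" using assms by simp
      have "(0 * (4 * d) - - N * - 4) / (4 * d * (4 * d)) = - N / (4 * d\<^sup>2)" for N d :: real
        by (cases "d = 0") (simp_all add: field_simps power2_eq_square)
      then show "(0 * (4 * (t - s)) - - (norm (x - y))\<^sup>2 * - 4) / (4 * (t - s) * (4 * (t - s))) = - (norm (x - y))\<^sup>2 / (4 * (t - s)\<^sup>2)" .
    qed
    note d2 = DERIV_fun_exp[OF this]
    show ?thesis
      by (rule DERIV_cong, rule DERIV_mult[OF d1 d2]) (simp add: algebra_simps)
  qed
  then have "((\<lambda>s. heat_kernel (x - y) (t - s)) has_real_derivative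
    ?g s * (?n / (2 * (t - s)) - (norm (x - y))\<^sup>2 / (4 * (t - s)\<^sup>2))) (at s)"
    by (rule has_field_derivative_transform_within_open[of _ _ _ "{..<t}"])
      (use assms in \<open>auto simp: heat_kernel_def\<close>)
  then show ?thesis using assms by (simp add: heat_kernel_def)
qed

lemma norm_line_sq:
  fixes x i :: "'a::euclidean_space"
  assumes "i \<in> Basis"
  shows "(norm (x + h *\<^sub>R i))\<^sup>2 = (norm x)\<^sup>2 + 2 * h * (x \<bullet> i) + h\<^sup>2"
  using assms unfolding power2_norm_eq_inner
  by (simp add: inner_add_left inner_add_right inner_commute power2_eq_square algebra_simps)

lemma heat_kernel_DERIV_space:
  fixes x y i :: "'a::euclidean_space"
  assumes "s < t" "i \<in> Basis"
  shows "((\<lambda>h. heat_kernel (x - (y + h *\<^sub>R i)) (t - s)) has_real_derivative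
    heat_kernel (x - y) (t - s) * (((x - y) \<bullet> i) / (2 * (t - s)))) (at 0)"
proof -
  have *: "(norm (x - (y + h *\<^sub>R i)))\<^sup>2 = (norm (x - y))\<^sup>2 - 2 * h * ((x - y) \<bullet> i) + h\<^sup>2" for h
    using norm_line_sq[OF assms(2), of "x - y" "- h"] by (simp add: algebra_simps)
  have "((\<lambda>h. - ((norm (x - y))\<^sup>2 - 2 * h * ((x - y) \<bullet> i) + h\<^sup>2) / (4 * (t - s))) has_real_derivative
      ((x - y) \<bullet> i) / (2 * (t - s))) (at 0)"
    using assms by (auto intro!: derivative_eq_intros simp: power2_eq_square) (simp add: field_simps)
  from DERIV_cmult[OF DERIV_fun_exp[OF this], of "(4 * pi * (t - s)) powr (- real DIM('a) / 2)"]
  show ?thesis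
    unfolding heat_kernel_def * using assms by (simp add: mult.assoc)
qed

lemma inner_line_DERIV:
  fixes x y i :: "'a::euclidean_space"
  assumes "i \<in> Basis"
  shows "((\<lambda>h. (y + h *\<^sub>R i) \<bullet> i) has_real_derivative 1) (at 0)"
    and "((\<lambda>h. (x - (y + h *\<^sub>R i)) \<bullet> i) has_real_derivative -1) (at 0)"
  using assms by (auto intro!: derivative_eq_intros simp: inner_add_left inner_diff_left)

text \<open>Summed over \<open>Basis\<close>, this is the negative of the derivative in
  \<open>heat_kernel_DERIV_time\<close>: the reversed kernel solves the backward heat
  equation.\<close>

lemma heat_kernel_DERIV2_space:
  fixes x y i :: "'a::euclidean_space"
  assumes "s < t" "i \<in> Basis"
  shows "((\<lambda>h. heat_kernel (x - (y + h *\<^sub>R i)) (t - s) * (((x - (y + h *\<^sub>R i)) \<bullet> i) / (2 * (t - s)))) has_real_derivative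
    heat_kernel (x - y) (t - s) * (((x - y) \<bullet> i)\<^sup>2 / (4 * (t - s)\<^sup>2) - 1 / (2 * (t - s)))) (at 0)"
  by (rule DERIV_cong, rule DERIV_mult[OF heat_kernel_DERIV_space[OF assms] DERIV_cdivide[OF inner_line_DERIV(2)[OF assms(2)]]])
    (use assms in \<open>simp add: field_simps power2_eq_square\<close>)

section \<open>Testing the heat inequality\<close>

lemma sum_Basis_inner_sq: "(\<Sum>i\<in>Basis. (x \<bullet> i)\<^sup>2) = (norm (x::'a::euclidean_space))\<^sup>2"
  by (subst power2_norm_eq_inner, subst euclidean_inner) (simp add: power2_eq_square)

text \<open>Cut-offs are written as functions of the squared norm, which is a quadratic polynomial
  along every line, so the origin causes no loss of smoothness.\<close>

lemma radial_DERIV: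
  fixes x i :: "'a::euclidean_space"
  assumes "i \<in> Basis" and "\<And>r. (g has_real_derivative g' r) (at r)"
  shows "((\<lambda>h. g ((norm (x + h *\<^sub>R i))\<^sup>2)) has_real_derivative 2 * (x \<bullet> i) * g' ((norm x)\<^sup>2)) (at 0)"
proof -
  have "((\<lambda>h. (norm x)\<^sup>2 + 2 * h * (x \<bullet> i) + h\<^sup>2) has_real_derivative 2 * (x \<bullet> i)) (at 0)"
    by (auto intro!: derivative_eq_intros)
  from DERIV_chain2[OF assms(2) this] show ?thesis
    unfolding norm_line_sq[OF assms(1)] by (simp add: mult.commute)
qed

lemma radial_DERIV2:
  fixes x i :: "'a::euclidean_space"
  assumes "i \<in> Basis" and "\<And>r. (g' has_real_derivative g'' r) (at r)"
  shows "((\<lambda>h. 2 * ((x + h *\<^sub>R i) \<bullet> i) * g' ((norm (x + h *\<^sub>R i))\<^sup>2)) has_real_derivative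
     2 * g' ((norm x)\<^sup>2) + 4 * (x \<bullet> i)\<^sup>2 * g'' ((norm x)\<^sup>2)) (at 0)"
  by (rule DERIV_cong, rule DERIV_mult[OF DERIV_cmult[OF inner_line_DERIV(1)[OF assms(1)]] radial_DERIV[OF assms]])
    (simp add: power2_eq_square)

lemma has_real_derivative_zero_unique: "((\<lambda>h. 0) has_real_derivative d) (at t) \<Longrightarrow> d = 0"
  using DERIV_unique DERIV_const by blast

lemma partial_derivative_eq_0_outside_support:
  fixes g :: "'a::real_normed_vector \<Rightarrow> real"
  assumes "\<And>x. R < norm x \<Longrightarrow> g x = 0" and "((\<lambda>h. g (x + h *\<^sub>R i)) has_real_derivative d) (at 0)" and "R < norm x"
  shows "d = 0"
proof (rule has_real_derivative_zero_unique)
  have "open ((\<lambda>h::real. norm (x + h *\<^sub>R i)) -` {R<..})"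
    by (rule open_vimage) (auto intro!: continuous_intros)
  from has_field_derivative_transform_within_open[OF assms(2) this, of "\<lambda>_. 0"]
  show "((\<lambda>h. 0) has_real_derivative d) (at 0)" using assms by auto
qed

section \<open>The abstract testing argument\<close>

definition heat_op :: "('a::euclidean_space \<Rightarrow> real \<Rightarrow> real) \<Rightarrow> 'a \<Rightarrow> real \<Rightarrow> real" where
  "heat_op u x t = dt u x t - lap u x t"

text \<open>The sign of the source is known only in the ball of radius 4, which limits the supports
  of all test functions. The upper bound on the source joins only after the nonlocal factor is
  bounded.\<close>

locale heat_supersolution =
  fixes u :: "'a::euclidean_space \<Rightarrow> real \<Rightarrow> real"
  assumes nonneg: "\<And>x t. 0 < t \<Longrightarrow> t < 16 \<Longrightarrow> 0 \<le> u x t"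
    and reg: "C21 u (UNIV \<times> {0<..<16})"
    and heat_op_nonneg: "\<And>x t. x \<in> ball 0 4 \<Longrightarrow> 0 < t \<Longrightarrow> t < 16 \<Longrightarrow> 0 \<le> heat_op u x t"
begin

abbreviation ux :: "'a \<Rightarrow> 'a \<Rightarrow> real \<Rightarrow> real" where
  "ux i x t \<equiv> pdx (\<lambda>z. u z t) i x"

abbreviation uxx :: "'a \<Rightarrow> 'a \<Rightarrow> real \<Rightarrow> real" where
  "uxx i x t \<equiv> pdx (\<lambda>y. pdx (\<lambda>z. u z t) i y) i x"

lemma continuous_on_derivatives:
  assumes "S \<subseteq> UNIV \<times> {0<..<16}"
  shows "continuous_on S (\<lambda>p. u (fst p) (snd p))"
    and "continuous_on S (\<lambda>p. dt u (fst p) (snd p))"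
    and "i \<in> Basis \<Longrightarrow> continuous_on S (\<lambda>p. ux i (fst p) (snd p))"
    and "i \<in> Basis \<Longrightarrow> continuous_on S (\<lambda>p. uxx i (fst p) (snd p))"
    and "continuous_on S (\<lambda>p. heat_op u (fst p) (snd p))"
proof -
  show 1: "continuous_on S (\<lambda>p. u (fst p) (snd p))"
    and 2: "continuous_on S (\<lambda>p. dt u (fst p) (snd p))"
    and 3: "i \<in> Basis \<Longrightarrow> continuous_on S (\<lambda>p. ux i (fst p) (snd p))"
    and 4: "i \<in> Basis \<Longrightarrow> continuous_on S (\<lambda>p. uxx i (fst p) (snd p))" for i
    by (rule continuous_on_subset[OF _ assms], use reg in \<open>simp add: C21_def case_prod_beta\<close>)+
  show "continuous_on S (\<lambda>p. heat_op u (fst p) (snd p))"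
    unfolding heat_op_def lap_def by (intro continuous_intros 2 4)
qed

lemma DERIV_derivatives:
  assumes "t \<in> {0<..<16}"
  shows "((\<lambda>s. u x s) has_real_derivative dt u x t) (at t)"
    and "i \<in> Basis \<Longrightarrow> ((\<lambda>h. u (x + h *\<^sub>R i) t) has_real_derivative ux i x t) (at 0)"
    and "i \<in> Basis \<Longrightarrow> ((\<lambda>h. ux i (x + h *\<^sub>R i) t) has_real_derivative uxx i x t) (at 0)"
proof -
  have "(\<lambda>s. u x s) differentiable (at t)" using reg assms by (simp add: C21_def)
  then show "((\<lambda>s. u x s) has_real_derivative dt u x t) (at t)"
    unfolding dt_def using DERIV_deriv_iff_real_differentiable by blast
  assume i: "i \<in> Basis"
  have "(\<lambda>h. u (x + h *\<^sub>R i) t) differentiable (at 0)" using reg assms i by (simp add: C21_def)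
  then show "((\<lambda>h. u (x + h *\<^sub>R i) t) has_real_derivative ux i x t) (at 0)"
    unfolding pdx_def using DERIV_deriv_iff_real_differentiable by blast
  have "(\<lambda>h. ux i (x + h *\<^sub>R i) t) differentiable (at 0)"
    using reg assms i unfolding C21_def by fast
  then show "((\<lambda>h. ux i (x + h *\<^sub>R i) t) has_real_derivative uxx i x t) (at 0)"
    unfolding pdx_def[of "\<lambda>y. pdx (\<lambda>z. u z t) i y"] using DERIV_deriv_iff_real_differentiable by blast
qed

end

text \<open>The derivatives of the test function are parameters, so each instance supplies closed
  formulas. The time interval is open because the reversed heat kernel, one of the two instances, is
  singular at its right end.\<close>

locale heat_test = heat_supersolution u for u :: "'a::euclidean_space \<Rightarrow> real \<Rightarrow> real" +
  fixes a b R :: real and \<psi> \<psi>t :: "'a \<Rightarrow> real \<Rightarrow> real" and \<psi>1 \<psi>2 :: "'a \<Rightarrow> 'a \<Rightarrow> real \<Rightarrow> real"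
  assumes ab: "0 \<le> a" "b \<le> 16" and R: "R < 4"
    and support: "\<And>x s. s \<in> {a<..<b} \<Longrightarrow> R < norm x \<Longrightarrow> \<psi> x s = 0"
    and test_nonneg: "\<And>x s. s \<in> {a<..<b} \<Longrightarrow> 0 \<le> \<psi> x s"
    and DERIV_time: "\<And>x s. s \<in> {a<..<b} \<Longrightarrow> ((\<lambda>s. \<psi> x s) has_real_derivative \<psi>t x s) (at s)"
    and DERIV_space: "\<And>i x s. i \<in> Basis \<Longrightarrow> s \<in> {a<..<b} \<Longrightarrow> ((\<lambda>h. \<psi> (x + h *\<^sub>R i) s) has_real_derivative \<psi>1 i x s) (at 0)"
    and DERIV2_space: "\<And>i x s. i \<in> Basis \<Longrightarrow> s \<in> {a<..<b} \<Longrightarrow> ((\<lambda>h. \<psi>1 i (x + h *\<^sub>R i) s) has_real_derivative \<psi>2 i x s) (at 0)"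
    and cont: "continuous_on (UNIV \<times> {a<..<b}) (\<lambda>p. \<psi> (fst p) (snd p))"
    and cont_time: "continuous_on (UNIV \<times> {a<..<b}) (\<lambda>p. \<psi>t (fst p) (snd p))"
    and cont1: "\<And>i. i \<in> Basis \<Longrightarrow> continuous_on (UNIV \<times> {a<..<b}) (\<lambda>p. \<psi>1 i (fst p) (snd p))"
    and cont2: "\<And>i. i \<in> Basis \<Longrightarrow> continuous_on (UNIV \<times> {a<..<b}) (\<lambda>p. \<psi>2 i (fst p) (snd p))"
begin

text \<open>This is the backward heat operator applied to the test function, that is, minus the
  formal adjoint of \<open>heat_op\<close>. One instance controls its sign, the other its
  size.\<close>

definition adj :: "'a \<Rightarrow> real \<Rightarrow> real" where
  "adj x s = \<psi>t x s + (\<Sum>i\<in>Basis. \<psi>2 i x s)"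

lemma support_derivatives:
  assumes "s \<in> {a<..<b}" "R < norm x"
  shows "\<psi>t x s = 0" and "i \<in> Basis \<Longrightarrow> \<psi>1 i x s = 0" and "i \<in> Basis \<Longrightarrow> \<psi>2 i x s = 0"
proof -
  show "\<psi>t x s = 0"
    using has_field_derivative_transform_within_open[OF DERIV_time[OF assms(1), of x] _ assms(1), of "\<lambda>_. 0"] support assms
    by (intro has_real_derivative_zero_unique) auto
  assume i: "i \<in> Basis"
  have *: "\<psi>1 i y s = 0" if "R < norm y" for y
    by (rule partial_derivative_eq_0_outside_support[OF _ DERIV_space[OF i assms(1)] that])
      (rule support[OF assms(1)])
  show "\<psi>1 i x s = 0" by (rule *) (rule assms(2))
  show "\<psi>2 i x s = 0"
    by (rule partial_derivative_eq_0_outside_support[OF * DERIV2_space[OF i assms(1)] assms(2)])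
qed

lemma strip_subset: "UNIV \<times> {a<..<b} \<subseteq> UNIV \<times> {0<..<16}"
  using ab by auto

lemmas cont_intros =
  cont cont_time cont1 cont2 continuous_on_derivatives[OF strip_subset]

lemma adj_support: "s \<in> {a<..<b} \<Longrightarrow> R < norm x \<Longrightarrow> adj x s = 0"
  by (simp add: adj_def support_derivatives)

lemma cont_adj: "continuous_on (UNIV \<times> {a<..<b}) (\<lambda>p. adj (fst p) (snd p))"
  unfolding adj_def by (intro continuous_intros cont_intros)

lemma integrable_slice:
  fixes q :: "'a \<Rightarrow> real \<Rightarrow> real"
  assumes "continuous_on (UNIV \<times> {a<..<b}) (\<lambda>p. q (fst p) (snd p))" "s \<in> {a<..<b}"
    and "\<And>x. R < norm x \<Longrightarrow> q x s = 0"
  shows "integrable lborel (\<lambda>x. q x s)"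
proof -
  obtain c d :: 'a where cd: "cball 0 R \<subseteq> cbox c d" by (rule obtain_cbox_around_cball)
  show ?thesis
    by (rule compact_support_integral(1)[OF continuous_on_slices(1)[where q=q, unfolded case_prod_beta, OF assms(1,2)] assms(3) cd])
qed

lemma integrable_products:
  assumes "s \<in> {a<..<b}"
  shows "integrable lborel (\<lambda>x. \<psi> x s * u x s)" "integrable lborel (\<lambda>x. adj x s * u x s)"
    "integrable lborel (\<lambda>x. \<psi> x s * heat_op u x s)"
  by (rule integrable_slice[OF _ assms], intro continuous_intros cont_intros cont_adj,
      use assms in \<open>simp add: support adj_support\<close>)+

text \<open>Green's identity in one coordinate: the integrand is the derivative along
  \<open>i\<close> of \<open>\<psi> * ux i - \<psi>1 i * u\<close>, in which the first-order cross
  terms cancel.\<close>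

lemma integral_second_derivative:
  assumes "i \<in> Basis" "s \<in> {a<..<b}"
  shows "(\<integral>x. \<psi> x s * uxx i x s - \<psi>2 i x s * u x s \<partial>lborel) = 0"
proof (rule compact_support_integral_partial_derivative)
  have s: "s \<in> {0<..<16}" using assms ab by auto
  show "((\<lambda>h. \<psi> (x + h *\<^sub>R i) s * ux i (x + h *\<^sub>R i) s - \<psi>1 i (x + h *\<^sub>R i) s * u (x + h *\<^sub>R i) s)
      has_real_derivative \<psi> x s * uxx i x s - \<psi>2 i x s * u x s) (at 0)" for x
    by (rule DERIV_cong, rule DERIV_diff[OF DERIV_mult[OF DERIV_space[OF assms] DERIV_derivatives(3)[OF s assms(1)]]
        DERIV_mult[OF DERIV2_space[OF assms] DERIV_derivatives(2)[OF s assms(1)]]]) simp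
  show "\<psi> x s * ux i x s - \<psi>1 i x s * u x s = 0" if "R < norm x" for x
    using support support_derivatives assms that by simp
  show "continuous_on UNIV (\<lambda>x. \<psi> x s * ux i x s - \<psi>1 i x s * u x s)"
    by (rule continuous_on_slices(1)[OF _ assms(2)], unfold case_prod_beta, intro continuous_intros cont_intros assms(1))
  show "continuous_on UNIV (\<lambda>x. \<psi> x s * uxx i x s - \<psi>2 i x s * u x s)"
    by (rule continuous_on_slices(1)[OF _ assms(2)], unfold case_prod_beta, intro continuous_intros cont_intros assms(1))
qed

text \<open>After the product rule in time, adding and subtracting the Laplacians gives
  \<open>adj * u + \<psi> * heat_op u\<close> plus terms of Green's identity, which integrate to
  0.\<close>

lemma pairing_DERIV:
  assumes s: "s \<in> {a<..<b}"
  shows "((\<lambda>s. \<integral>x. \<psi> x s * u x s \<partial>lborel) has_real_derivative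
    (\<integral>x. adj x s * u x s \<partial>lborel) + (\<integral>x. \<psi> x s * heat_op u x s \<partial>lborel)) (at s)"
proof -
  have "((\<lambda>s. \<integral>x. \<psi> x s * u x s \<partial>lborel) has_real_derivative
     (\<integral>x. \<psi>t x s * u x s + dt u x s * \<psi> x s \<partial>lborel)) (at s)"
  proof (rule compact_support_integral_DERIV[where S="{a<..<b}" and R=R])
    show "continuous_on (UNIV \<times> {a<..<b}) (\<lambda>(x, s). \<psi> x s * u x s)"
      unfolding case_prod_beta by (intro continuous_intros cont_intros)
    show "continuous_on (UNIV \<times> {a<..<b}) (\<lambda>(x, s). \<psi>t x s * u x s + dt u x s * \<psi> x s)"
      unfolding case_prod_beta by (intro continuous_intros cont_intros)
    show "((\<lambda>s. \<psi> x s * u x s) has_real_derivative \<psi>t x s * u x s + dt u x s * \<psi> x s) (at s)"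
      if "s \<in> {a<..<b}" for x s
      by (rule DERIV_mult[OF DERIV_time[OF that] DERIV_derivatives(1)]) (use that ab in auto)
  qed (use s support in auto)
  moreover have "(\<lambda>x. \<psi>t x s * u x s + dt u x s * \<psi> x s)
    = (\<lambda>x. adj x s * u x s + \<psi> x s * heat_op u x s + (\<Sum>i\<in>Basis. \<psi> x s * uxx i x s - \<psi>2 i x s * u x s))"
    by (simp add: fun_eq_iff adj_def heat_op_def lap_def sum_subtractf sum_distrib_left sum_distrib_right algebra_simps)
  moreover have "(\<integral>x. adj x s * u x s + \<psi> x s * heat_op u x s + (\<Sum>i\<in>Basis. \<psi> x s * uxx i x s - \<psi>2 i x s * u x s) \<partial>lborel)
    = (\<integral>x. adj x s * u x s \<partial>lborel) + (\<integral>x. \<psi> x s * heat_op u x s \<partial>lborel)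
      + (\<Sum>i\<in>Basis. \<integral>x. \<psi> x s * uxx i x s - \<psi>2 i x s * u x s \<partial>lborel)"
  proof -
    have i: "integrable lborel (\<lambda>x. \<psi> x s * uxx i x s - \<psi>2 i x s * u x s)" if "i \<in> Basis" for i
      by (rule integrable_slice[OF _ s], intro continuous_intros cont_intros that)
        (use s that in \<open>simp add: support support_derivatives\<close>)
    then show ?thesis
      by (simp add: integrable_products[OF s])
  qed
  moreover have "(\<Sum>i\<in>Basis. \<integral>x. \<psi> x s * uxx i x s - \<psi>2 i x s * u x s \<partial>lborel) = 0"
    using integral_second_derivative[OF _ s] by simp
  ultimately show ?thesis by (simp only: add_0_right)
qed

text \<open>The source contribution \<open>J\<close> is provided both as a real number, for the
  balance, and as a space-time integral in \<open>ennreal\<close>, for comparison with other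
  integrals.\<close>

lemma pairing_increment:
  assumes "a < s1" "s1 \<le> s2" "s2 < b"
  obtains J where "0 \<le> J"
    and "ennreal J = (\<integral>\<^sup>+p\<in>UNIV \<times> {s1..s2}. ennreal (\<psi> (fst p) (snd p) * heat_op u (fst p) (snd p)) \<partial>lborel)"
    and "(\<integral>x. \<psi> x s2 * u x s2 \<partial>lborel) - (\<integral>x. \<psi> x s1 * u x s1 \<partial>lborel)
      = integral {s1..s2} (\<lambda>s. \<integral>x. adj x s * u x s \<partial>lborel) + J"
    and "(\<lambda>s. \<integral>x. adj x s * u x s \<partial>lborel) integrable_on {s1..s2}"
proof
  let ?A = "\<lambda>s. \<integral>x. adj x s * u x s \<partial>lborel" and ?H = "\<lambda>s. \<integral>x. \<psi> x s * heat_op u x s \<partial>lborel"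
  let ?J = "integral {s1..s2} ?H"
  have sub: "{s1..s2} \<subseteq> {a<..<b}" using assms by auto
  have contA: "continuous_on {a<..<b} ?A"
    by (rule compact_support_integral_continuous[where R=R], unfold case_prod_beta,
        intro continuous_intros cont_intros cont_adj, simp add: adj_support)
  have contQ: "continuous_on (UNIV \<times> {a<..<b}) (\<lambda>(x, s). \<psi> x s * heat_op u x s)"
    unfolding case_prod_beta by (intro continuous_intros cont_intros)
  have contH: "continuous_on {a<..<b} ?H"
    by (rule compact_support_integral_continuous[where R=R, OF contQ]) (simp add: support)
  have int: "?A integrable_on {s1..s2}" "?H integrable_on {s1..s2}"
    by (auto intro!: integrable_continuous_real continuous_on_subset[OF contA sub] continuous_on_subset[OF contH sub])
  then show "?A integrable_on {s1..s2}" by simp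
  have "((\<lambda>s. ?A s + ?H s) has_integral (\<integral>x. \<psi> x s2 * u x s2 \<partial>lborel) - (\<integral>x. \<psi> x s1 * u x s1 \<partial>lborel)) {s1..s2}"
  proof (rule fundamental_theorem_of_calculus[OF assms(2)])
    fix s assume "s \<in> {s1..s2}"
    then have "s \<in> {a<..<b}" using sub by blast
    then show "((\<lambda>s. \<integral>x. \<psi> x s * u x s \<partial>lborel) has_vector_derivative ?A s + ?H s) (at s within {s1..s2})"
      by (rule has_vector_derivative_at_within[OF pairing_DERIV[unfolded has_real_derivative_iff_has_vector_derivative]])
  qed
  moreover have "((\<lambda>s. ?A s + ?H s) has_integral integral {s1..s2} ?A + ?J) {s1..s2}"
    by (rule has_integral_add[OF int[unfolded has_integral_integral]])
  ultimately show "(\<integral>x. \<psi> x s2 * u x s2 \<partial>lborel) - (\<integral>x. \<psi> x s1 * u x s1 \<partial>lborel) = integral {s1..s2} ?A + ?J"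
    by (rule has_integral_unique)
  \<comment> \<open>Far from the origin \<open>heat_op u\<close> may have any sign, but there
    \<open>\<psi>\<close> vanishes; \<open>R < 4\<close> puts the support inside the ball where the
    source is nonnegative.\<close>
  have nn: "0 \<le> \<psi> x s * heat_op u x s" if "s \<in> {s1..s2}" for x s
  proof (cases "R < norm x")
    case True then show ?thesis using support[of s x] that sub by auto
  next
    case False
    then show ?thesis
      using that sub ab R by (intro mult_nonneg_nonneg test_nonneg heat_op_nonneg) (auto simp: subset_iff)
  qed
  then show "0 \<le> ?J" by (intro integral_nonneg int) auto
  show "ennreal ?J = (\<integral>\<^sup>+p\<in>UNIV \<times> {s1..s2}. ennreal (\<psi> (fst p) (snd p) * heat_op u (fst p) (snd p)) \<partial>lborel)"
  proof (rule nn_integral_space_time_compact_support[where R=R, symmetric, OF _ _ nn])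
    show "continuous_on (UNIV \<times> {s1..s2}) (\<lambda>(x, s). \<psi> x s * heat_op u x s)"
      by (rule continuous_on_subset[OF contQ]) (use sub in auto)
    show "\<psi> x s * heat_op u x s = 0" if "s \<in> {s1..s2}" "R < norm x" for x s
      using support[of s x] that sub by auto
  qed auto
qed

end

section \<open>Local mass bounds\<close>

lemma DERIV_pos_part_sq: "((\<lambda>z::real. (max 0 z)\<^sup>2) has_real_derivative 2 * max 0 z) (at z)"
proof -
  consider "z < 0" | "z = 0" | "0 < z" by linarith
  then show ?thesis
  proof cases
    case 1
    have "((\<lambda>z::real. 0) has_real_derivative 2 * max 0 z) (at z)" using 1 by simp
    then show ?thesis
      by (rule has_field_derivative_transform_within_open[of _ _ _ "{..<0}"]) (use 1 in auto)
  next
    case 2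
    have "(\<lambda>h::real. ((max 0 (0 + h))\<^sup>2 - (max 0 0)\<^sup>2) / h) \<midarrow>0\<rightarrow> 0"
    proof (rule Lim_null_comparison)
      show "\<forall>\<^sub>F h::real in at 0. norm (((max 0 (0 + h))\<^sup>2 - (max 0 0)\<^sup>2) / h) \<le> \<bar>h\<bar>"
        by (intro always_eventually allI) (auto simp: max_def power2_eq_square)
      show "(\<lambda>h::real. \<bar>h\<bar>) \<midarrow>0\<rightarrow> 0" by (auto intro!: tendsto_eq_intros)
    qed
    then show ?thesis unfolding DERIV_def 2 by simp
  next
    case 3
    have "((\<lambda>z::real. z\<^sup>2) has_real_derivative 2 * max 0 z) (at z)"
      using 3 by (auto intro!: derivative_eq_intros)
    then show ?thesis
      by (rule has_field_derivative_transform_within_open[of _ _ _ "{0<..}"]) (use 3 in auto)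
  qed
qed

text \<open>The cube is the smallest integer power of the positive part that is twice continuously
  differentiable, as required of a test function.\<close>

lemma DERIV_pos_part_cube: "((\<lambda>z::real. (max 0 z)^3) has_real_derivative 3 * (max 0 z)\<^sup>2) (at z)"
proof -
  have "(\<lambda>z::real. (max 0 z)^3) = (\<lambda>z. z * (max 0 z)\<^sup>2)"
    by (auto simp: max_def power3_eq_cube power2_eq_square)
  moreover have "((\<lambda>z::real. z * (max 0 z)\<^sup>2) has_real_derivative 3 * (max 0 z)\<^sup>2) (at z)"
    by (rule DERIV_cong, rule DERIV_mult[OF DERIV_ident DERIV_pos_part_sq]) (auto simp: max_def power2_eq_square)
  ultimately show ?thesis by simp
qed

text \<open>Composing the cubed positive part with itself gives a \<open>C\<^sup>2\<close> step from 0 to 1.\<close>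

lemma smooth_step:
  obtains P P' P'' :: "real \<Rightarrow> real" and B :: real
  where "\<And>z. (P has_real_derivative P' z) (at z)" "\<And>z. (P' has_real_derivative P'' z) (at z)"
    "continuous_on UNIV P''" "\<And>z. 0 \<le> P z" "\<And>z. P z \<le> 1" "\<And>z. z \<le> 0 \<Longrightarrow> P z = 0" "\<And>z. 1 \<le> z \<Longrightarrow> P z = 1"
    "\<And>z. \<bar>P' z\<bar> \<le> B" "\<And>z. \<bar>P'' z\<bar> \<le> B" "\<And>z. z \<notin> {0..1} \<Longrightarrow> P' z = 0 \<and> P'' z = 0"
proof -
  define P :: "real \<Rightarrow> real" where "P z = 1 - (max 0 (1 - (max 0 z)^3))^3" for z
  define P' :: "real \<Rightarrow> real" where "P' z = 9 * ((max 0 (1 - (max 0 z)^3))\<^sup>2 * (max 0 z)\<^sup>2)" for z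
  define P'' :: "real \<Rightarrow> real" where
    "P'' z = 9 * ((2 * max 0 (1 - (max 0 z)^3) * (0 - 3 * (max 0 z)\<^sup>2)) * (max 0 z)\<^sup>2 + (2 * max 0 z) * (max 0 (1 - (max 0 z)^3))\<^sup>2)" for z
  have inner: "((\<lambda>z::real. 1 - (max 0 z)^3) has_real_derivative 0 - 3 * (max 0 z)\<^sup>2) (at z)" for z
    by (rule DERIV_diff[OF DERIV_const DERIV_pos_part_cube])
  have 1: "(P has_real_derivative P' z) (at z)" for z
    unfolding P_def P'_def
    by (rule DERIV_cong, rule DERIV_diff[OF DERIV_const DERIV_chain2[OF DERIV_pos_part_cube inner]]) simp
  have 2: "(P' has_real_derivative P'' z) (at z)" for z
    unfolding P'_def P''_def
    by (rule DERIV_cmult[OF DERIV_mult[OF DERIV_chain2[OF DERIV_pos_part_sq inner] DERIV_pos_part_sq]])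
  have c: "continuous_on UNIV P''" "continuous_on UNIV P'"
    unfolding P''_def P'_def by (intro continuous_intros)+
  have out: "P' z = 0 \<and> P'' z = 0" if "z \<notin> {0..1}" for z
  proof (cases "z < 0")
    case False
    then have "1 \<le> (max 0 z)^3" using that by (intro one_le_power) auto
    then show ?thesis by (simp add: P'_def P''_def max_absorb1)
  qed (simp add: P'_def P''_def)
  have "compact (P' ` {0..1} \<union> P'' ` {0..1})"
    by (intro compact_Un compact_continuous_image continuous_on_subset[OF c(1)] continuous_on_subset[OF c(2)]) auto
  then obtain B where B: "\<And>y. y \<in> P' ` {0..1} \<union> P'' ` {0..1} \<Longrightarrow> \<bar>y\<bar> \<le> B"
    using compact_imp_bounded bounded_iff by (metis real_norm_def)
  have "0 \<le> B" using B[of "P' 0"] by fastforce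
  then have "\<bar>P' z\<bar> \<le> B" "\<bar>P'' z\<bar> \<le> B" for z
    using B[of "P' z"] B[of "P'' z"] out[of z] by (cases "z \<in> {0..1}"; auto)+
  moreover have "0 \<le> P z" "P z \<le> 1" for z
  proof -
    have "0 \<le> max 0 (1 - (max 0 z)^3)" "max 0 (1 - (max 0 z)^3) \<le> 1" by auto
    then show "0 \<le> P z" "P z \<le> 1" unfolding P_def by (simp_all add: power_le_one)
  qed
  moreover have "P z = 0" if "z \<le> 0" for z using that by (simp add: P_def max_absorb1)
  moreover have "P z = 1" if "1 \<le> z" for z
  proof -
    have "1 \<le> (max 0 z)^3" using that by (intro one_le_power) auto
    then show ?thesis by (simp add: P_def max_absorb1)
  qed
  ultimately show ?thesis using that[OF 1 2 c(1)] out by blast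
qed

text \<open>Monotone convergence along \<open>\<tau> = 1 / (k + 2)\<close>, which lies strictly
  between 0 and 1. Measurability is asked only of the restricted function, since \<open>u\<close> is
  arbitrary outside the time strip.\<close>

lemma nn_integral_time_exhaustion:
  fixes h :: "'a::euclidean_space \<times> real \<Rightarrow> ennreal"
  assumes m: "(\<lambda>p. h p * indicator (S \<times> {0<..<1}) p) \<in> borel_measurable borel"
    and le: "\<And>\<tau>. 0 < \<tau> \<Longrightarrow> \<tau> < 1 \<Longrightarrow> (\<integral>\<^sup>+p\<in>S \<times> {\<tau><..<1}. h p \<partial>lborel) \<le> B"
  shows "(\<integral>\<^sup>+p\<in>S \<times> {0<..<1}. h p \<partial>lborel) \<le> B"
proof -
  let ?\<tau> = "\<lambda>k::nat. 1 / (real k + 2)"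
  let ?g = "\<lambda>k p. h p * indicator (S \<times> {?\<tau> k<..<1}) p"
  have g: "?g k = (\<lambda>p. h p * indicator (S \<times> {0<..<1}) p * indicator (UNIV \<times> {?\<tau> k<..}) p)" for k
  proof
    fix p :: "'a \<times> real"
    have "0 < b" if "?\<tau> k < b" for b by (rule less_trans[OF _ that]) simp
    then have "indicator (S \<times> {?\<tau> k<..<1}) p = (indicator (S \<times> {0<..<1}) p * indicator (UNIV \<times> {?\<tau> k<..}) p :: ennreal)"
      by (cases p) (auto simp: indicator_def)
    then show "?g k p = h p * indicator (S \<times> {0<..<1}) p * indicator (UNIV \<times> {?\<tau> k<..}) p"
      by (simp only: mult.assoc)
  qed
  have [measurable]: "?g k \<in> borel_measurable borel" for k
    unfolding g by (rule borel_measurable_times_ennreal[OF m], intro borel_measurable_indicator borel_open open_Times) auto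
  have mono: "incseq ?g"
  proof (intro incseq_SucI le_funI mult_left_mono)
    fix k p
    have "?\<tau> (Suc k) \<le> ?\<tau> k" by (simp add: field_simps)
    then show "(indicator (S \<times> {?\<tau> k<..<1}) p :: ennreal) \<le> indicator (S \<times> {?\<tau> (Suc k)<..<1}) p"
      by (cases p) (auto simp: indicator_def)
  qed simp
  have sup: "(SUP k. ?g k p) = h p * indicator (S \<times> {0<..<1}) p" for p
  proof (cases "p \<in> S \<times> {0<..<1}")
    case True
    then obtain k :: nat where "1 / snd p < real k" using reals_Archimedean2 by blast
    then have "?\<tau> k < snd p" using True by (auto simp: field_simps intro: add_strict_increasing2)
    then have eq: "?g k p = h p" using True by (cases p) auto
    have "?g k p \<le> (SUP k. ?g k p)" by (rule SUP_upper) simp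
    then have "h p \<le> (SUP k. ?g k p)" unfolding eq .
    moreover have "(SUP k. ?g k p) \<le> h p" by (intro SUP_least) (auto simp: indicator_def)
    ultimately show ?thesis using True by simp
  next
    case False
    have "?g k p = 0" for k
      by (rule trans[OF fun_cong[OF g]]) (use False in simp)
    then show ?thesis using False by (simp only: SUP_const) simp
  qed
  have "(\<integral>\<^sup>+p\<in>S \<times> {0<..<1}. h p \<partial>lborel) = (\<integral>\<^sup>+p. (SUP k. ?g k p) \<partial>lborel)"
    by (simp only: sup)
  also have "\<dots> = (SUP k. \<integral>\<^sup>+p. ?g k p \<partial>lborel)"
    by (rule nn_integral_monotone_convergence_SUP[OF mono]) simp
  also have "\<dots> \<le> B" by (intro SUP_least le) auto
  finally show ?thesis .
qed

lemma borel_measurable_restrict_continuous: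
  fixes q :: "'b::euclidean_space \<Rightarrow> real"
  assumes "continuous_on S q" "S \<in> sets borel"
  shows "(\<lambda>p. ennreal (q p) * indicator S p) \<in> borel_measurable borel"
proof -
  have "(\<lambda>p. ennreal (indicator S p *\<^sub>R q p)) \<in> borel_measurable borel"
    by (rule measurable_compose[OF borel_measurable_continuous_on_indicator[OF assms(2,1)]]) simp
  moreover have "(\<lambda>p. ennreal (indicator S p *\<^sub>R q p)) = (\<lambda>p. ennreal (q p) * indicator S p)"
    by (auto simp: indicator_def)
  ultimately show ?thesis by simp
qed

context heat_supersolution
begin

text \<open>With \<open>adj\<close> nonnegative, the pairing at time \<open>s\<close> plus the
  source mass after \<open>s\<close> is at most the pairing at time 1. That one finite number
  controls both quantities, uniformly as \<open>s\<close> tends to 0.\<close>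

lemma mass_bounds:
  obtains A where "0 < A"
    and "\<And>s. 0 < s \<Longrightarrow> s \<le> 1 \<Longrightarrow> (\<integral>\<^sup>+y\<in>cball 0 3. ennreal (u y s) \<partial>lborel) \<le> ennreal A"
    and "(\<integral>\<^sup>+p\<in>cball 0 3 \<times> {0<..<1}. ennreal (heat_op u (fst p) (snd p)) \<partial>lborel) \<le> ennreal A"
proof -
  let ?n = "real DIM('a)"
  \<comment> \<open>The growth rate must absorb the negative part of the Laplacian of the weight.
    Substituting \<open>w = (24 + 6 * n) * z\<close> turns the bracket below into
    \<open>w^2 - w + 288\<close>, which is positive.\<close>
  define C where "C = (24 + 6 * ?n)\<^sup>2"
  have C: "0 \<le> C" by (simp add: C_def)
  \<comment> \<open>The number 12 lies between \<open>3^2\<close> and \<open>(7/2)^2\<close>: the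
    weight is at least 1 on \<open>cball 0 3\<close> and vanishes beyond radius \<open>7/2\<close>,
    still inside the ball of radius 4.\<close>
  define g g' g'' :: "real \<Rightarrow> real" where
    "g r = (max 0 (12 - r))^3" and "g' r = - 3 * (max 0 (12 - r))\<^sup>2" and "g'' r = 6 * max 0 (12 - r)" for r
  have dr: "((\<lambda>r::real. 12 - r) has_real_derivative 0 - 1) (at r)" for r
    by (rule DERIV_diff[OF DERIV_const DERIV_ident])
  have dg: "(g has_real_derivative g' r) (at r)" for r
    unfolding g_def g'_def by (rule DERIV_cong, rule DERIV_chain2[OF DERIV_pos_part_cube dr]) simp
  have dg': "(g' has_real_derivative g'' r) (at r)" for r
    unfolding g'_def g''_def by (rule DERIV_cong, rule DERIV_cmult[OF DERIV_chain2[OF DERIV_pos_part_sq dr]]) simp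
  interpret T: heat_test u 0 16 "7/2" "\<lambda>x s. exp (C * s) * g ((norm x)\<^sup>2)" "\<lambda>x s. C * exp (C * s) * g ((norm x)\<^sup>2)"
    "\<lambda>i x s. exp (C * s) * (2 * (x \<bullet> i) * g' ((norm x)\<^sup>2))"
    "\<lambda>i x s. exp (C * s) * (2 * g' ((norm x)\<^sup>2) + 4 * (x \<bullet> i)\<^sup>2 * g'' ((norm x)\<^sup>2))"
  proof
    show "exp (C * s) * g ((norm x)\<^sup>2) = 0" if "7 / 2 < norm x" for x :: 'a and s
    proof -
      have "(7/2)\<^sup>2 < (norm x)\<^sup>2" by (rule power_strict_mono) (use that in auto)
      then show ?thesis by (simp add: g_def power2_eq_square max_absorb1)
    qed
    show "((\<lambda>s. exp (C * s) * g ((norm x)\<^sup>2)) has_real_derivative C * exp (C * s) * g ((norm x)\<^sup>2)) (at s)" for x :: 'a and s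
      by (auto intro!: derivative_eq_intros)
    show "((\<lambda>h. exp (C * s) * g ((norm (x + h *\<^sub>R i))\<^sup>2)) has_real_derivative exp (C * s) * (2 * (x \<bullet> i) * g' ((norm x)\<^sup>2))) (at 0)"
      if "i \<in> Basis" for i x :: 'a and s
      by (rule DERIV_cmult[OF radial_DERIV[OF that dg]])
    show "((\<lambda>h. exp (C * s) * (2 * ((x + h *\<^sub>R i) \<bullet> i) * g' ((norm (x + h *\<^sub>R i))\<^sup>2))) has_real_derivative
       exp (C * s) * (2 * g' ((norm x)\<^sup>2) + 4 * (x \<bullet> i)\<^sup>2 * g'' ((norm x)\<^sup>2))) (at 0)"
      if "i \<in> Basis" for i x :: 'a and s
      by (rule DERIV_cmult[OF radial_DERIV2[OF that dg']])
  qed (unfold g_def g'_def g''_def, auto intro!: continuous_intros)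
  let ?F = "\<lambda>s. \<integral>x. exp (C * s) * g ((norm x)\<^sup>2) * u x s \<partial>lborel"
  have adj: "0 \<le> T.adj x s" for x s
  proof -
    define r where "r = (norm x)\<^sup>2"
    define z where "z = max 0 (12 - r)"
    have "T.adj x s = exp (C * s) * (C * g r + (\<Sum>i\<in>Basis. 2 * g' r + 4 * (x \<bullet> i)\<^sup>2 * g'' r))"
      unfolding T.adj_def r_def by (simp add: sum_distrib_left algebra_simps)
    also have "(\<Sum>i\<in>Basis. 2 * g' r + 4 * (x \<bullet> i)\<^sup>2 * g'' r) = 2 * ?n * g' r + 4 * r * g'' r"
      by (simp add: sum.distrib sum_distrib_left[symmetric] sum_distrib_right[symmetric] sum_Basis_inner_sq r_def)
    also have "C * g r + (2 * ?n * g' r + 4 * r * g'' r) = z * (C * z\<^sup>2 - 6 * ?n * z + 24 * r)"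
      by (simp add: g_def g'_def g''_def z_def[symmetric] power2_eq_square power3_eq_cube algebra_simps)
    also have "0 \<le> exp (C * s) * \<dots>"
    proof (cases "r < 12")
      case True
      then have r: "r = 12 - z" by (simp add: z_def)
      define w where "w = (24 + 6 * ?n) * z"
      have "C * z\<^sup>2 - 6 * ?n * z + 24 * r = w\<^sup>2 - w + 288"
        by (simp add: r C_def w_def power2_eq_square algebra_simps)
      also have "\<dots> = (w - 1/2)\<^sup>2 + 1151/4" by (simp add: power2_eq_square algebra_simps)
      also have "0 \<le> \<dots>" by simp
      finally show ?thesis by (simp add: z_def)
    qed (simp add: z_def)
    finally show ?thesis .
  qed
  have inc: "\<exists>J. 0 \<le> J \<and> ennreal J = (\<integral>\<^sup>+p\<in>UNIV \<times> {s..1}. ennreal (exp (C * snd p) * g ((norm (fst p))\<^sup>2) * heat_op u (fst p) (snd p)) \<partial>lborel)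
      \<and> ?F s + J \<le> ?F 1" if s: "0 < s" "s \<le> 1" for s
  proof -
    obtain J where J: "0 \<le> J"
      "ennreal J = (\<integral>\<^sup>+p\<in>UNIV \<times> {s..1}. ennreal (exp (C * snd p) * g ((norm (fst p))\<^sup>2) * heat_op u (fst p) (snd p)) \<partial>lborel)"
      "?F 1 - ?F s = integral {s..1} (\<lambda>s. \<integral>x. T.adj x s * u x s \<partial>lborel) + J"
      "(\<lambda>s. \<integral>x. T.adj x s * u x s \<partial>lborel) integrable_on {s..1}"
      by (rule T.pairing_increment[of s 1]) (use s in linarith, use s in linarith, simp, blast)
    have "0 \<le> integral {s..1} (\<lambda>s. \<integral>x. T.adj x s * u x s \<partial>lborel)"
      by (rule integral_nonneg[OF J(4)]) (use s in \<open>auto intro!: integral_nonneg_AE mult_nonneg_nonneg adj nonneg\<close>)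
    then show ?thesis using J by (intro exI[of _ J]) auto
  qed
  have g1: "1 \<le> exp (C * s) * g ((norm x)\<^sup>2)" if "0 < s" "x \<in> cball 0 3" for s and x :: 'a
  proof -
    have "(norm x)\<^sup>2 \<le> 3\<^sup>2" using that by (intro power_mono) auto
    then have "1 \<le> (max 0 (12 - (norm x)\<^sup>2))^3" by (intro one_le_power) auto
    moreover have "1 \<le> exp (C * s)" using C that by simp
    ultimately have "1 * 1 \<le> exp (C * s) * g ((norm x)\<^sup>2)" unfolding g_def by (intro mult_mono) auto
    then show ?thesis by simp
  qed
  have F0: "0 \<le> ?F s" if "0 < s" "s \<le> 1" for s
    using that nonneg[of s] T.test_nonneg[of s] by (intro integral_nonneg_AE) (auto intro!: mult_nonneg_nonneg)
  show thesis
  \<comment> \<open>The added 1 makes the bound strictly positive.\<close>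
  proof (rule that[of "?F 1 + 1"])
    show "0 < ?F 1 + 1" using F0[of 1] by simp
    show "(\<integral>\<^sup>+y\<in>cball 0 3. ennreal (u y s) \<partial>lborel) \<le> ennreal (?F 1 + 1)" if s: "0 < s" "s \<le> 1" for s
    proof -
      have "(\<integral>\<^sup>+y\<in>cball 0 3. ennreal (u y s) \<partial>lborel) \<le> (\<integral>\<^sup>+y. ennreal (exp (C * s) * g ((norm y)\<^sup>2) * u y s) \<partial>lborel)"
      proof (rule nn_integral_mono)
        fix y :: 'a
        have "1 * u y s \<le> exp (C * s) * g ((norm y)\<^sup>2) * u y s" if "y \<in> cball 0 3"
          using g1[OF s(1) that] nonneg[of s y] s by (intro mult_right_mono) auto
        then show "ennreal (u y s) * indicator (cball 0 3) y \<le> ennreal (exp (C * s) * g ((norm y)\<^sup>2) * u y s)"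
          by (auto simp: indicator_def intro: ennreal_leI)
      qed
      also have "\<dots> = ennreal (?F s)"
        by (rule nn_integral_eq_integral[OF T.integrable_products(1)])
          (use s nonneg[of s] T.test_nonneg[of s] in \<open>auto intro!: mult_nonneg_nonneg\<close>)
      also have "\<dots> \<le> ennreal (?F 1 + 1)" using inc[OF s] by (intro ennreal_leI) auto
      finally show ?thesis .
    qed
    show "(\<integral>\<^sup>+p\<in>cball 0 3 \<times> {0<..<1}. ennreal (heat_op u (fst p) (snd p)) \<partial>lborel) \<le> ennreal (?F 1 + 1)"
    proof (rule nn_integral_time_exhaustion)
      show "(\<lambda>p. ennreal (heat_op u (fst p) (snd p)) * indicator (cball 0 3 \<times> {0<..<1}) p) \<in> borel_measurable borel"
        by (rule borel_measurable_restrict_continuous)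
          (auto intro!: continuous_on_derivatives simp: borel_prod[symmetric])
      fix \<tau> :: real assume \<tau>: "0 < \<tau>" "\<tau> < 1"
      obtain J where J: "0 \<le> J"
        "ennreal J = (\<integral>\<^sup>+p\<in>UNIV \<times> {\<tau>..1}. ennreal (exp (C * snd p) * g ((norm (fst p))\<^sup>2) * heat_op u (fst p) (snd p)) \<partial>lborel)"
        "?F \<tau> + J \<le> ?F 1" using inc[of \<tau>] \<tau> by auto
      have "(\<integral>\<^sup>+p\<in>cball 0 3 \<times> {\<tau><..<1}. ennreal (heat_op u (fst p) (snd p)) \<partial>lborel) \<le> ennreal J"
        unfolding J(2)
      proof (rule nn_integral_mono)
        fix p :: "'a \<times> real"
        have "1 * heat_op u x s \<le> exp (C * s) * g ((norm x)\<^sup>2) * heat_op u x s" if "x \<in> cball 0 3" "\<tau> < s" "s < 1" for x s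
          using g1[of s x] that \<tau> by (intro mult_right_mono heat_op_nonneg) auto
        then show "ennreal (heat_op u (fst p) (snd p)) * indicator (cball 0 3 \<times> {\<tau><..<1}) p
          \<le> ennreal (exp (C * snd p) * g ((norm (fst p))\<^sup>2) * heat_op u (fst p) (snd p)) * indicator (UNIV \<times> {\<tau>..1}) p"
          by (cases p) (auto simp: indicator_def intro: ennreal_leI)
      qed
      also have "ennreal J \<le> ennreal (?F 1 + 1)" using J F0[of \<tau>] \<tau> by (intro ennreal_leI) auto
      finally show "(\<integral>\<^sup>+p\<in>cball 0 3 \<times> {\<tau><..<1}. ennreal (heat_op u (fst p) (snd p)) \<partial>lborel) \<le> ennreal (?F 1 + 1)" .
    qed
  qed
qed

end

section \<open>Domination by heat potentials\<close>

text \<open>Here \<open>k\<close>, \<open>f\<close>, \<open>d\<close> stand for kernel, cut-off and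
  \<open>t - s\<close>, with \<open>z = x - y\<close>, and \<open>g1\<close>, \<open>g2\<close> for
  the radial derivatives of the cut-off. Terms in which no derivative falls on the cut-off cancel by
  the backward heat equation.\<close>

lemma backward_heat_product_identity:
  fixes z y :: "'a::euclidean_space" and k f d g1 g2 :: real
  assumes d: "d \<noteq> 0"
  shows "k * (real DIM('a) / (2 * d) - (norm z)\<^sup>2 / (4 * d\<^sup>2)) * f
    + (\<Sum>i\<in>Basis. k * ((z \<bullet> i)\<^sup>2 / (4 * d\<^sup>2) - 1 / (2 * d)) * f + 2 * (y \<bullet> i) * g1 * (k * ((z \<bullet> i) / (2 * d)))
      + ((2 * g1 + 4 * (y \<bullet> i)\<^sup>2 * g2) * k + k * ((z \<bullet> i) / (2 * d)) * (2 * (y \<bullet> i) * g1)))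
    = k / d * (2 * g1 * (z \<bullet> y) + d * (2 * real DIM('a) * g1 + 4 * (norm y)\<^sup>2 * g2))"
proof -
  define e where "e = 1 / d"
  have e: "a / d = a * e" "a / (2 * d) = a * e / 2" "a / (4 * d\<^sup>2) = a * e\<^sup>2 / 4" for a
    by (simp_all add: e_def power_divide)
  have de: "d * e = 1" using d by (simp add: e_def)
  have summand: "k * (p\<^sup>2 * e\<^sup>2 / 4 - 1 * e / 2) * f + 2 * q * g1 * (k * (p * e / 2))
      + ((2 * g1 + 4 * q\<^sup>2 * g2) * k + k * (p * e / 2) * (2 * q * g1))
    = (k * f * e\<^sup>2 / 4) * p\<^sup>2 + (2 * g1 * k * e) * (p * q) + (4 * g2 * k) * q\<^sup>2 + (2 * g1 * k - k * f * e / 2)" for p q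
    by (simp add: algebra_simps)
  have s1: "(\<Sum>i\<in>Basis. (k * f * e\<^sup>2 / 4) * (z \<bullet> i)\<^sup>2) = (k * f * e\<^sup>2 / 4) * (norm z)\<^sup>2"
    by (subst sum_distrib_left[symmetric], subst sum_Basis_inner_sq) (rule refl)
  have s2: "(\<Sum>i\<in>Basis. (2 * g1 * k * e) * ((z \<bullet> i) * (y \<bullet> i))) = (2 * g1 * k * e) * (z \<bullet> y)"
    by (subst sum_distrib_left[symmetric], subst euclidean_inner[of z y]) (rule refl)
  have s3: "(\<Sum>i\<in>Basis. (4 * g2 * k) * (y \<bullet> i)\<^sup>2) = (4 * g2 * k) * (norm y)\<^sup>2"
    by (subst sum_distrib_left[symmetric], subst sum_Basis_inner_sq) (rule refl)
  have "k * e * (2 * g1 * (z \<bullet> y) + d * (2 * real DIM('a) * g1 + 4 * (norm y)\<^sup>2 * g2))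
      = k * e * (2 * g1 * (z \<bullet> y)) + (d * e) * (k * (2 * real DIM('a) * g1 + 4 * (norm y)\<^sup>2 * g2))"
    by (simp add: algebra_simps)
  also have "\<dots> = k * e * (2 * g1 * (z \<bullet> y)) + k * (2 * real DIM('a) * g1 + 4 * (norm y)\<^sup>2 * g2)"
    unfolding de by (simp only: mult_1_left)
  finally show ?thesis
    unfolding e summand sum.distrib s1 s2 s3 by (simp add: algebra_simps)
qed

context heat_supersolution
begin

text \<open>This replaces the convergence of the kernel to a point mass: near \<open>(x, t)\<close>
  the product of cut-off and \<open>u\<close> is at least half of \<open>u x t\<close>, and the
  average bound applies with a constant independent of the time lag.\<close>

lemma cutoff_pairing_lower_bound:
  obtains c where "0 < c" and
    "\<And>x t \<phi> \<tau>. 0 < t \<Longrightarrow> t < 16 \<Longrightarrow> \<tau> < t \<Longrightarrow> 0 < \<tau> \<Longrightarrow> continuous_on UNIV \<phi> \<Longrightarrow> \<phi> x = 1 \<Longrightarrow>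
      \<exists>s\<in>{\<tau><..<t}. ennreal (c * u x t) \<le> (\<integral>\<^sup>+y. ennreal (heat_kernel (x - y) (t - s) * \<phi> y * u y s) \<partial>lborel)"
proof -
  obtain c where c: "0 < c" "\<And>(x::'a) e m w. 0 < e \<Longrightarrow> 0 \<le> m \<Longrightarrow>
    w \<in> borel_measurable borel \<Longrightarrow> (\<And>y. y \<in> ball x (sqrt e) \<Longrightarrow> m \<le> w y) \<Longrightarrow>
    ennreal (c * m) \<le> (\<integral>\<^sup>+y. ennreal (heat_kernel (x - y) e * w y) \<partial>lborel)"
    by (rule heat_kernel_average_lower_bound) blast
  show thesis
  proof (rule that[of "c / 2"])
    show "0 < c / 2" using c by simp
    fix x :: 'a and t \<tau> :: real and \<phi> :: "'a \<Rightarrow> real"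
    assume t: "0 < t" "t < 16" "\<tau> < t" "0 < \<tau>" and \<phi>: "continuous_on UNIV \<phi>" "\<phi> x = 1"
    show "\<exists>s\<in>{\<tau><..<t}. ennreal (c / 2 * u x t) \<le> (\<integral>\<^sup>+y. ennreal (heat_kernel (x - y) (t - s) * \<phi> y * u y s) \<partial>lborel)"
    proof (cases "u x t = 0")
      case True
      then show ?thesis using dense[OF t(3)] by auto
    next
      case False
      then have pos: "0 < u x t" using nonneg[of t x] t by simp
      have cont: "continuous_on (UNIV \<times> {0<..<16}) (\<lambda>p. \<phi> (fst p) * u (fst p) (snd p))"
        by (intro continuous_intros continuous_on_derivatives continuous_on_compose2[OF \<phi>(1)]) auto
      have "isCont (\<lambda>p. \<phi> (fst p) * u (fst p) (snd p)) (x, t)"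
        by (rule continuous_on_interior[OF cont]) (use t in \<open>simp add: interior_Times interior_open\<close>)
      then have "\<forall>\<^sub>F p in at (x, t). dist (\<phi> (fst p) * u (fst p) (snd p)) (u x t) < u x t / 2"
        unfolding isCont_def using pos \<phi>(2) by (auto dest!: tendstoD[where e="u x t / 2"])
      then obtain d where d: "0 < d" "\<And>p. p \<noteq> (x, t) \<Longrightarrow> dist p (x, t) < d \<Longrightarrow> dist (\<phi> (fst p) * u (fst p) (snd p)) (u x t) < u x t / 2"
        unfolding eventually_at by blast
      \<comment> \<open>\<open>r \<le> 1\<close> makes the lag \<open>e = r^2\<close> at most
        \<open>r\<close>; then \<open>r \<le> d / 2\<close> keeps the cylinder within distance
        \<open>d\<close> of \<open>(x, t)\<close>, and \<open>r < t - \<tau>\<close> keeps the time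
        above \<open>\<tau>\<close>.\<close>
      define r where "r = min 1 (min (d / 2) ((t - \<tau>) / 2))"
      have r: "0 < r" "r \<le> 1" "r \<le> d / 2" "r < t - \<tau>"
        using d t by (auto simp: r_def min_less_iff_disj)
      define e where "e = r\<^sup>2"
      have e: "0 < e" "e \<le> r" "sqrt e = r" using r by (auto simp: e_def power2_eq_square mult_left_le)
      have s: "t - e \<in> {\<tau><..<t}" using e r by auto
      have slice: "continuous_on UNIV (\<lambda>y. \<phi> y * u y (t - e))"
        by (rule continuous_on_slices(1)[where S="{0<..<16}", unfolded case_prod_beta, OF cont]) (use s t in auto)
      have "ennreal (c * (u x t / 2)) \<le> (\<integral>\<^sup>+y. ennreal (heat_kernel (x - y) e * (\<phi> y * u y (t - e))) \<partial>lborel)"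
      proof (rule c(2)[OF e(1)])
        show "(\<lambda>y. \<phi> y * u y (t - e)) \<in> borel_measurable borel"
          by (rule borel_measurable_continuous_onI[OF slice])
        fix y assume "y \<in> ball x (sqrt e)"
        then have y: "dist y x < r" using e by (simp add: dist_commute)
        have "dist (y, t - e) (x, t) \<le> dist y x + dist (t - e) t"
          unfolding dist_prod_def using sqrt_sum_squares_le_sum[of "dist y x" e] e by (simp add: dist_real_def)
        also have "\<dots> < d" using y e r by (auto simp: dist_real_def)
        finally have "dist (\<phi> y * u y (t - e)) (u x t) < u x t / 2"
          using d(2)[of "(y, t - e)"] e by simp
        then show "u x t / 2 \<le> \<phi> y * u y (t - e)" by (auto simp: dist_real_def abs_if split: if_splits)
      qed (use pos in simp)
      then show ?thesis using s by (intro bexI[of _ "t - e"]) (auto simp: mult.assoc)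
    qed
  qed
qed

text \<open>The kernel times a cut-off is the test function. Its backward heat operator lives where
  the cut-off varies, at distance at least \<open>1/2\<close> from \<open>x\<close>; there it is
  bounded, so the error is a multiple of the local mass of \<open>u\<close>.\<close>

lemma representation_bound:
  obtains C where "0 < C" and "\<And>x \<tau> t. norm x \<le> 2 \<Longrightarrow> 0 < \<tau> \<Longrightarrow> \<tau> < t \<Longrightarrow> t \<le> 1 \<Longrightarrow>
    ennreal (u x t) \<le> ennreal C * (1 + (\<integral>\<^sup>+y\<in>cball 0 3. ennreal (heat_kernel (x - y) (t - \<tau>) * u y \<tau>) \<partial>lborel)
      + (\<integral>\<^sup>+p\<in>cball 0 3 \<times> {0<..<1}. ennreal (heat_kernel (x - fst p) (t - snd p) * heat_op u (fst p) (snd p)) \<partial>lborel))"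
proof -
  let ?n = "real DIM('a)"
  obtain A where A: "0 < A" "\<And>s. 0 < s \<Longrightarrow> s \<le> 1 \<Longrightarrow> (\<integral>\<^sup>+y\<in>cball 0 3. ennreal (u y s) \<partial>lborel) \<le> ennreal A"
    using mass_bounds by metis
  obtain c where c: "0 < c" "\<And>x t \<phi> \<tau>. 0 < t \<Longrightarrow> t < 16 \<Longrightarrow> \<tau> < t \<Longrightarrow> 0 < \<tau> \<Longrightarrow> continuous_on UNIV \<phi> \<Longrightarrow> \<phi> x = 1 \<Longrightarrow>
      \<exists>s\<in>{\<tau><..<t}. ennreal (c * u x t) \<le> (\<integral>\<^sup>+y. ennreal (heat_kernel (x - y) (t - s) * \<phi> y * u y s) \<partial>lborel)"
    by (rule cutoff_pairing_lower_bound) blast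
  obtain P P' P'' :: "real \<Rightarrow> real" and B where P: "\<And>z. (P has_real_derivative P' z) (at z)" "\<And>z. (P' has_real_derivative P'' z) (at z)"
    "continuous_on UNIV P''" "\<And>z. 0 \<le> P z" "\<And>z. P z \<le> 1" "\<And>z. z \<le> 0 \<Longrightarrow> P z = 0" "\<And>z. 1 \<le> z \<Longrightarrow> P z = 1"
    "\<And>z. \<bar>P' z\<bar> \<le> B" "\<And>z. \<bar>P'' z\<bar> \<le> B" "\<And>z. z \<notin> {0..1} \<Longrightarrow> P' z = 0 \<and> P'' z = 0"
    by (rule smooth_step) blast
  have B0: "0 \<le> B" using P(8)[of 0] by linarith
  obtain D0 where D0: "0 < D0" "\<And>\<rho> (x::'a) s. 0 < \<rho> \<Longrightarrow> 0 < s \<Longrightarrow> \<rho> \<le> norm x \<Longrightarrow>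
    heat_kernel x s / s \<le> D0 * \<rho> powr (- ?n - 2)"
    by (rule heat_kernel_over_time_off_diagonal) blast
  define D where "D = D0 * (1/2) powr (- ?n - 2)"
  have D: "0 \<le> D" "\<And>(x::'a) s. 0 < s \<Longrightarrow> 1/2 \<le> norm x \<Longrightarrow> heat_kernel x s / s \<le> D"
    using D0(1) D0(2)[of "1/2"] by (auto simp: D_def)
  \<comment> \<open>On the annulus \<open>norm (x - y) \<le> 5\<close> and
    \<open>norm y \<le> 3\<close>, so the first-order term contributes \<open>2 * B * 15\<close>.
    The other two summands bound the Laplacian of the cut-off, with
    \<open>t - s \<le> 1\<close>.\<close>
  define E where "E = D * (30 * B + 2 * ?n * B + 36 * B)"
  have E0: "0 \<le> E" using D(1) B0 by (simp add: E_def)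
  define g g' g'' :: "real \<Rightarrow> real" where "g r = P (9 - r)" and "g' r = - P' (9 - r)" and "g'' r = P'' (9 - r)" for r
  have dr: "((\<lambda>r::real. 9 - r) has_real_derivative 0 - 1) (at r)" for r
    by (rule DERIV_diff[OF DERIV_const DERIV_ident])
  have dg: "(g has_real_derivative g' r) (at r)" for r
    unfolding g_def g'_def by (rule DERIV_cong, rule DERIV_chain2[OF P(1) dr]) simp
  have dg': "(g' has_real_derivative g'' r) (at r)" for r
    unfolding g'_def g''_def by (rule DERIV_cong, rule DERIV_minus[OF DERIV_chain2[OF P(2) dr]]) simp
  have contg: "continuous_on UNIV g" "continuous_on UNIV g'"
    by (intro continuous_at_imp_continuous_on ballI DERIV_isCont[OF dg] DERIV_isCont[OF dg'])+
  have contg'': "continuous_on UNIV g''"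
    unfolding g''_def by (rule continuous_on_compose2[OF P(3)]) (auto intro!: continuous_intros)
  define \<phi> :: "'a \<Rightarrow> real" where "\<phi> y = g ((norm y)\<^sup>2)" for y
  have \<phi>: "0 \<le> \<phi> y" "\<phi> y \<le> 1" for y using P(4,5) by (auto simp: \<phi>_def g_def)
  have \<phi>cont: "continuous_on UNIV \<phi>"
    unfolding \<phi>_def by (rule continuous_on_compose2[OF contg(1)]) (auto intro!: continuous_intros)
  have \<phi>_out: "\<phi> y = 0" if "3 < norm y" for y
  proof -
    have "3\<^sup>2 < (norm y)\<^sup>2" by (rule power_strict_mono) (use that in auto)
    then show ?thesis unfolding \<phi>_def g_def by (intro P(6)) simp
  qed
  have bound: "ennreal (c * u x t) \<le> (\<integral>\<^sup>+y\<in>cball 0 3. ennreal (heat_kernel (x - y) (t - \<tau>) * u y \<tau>) \<partial>lborel)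
      + ennreal (E * A)
      + (\<integral>\<^sup>+p\<in>cball 0 3 \<times> {0<..<1}. ennreal (heat_kernel (x - fst p) (t - snd p) * heat_op u (fst p) (snd p)) \<partial>lborel)"
    if x: "norm x \<le> 2" and \<tau>: "0 < \<tau>" "\<tau> < t" and t: "t \<le> 1" for x \<tau> t
  proof -
    let ?K = "\<lambda>y s. heat_kernel (x - y) (t - s)"
    have contK: "continuous_on (UNIV \<times> {0<..<t}) (\<lambda>p. ?K (fst p) (snd p))"
      by (rule continuous_on_subset[OF continuous_on_heat_kernel_reversed[unfolded case_prod_beta]]) auto
    interpret T: heat_test u 0 t 3 "\<lambda>y s. ?K y s * \<phi> y"
      "\<lambda>y s. ?K y s * (?n / (2 * (t - s)) - (norm (x - y))\<^sup>2 / (4 * (t - s)\<^sup>2)) * \<phi> y"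
      "\<lambda>i y s. ?K y s * (((x - y) \<bullet> i) / (2 * (t - s))) * \<phi> y + 2 * (y \<bullet> i) * g' ((norm y)\<^sup>2) * ?K y s"
      "\<lambda>i y s. ?K y s * (((x - y) \<bullet> i)\<^sup>2 / (4 * (t - s)\<^sup>2) - 1 / (2 * (t - s))) * \<phi> y
         + 2 * (y \<bullet> i) * g' ((norm y)\<^sup>2) * (?K y s * (((x - y) \<bullet> i) / (2 * (t - s))))
         + ((2 * g' ((norm y)\<^sup>2) + 4 * (y \<bullet> i)\<^sup>2 * g'' ((norm y)\<^sup>2)) * ?K y s
         + ?K y s * (((x - y) \<bullet> i) / (2 * (t - s))) * (2 * (y \<bullet> i) * g' ((norm y)\<^sup>2)))"
    proof
      show "t \<le> 16" using t by simp
      show "?K y s * \<phi> y = 0" if "3 < norm y" for y s using \<phi>_out[OF that] by simp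
      show "0 \<le> ?K y s * \<phi> y" for y s using \<phi> by simp
      show "((\<lambda>s. ?K y s * \<phi> y) has_real_derivative ?K y s * (?n / (2 * (t - s)) - (norm (x - y))\<^sup>2 / (4 * (t - s)\<^sup>2)) * \<phi> y) (at s)"
        if "s \<in> {0<..<t}" for y s
        by (rule DERIV_cmult_right[OF heat_kernel_DERIV_time]) (use that in auto)
      fix i :: 'a assume i: "i \<in> Basis"
      have d\<phi>: "((\<lambda>h. \<phi> (y + h *\<^sub>R i)) has_real_derivative 2 * (y \<bullet> i) * g' ((norm y)\<^sup>2)) (at 0)" for y
        unfolding \<phi>_def by (rule radial_DERIV[OF i dg])
      have [simp]: "y + 0 *\<^sub>R i = y" for y by simp
      show "((\<lambda>h. ?K (y + h *\<^sub>R i) s * \<phi> (y + h *\<^sub>R i)) has_real_derivative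
          ?K y s * (((x - y) \<bullet> i) / (2 * (t - s))) * \<phi> y + 2 * (y \<bullet> i) * g' ((norm y)\<^sup>2) * ?K y s) (at 0)"
        if "s \<in> {0<..<t}" for y s
      proof -
        have "s < t" using that by simp
        then show ?thesis
          by (intro DERIV_cong[OF DERIV_mult[OF heat_kernel_DERIV_space[OF _ i] d\<phi>]]) simp_all
      qed
      show "((\<lambda>h. ?K (y + h *\<^sub>R i) s * (((x - (y + h *\<^sub>R i)) \<bullet> i) / (2 * (t - s))) * \<phi> (y + h *\<^sub>R i)
            + 2 * ((y + h *\<^sub>R i) \<bullet> i) * g' ((norm (y + h *\<^sub>R i))\<^sup>2) * ?K (y + h *\<^sub>R i) s) has_real_derivative
         ?K y s * (((x - y) \<bullet> i)\<^sup>2 / (4 * (t - s)\<^sup>2) - 1 / (2 * (t - s))) * \<phi> y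
         + 2 * (y \<bullet> i) * g' ((norm y)\<^sup>2) * (?K y s * (((x - y) \<bullet> i) / (2 * (t - s))))
         + ((2 * g' ((norm y)\<^sup>2) + 4 * (y \<bullet> i)\<^sup>2 * g'' ((norm y)\<^sup>2)) * ?K y s
         + ?K y s * (((x - y) \<bullet> i) / (2 * (t - s))) * (2 * (y \<bullet> i) * g' ((norm y)\<^sup>2)))) (at 0)"
        if "s \<in> {0<..<t}" for y s
      proof -
        have "s < t" using that by simp
        then show ?thesis
          by (intro DERIV_cong[OF DERIV_add[OF DERIV_mult[OF heat_kernel_DERIV2_space[OF _ i] d\<phi>]
                DERIV_mult[OF radial_DERIV2[OF i dg'] heat_kernel_DERIV_space[OF _ i]]]]) simp_all
      qed
    next
      have c1: "continuous_on (UNIV \<times> {0<..<t}) (\<lambda>p. \<phi> (fst p))"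
        "continuous_on (UNIV \<times> {0<..<t}) (\<lambda>p. g' ((norm (fst p))\<^sup>2))"
        "continuous_on (UNIV \<times> {0<..<t}) (\<lambda>p. g'' ((norm (fst p))\<^sup>2))"
        by (rule continuous_on_compose2[OF \<phi>cont] continuous_on_compose2[OF contg(2)] continuous_on_compose2[OF contg''],
            intro continuous_intros, simp)+
      show "continuous_on (UNIV \<times> {0<..<t}) (\<lambda>p. ?K (fst p) (snd p) * \<phi> (fst p))"
        by (intro continuous_intros contK c1)
      show "continuous_on (UNIV \<times> {0<..<t}) (\<lambda>p. ?K (fst p) (snd p) * (?n / (2 * (t - snd p)) - (norm (x - fst p))\<^sup>2 / (4 * (t - snd p)\<^sup>2)) * \<phi> (fst p))"
        by (intro continuous_intros contK c1) auto
      fix i :: 'a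
      show "continuous_on (UNIV \<times> {0<..<t}) (\<lambda>p. ?K (fst p) (snd p) * (((x - fst p) \<bullet> i) / (2 * (t - snd p))) * \<phi> (fst p)
          + 2 * (fst p \<bullet> i) * g' ((norm (fst p))\<^sup>2) * ?K (fst p) (snd p))"
        by (intro continuous_intros contK c1) auto
      show "continuous_on (UNIV \<times> {0<..<t}) (\<lambda>p. ?K (fst p) (snd p) * (((x - fst p) \<bullet> i)\<^sup>2 / (4 * (t - snd p)\<^sup>2) - 1 / (2 * (t - snd p))) * \<phi> (fst p)
         + 2 * (fst p \<bullet> i) * g' ((norm (fst p))\<^sup>2) * (?K (fst p) (snd p) * (((x - fst p) \<bullet> i) / (2 * (t - snd p))))
         + ((2 * g' ((norm (fst p))\<^sup>2) + 4 * (fst p \<bullet> i)\<^sup>2 * g'' ((norm (fst p))\<^sup>2)) * ?K (fst p) (snd p)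
         + ?K (fst p) (snd p) * (((x - fst p) \<bullet> i) / (2 * (t - snd p))) * (2 * (fst p \<bullet> i) * g' ((norm (fst p))\<^sup>2))))"
        by (intro continuous_intros contK c1) auto
    qed simp_all
    define adj where "adj = T.adj"
    note increment = T.pairing_increment[folded adj_def] and integrable_adj = T.integrable_products(2)[folded adj_def]
    have adj_eq: "adj y s = ?K y s / (t - s) * (2 * g' ((norm y)\<^sup>2) * ((x - y) \<bullet> y) + (t - s) * (2 * ?n * g' ((norm y)\<^sup>2) + 4 * (norm y)\<^sup>2 * g'' ((norm y)\<^sup>2)))"
      if "s < t" for y s
      unfolding adj_def T.adj_def by (rule backward_heat_product_identity) (use that in simp)
    have adj_le: "adj y s * u y s \<le> E * (indicator (cball 0 3) y *\<^sub>R u y s)" if s: "s \<in> {0<..<t}" for y s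
    \<comment> \<open>Outside this range the derivatives of the step vanish and \<open>adj\<close>
      is 0. Inside it \<open>8 \<le> (norm y)^2 \<le> 9\<close>, and \<open>(5/2)^2 < 8\<close>
      separates \<open>y\<close> from \<open>x\<close>, whose norm is at most 2.\<close>
    proof (cases "9 - (norm y)\<^sup>2 \<in> {0..1}")
      case False
      then have "adj y s = 0" using s P(10)[OF False] adj_eq[of s y] by (simp add: g'_def g''_def)
      then show ?thesis using E0 nonneg[of s y] s t by simp
    next
      case True
      then have "(norm y)\<^sup>2 \<le> 3\<^sup>2" "(5/2)\<^sup>2 \<le> (norm y)\<^sup>2" by (auto simp: power2_eq_square)
      then have y: "norm y \<le> 3" "5/2 \<le> norm y" by (auto intro: power2_le_imp_le)
      then have xy: "1/2 \<le> norm (x - y)" "norm (x - y) \<le> 5"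
        using x norm_triangle_ineq2[of y x] norm_triangle_ineq4[of x y] by (auto simp: norm_minus_commute)
      have k: "0 \<le> ?K y s / (t - s)" "?K y s / (t - s) \<le> D" using D(2)[OF _ xy(1), of "t - s"] s by auto
      have i: "\<bar>(x - y) \<bullet> y\<bar> \<le> 15"
        using Cauchy_Schwarz_ineq2[of "x - y" y] mult_mono[OF xy(2) y(1)] by simp
      have g: "\<bar>g' r\<bar> \<le> B" "\<bar>g'' r\<bar> \<le> B" for r using P(8,9) by (auto simp: g'_def g''_def)
      have "\<bar>2 * g' ((norm y)\<^sup>2) * ((x - y) \<bullet> y)\<bar> \<le> 2 * B * 15"
        unfolding abs_mult using g i B0 by (intro mult_mono) auto
      moreover have "\<bar>(t - s) * (2 * ?n * g' ((norm y)\<^sup>2) + 4 * (norm y)\<^sup>2 * g'' ((norm y)\<^sup>2))\<bar> \<le> 1 * (2 * ?n * B + 4 * 9 * B)"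
      proof -
        have "\<bar>2 * ?n * g' ((norm y)\<^sup>2)\<bar> \<le> 2 * ?n * B" unfolding abs_mult using g by (intro mult_mono) auto
        moreover have "\<bar>4 * (norm y)\<^sup>2 * g'' ((norm y)\<^sup>2)\<bar> \<le> 4 * 9 * B"
          unfolding abs_mult using g True by (intro mult_mono) auto
        ultimately have "\<bar>2 * ?n * g' ((norm y)\<^sup>2) + 4 * (norm y)\<^sup>2 * g'' ((norm y)\<^sup>2)\<bar> \<le> 2 * ?n * B + 4 * 9 * B"
          by linarith
        then show ?thesis unfolding abs_mult[of "t - s"] using s t by (intro mult_mono) auto
      qed
      ultimately have Z: "2 * g' ((norm y)\<^sup>2) * ((x - y) \<bullet> y) + (t - s) * (2 * ?n * g' ((norm y)\<^sup>2) + 4 * (norm y)\<^sup>2 * g'' ((norm y)\<^sup>2))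
         \<le> 2 * B * 15 + 1 * (2 * ?n * B + 4 * 9 * B)" (is "?Z \<le> ?W") by (rule add_mono[OF abs_le_D1 abs_le_D1])
      have W: "?W = 30 * B + 2 * ?n * B + 36 * B" by simp
      have "adj y s = ?K y s / (t - s) * ?Z" by (rule adj_eq) (use s in simp)
      also have "\<dots> \<le> ?K y s / (t - s) * ?W" by (rule mult_left_mono[OF Z k(1)])
      also have "\<dots> \<le> D * ?W" by (rule mult_right_mono[OF k(2)]) (use B0 in simp)
      finally have "adj y s \<le> E" unfolding E_def W .
      then show ?thesis using y nonneg[of s y] s t by (auto intro!: mult_right_mono)
    qed
    have slice: "integrable lborel (\<lambda>y. indicator (cball 0 3) y *\<^sub>R u y s)" if "0 < s" "s \<le> 1" for s
      by (rule borel_integrable_compact)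
        (auto intro!: continuous_on_subset[OF continuous_on_slices(1)[where S="{0<..<16}" and s=s and q=u]]
          continuous_on_derivatives simp: case_prod_beta that order.strict_trans1[OF that(2)])
    have mass: "(\<integral>y. indicator (cball 0 3) y *\<^sub>R u y s \<partial>lborel) \<le> A" if "0 < s" "s \<le> 1" for s
    proof -
      have "ennreal (\<integral>y. indicator (cball 0 3) y *\<^sub>R u y s \<partial>lborel) = (\<integral>\<^sup>+y. ennreal (indicator (cball 0 3) y *\<^sub>R u y s) \<partial>lborel)"
        by (rule nn_integral_eq_integral[symmetric, OF slice[OF that]]) (use nonneg[of s] that in auto)
      also have "\<dots> = (\<integral>\<^sup>+y\<in>cball 0 3. ennreal (u y s) \<partial>lborel)"
        by (intro nn_integral_cong) (auto simp: indicator_def)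
      also have "\<dots> \<le> ennreal A" by (rule A(2)[OF that])
      finally show ?thesis using A(1) by simp
    qed
    have "\<phi> x = 1"
    proof -
      have "(norm x)\<^sup>2 \<le> 2\<^sup>2" using x by (intro power_mono) auto
      then show ?thesis unfolding \<phi>_def g_def by (intro P(7)) simp
    qed
    \<comment> \<open>The test ends at a time \<open>s\<close> before the singularity at
      \<open>t\<close>, chosen so that the pairing already dominates
      \<open>c * u x t\<close>.\<close>
    then obtain s where s: "\<tau> < s" "s < t" "ennreal (c * u x t) \<le> (\<integral>\<^sup>+y. ennreal (?K y s * \<phi> y * u y s) \<partial>lborel)"
      using c(2)[of t \<tau> \<phi> x] \<tau> t \<phi>cont by auto
    obtain J where J: "0 \<le> J"
      "ennreal J = (\<integral>\<^sup>+p\<in>UNIV \<times> {\<tau>..s}. ennreal (?K (fst p) (snd p) * \<phi> (fst p) * heat_op u (fst p) (snd p)) \<partial>lborel)"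
      "(\<integral>y. ?K y s * \<phi> y * u y s \<partial>lborel) - (\<integral>y. ?K y \<tau> * \<phi> y * u y \<tau> \<partial>lborel)
         = integral {\<tau>..s} (\<lambda>s. \<integral>y. adj y s * u y s \<partial>lborel) + J"
      "(\<lambda>s. \<integral>y. adj y s * u y s \<partial>lborel) integrable_on {\<tau>..s}"
      by (rule increment[of \<tau> s]) (use s \<tau> in linarith, use s in linarith, use s in linarith, blast)
    have F: "ennreal (\<integral>y. ?K y s * \<phi> y * u y s \<partial>lborel) = (\<integral>\<^sup>+y. ennreal (?K y s * \<phi> y * u y s) \<partial>lborel)"
      "0 \<le> (\<integral>y. ?K y s * \<phi> y * u y s \<partial>lborel)" if "s \<in> {0<..<t}" for s
      using that t nonneg[of s] T.test_nonneg[OF that]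
      by (auto intro!: nn_integral_eq_integral[symmetric] T.integrable_products(1) integral_nonneg_AE)
    have "integral {\<tau>..s} (\<lambda>s. \<integral>y. adj y s * u y s \<partial>lborel) \<le> integral {\<tau>..s} (\<lambda>_. E * A)"
    proof (rule integral_le[OF J(4)])
      fix r assume r: "r \<in> {\<tau>..s}"
      have "(\<integral>y. adj y r * u y r \<partial>lborel) \<le> (\<integral>y. E * (indicator (cball 0 3) y *\<^sub>R u y r) \<partial>lborel)"
        using r s \<tau> t by (intro integral_mono integrable_adj integrable_mult_right slice adj_le) auto
      also have "\<dots> \<le> E * A" using r s \<tau> t E0 mass[of r] by (auto intro!: mult_left_mono)
      finally show "(\<integral>y. adj y r * u y r \<partial>lborel) \<le> E * A" .
    qed (rule integrable_const_ivl)
    also have "\<dots> = (s - \<tau>) * (E * A)" using s by simp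
    also have "\<dots> \<le> 1 * (E * A)"
      by (rule mult_right_mono) (use s \<tau> t E0 A(1) in auto)
    finally have "(\<integral>y. ?K y s * \<phi> y * u y s \<partial>lborel) \<le> (\<integral>y. ?K y \<tau> * \<phi> y * u y \<tau> \<partial>lborel) + E * A + J"
      using J(3) by linarith
    then have "ennreal (\<integral>y. ?K y s * \<phi> y * u y s \<partial>lborel) \<le> ennreal ((\<integral>y. ?K y \<tau> * \<phi> y * u y \<tau> \<partial>lborel) + E * A + J)"
      by (rule ennreal_leI)
    also have "\<dots> = ennreal (\<integral>y. ?K y \<tau> * \<phi> y * u y \<tau> \<partial>lborel) + ennreal (E * A) + ennreal J"
      using F(2)[of \<tau>] J(1) E0 A(1) \<tau> by (simp add: ennreal_plus)
    finally have "ennreal (c * u x t) \<le> (\<integral>\<^sup>+y. ennreal (?K y \<tau> * \<phi> y * u y \<tau>) \<partial>lborel) + ennreal (E * A) + ennreal J"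
      using s F(1)[of s] F(1)[of \<tau>] \<tau> by simp
    also have "\<dots> \<le> (\<integral>\<^sup>+y\<in>cball 0 3. ennreal (?K y \<tau> * u y \<tau>) \<partial>lborel) + ennreal (E * A)
      + (\<integral>\<^sup>+p\<in>cball 0 3 \<times> {0<..<1}. ennreal (?K (fst p) (snd p) * heat_op u (fst p) (snd p)) \<partial>lborel)"
      unfolding J(2)
    proof (intro add_mono nn_integral_mono order_refl)
      fix y :: 'a
      have "?K y \<tau> * \<phi> y * u y \<tau> \<le> ?K y \<tau> * 1 * u y \<tau>"
        using \<phi>[of y] nonneg[of \<tau> y] \<tau> t by (intro mult_right_mono mult_left_mono) auto
      then show "ennreal (?K y \<tau> * \<phi> y * u y \<tau>) \<le> ennreal (?K y \<tau> * u y \<tau>) * indicator (cball 0 3) y"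
        using \<phi>_out[of y] by (cases "norm y \<le> 3") (auto intro: ennreal_leI)
    next
      fix p :: "'a \<times> real"
      have "?K y r * \<phi> y * heat_op u y r \<le> ?K y r * 1 * heat_op u y r" if "r \<in> {\<tau>..s}" "norm y \<le> 3" for y r
        using \<phi>[of y] that s \<tau> t by (intro mult_right_mono mult_left_mono heat_op_nonneg) auto
      then show "ennreal (?K (fst p) (snd p) * \<phi> (fst p) * heat_op u (fst p) (snd p)) * indicator (UNIV \<times> {\<tau>..s}) p
        \<le> ennreal (?K (fst p) (snd p) * heat_op u (fst p) (snd p)) * indicator (cball 0 3 \<times> {0<..<1}) p"
        using \<phi>_out[of "fst p"] s \<tau> t by (cases p, cases "norm (fst p) \<le> 3") (auto simp: indicator_def intro: ennreal_leI)
    qed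
    finally show ?thesis .
  qed
  show thesis
  \<comment> \<open>Division by \<open>c\<close> undoes the averaging constant, and the error
    \<open>E * A\<close> merges with the leading 1.\<close>
  proof (rule that[of "(1 + E * A) / c"])
    show "0 < (1 + E * A) / c" using c E0 A by (simp add: add_pos_nonneg)
    fix x :: 'a and \<tau> t :: real assume *: "norm x \<le> 2" "0 < \<tau>" "\<tau> < t" "t \<le> 1"
    let ?X = "\<integral>\<^sup>+y\<in>cball 0 3. ennreal (heat_kernel (x - y) (t - \<tau>) * u y \<tau>) \<partial>lborel"
    let ?Y = "\<integral>\<^sup>+p\<in>cball 0 3 \<times> {0<..<1}. ennreal (heat_kernel (x - fst p) (t - snd p) * heat_op u (fst p) (snd p)) \<partial>lborel"
    have EA: "0 \<le> E * A" using E0 A by simp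
    have "ennreal (u x t) = ennreal (1 / c) * ennreal (c * u x t)"
      using c nonneg[of t x] * by (simp flip: ennreal_mult)
    also have "\<dots> \<le> ennreal (1 / c) * (?X + ennreal (E * A) + ?Y)"
      by (intro mult_left_mono bound *) simp
    also have "\<dots> \<le> ennreal (1 / c) * (ennreal (1 + E * A) * (1 + ?X + ?Y))"
    proof (rule mult_left_mono)
      show "?X + ennreal (E * A) + ?Y \<le> ennreal (1 + E * A) * (1 + ?X + ?Y)"
      proof -
        have "1 \<le> ennreal (1 + E * A)" using EA by simp
        then have "?X + ?Y \<le> ennreal (1 + E * A) * (?X + ?Y)"
          using mult_right_mono[of 1 "ennreal (1 + E * A)" "?X + ?Y"] by simp
        moreover have "ennreal (E * A) \<le> ennreal (1 + E * A)" using EA by (intro ennreal_leI) auto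
        ultimately have "ennreal (E * A) + (?X + ?Y) \<le> ennreal (1 + E * A) + ennreal (1 + E * A) * (?X + ?Y)"
          by (intro add_mono)
        then show ?thesis by (simp add: distrib_left add_ac)
      qed
    qed simp
    also have "\<dots> = ennreal (1 / c) * ennreal (1 + E * A) * (1 + ?X + ?Y)" by (simp only: mult.assoc)
    also have "ennreal (1 / c) * ennreal (1 + E * A) = ennreal ((1 + E * A) / c)"
      using c(1) EA by (subst ennreal_mult[symmetric]) auto
    finally show "ennreal (u x t) \<le> ennreal ((1 + E * A) / c) * (1 + ?X + ?Y)" .
  qed
qed

end

section \<open>Local integrability\<close>

text \<open>Tonelli's theorem and translation invariance. The map \<open>c\<close> covers two kinds
  of potential: of a measure on one time slice, with \<open>c y = (y, \<tau>)\<close>, and of a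
  space-time density, with \<open>c\<close> the identity.\<close>

lemma nn_integral_translated_kernel:
  fixes k :: "'b::euclidean_space \<Rightarrow> ennreal" and c :: "'c::euclidean_space \<Rightarrow> 'b"
  assumes [measurable]: "k \<in> borel_measurable borel" "c \<in> borel_measurable borel" "h \<in> borel_measurable borel"
  shows "(\<integral>\<^sup>+z. (\<integral>\<^sup>+w. k (z - c w) * h w \<partial>lborel) \<partial>lborel) = (\<integral>\<^sup>+z. k z \<partial>lborel) * (\<integral>\<^sup>+w. h w \<partial>lborel)"
proof -
  have "(\<integral>\<^sup>+z. (\<integral>\<^sup>+w. k (z - c w) * h w \<partial>lborel) \<partial>lborel) = (\<integral>\<^sup>+w. (\<integral>\<^sup>+z. k (z - c w) * h w \<partial>lborel) \<partial>lborel)"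
    by (rule lborel_pair.Fubini'[symmetric]) measurable
  also have "\<dots> = (\<integral>\<^sup>+w. (\<integral>\<^sup>+z. k z \<partial>lborel) * h w \<partial>lborel)"
    by (intro nn_integral_cong, subst nn_integral_multc)
      (use lborel_nn_integral_translate[OF assms(1)] in \<open>auto simp: diff_conv_add_uminus simp del: add_uminus_conv_diff\<close>)
  finally show ?thesis by (simp add: nn_integral_cmult)
qed

text \<open>Above the level \<open>m\<close> one has \<open>1 \<le> (z / m)^(p - 1)\<close>. The
  level stays free so that it can later be tied to the value being estimated.\<close>

lemma le_add_powr_split:
  fixes z m p :: real
  assumes "0 \<le> z" "0 < m" "1 \<le> p"
  shows "z \<le> m + m powr (1 - p) * z powr p"
proof (cases "z \<le> m")
  case True
  then show ?thesis by (simp add: add_increasing2)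
next
  case False
  then have "m powr (p - 1) \<le> z powr (p - 1)" using assms by (intro powr_mono2) auto
  then have "z * m powr (p - 1) \<le> z * z powr (p - 1)" using assms by (intro mult_left_mono) auto
  also have "z * z powr (p - 1) = z powr p" using False assms by (simp add: powr_diff)
  finally have "m powr (1 - p) * (z * m powr (p - 1)) \<le> m powr (1 - p) * z powr p"
    by (intro mult_left_mono) auto
  also have "m powr (1 - p) * (z * m powr (p - 1)) = z"
    using assms by (simp add: powr_diff)
  finally show ?thesis using assms by linarith
qed

text \<open>With \<open>m = a / (8 * C * A)\<close> the term linear in \<open>m\<close> equals
  \<open>a / 4\<close>, and for \<open>a > 4 * C\<close> the constant is below \<open>a / 4\<close>;
  the rest bounds \<open>a / 2\<close>. This does the work of Jensen's inequality for potentials of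
  finite measures.\<close>

lemma powr_bound_by_absorption:
  fixes a C A p j :: real
  assumes "0 < C" "0 < A" "1 \<le> p" "0 \<le> a" "0 \<le> j"
    and le: "\<And>m. 0 < m \<Longrightarrow> a \<le> C * (1 + 2 * (m * A) + m powr (1 - p) * j)"
  shows "a powr p \<le> ((4 * C) powr p + 2 * C * (8 * C * A) powr (p - 1)) * (1 + j)"
proof -
  have nn: "0 \<le> (4 * C) powr p" "0 \<le> 2 * C * (8 * C * A) powr (p - 1)" using assms by auto
  show ?thesis
  proof (cases "a \<le> 4 * C")
    case True
    then have "a powr p \<le> (4 * C) powr p" using assms by (intro powr_mono2) auto
    also have "\<dots> \<le> ((4 * C) powr p + 2 * C * (8 * C * A) powr (p - 1)) * 1" using nn by simp
    also have "\<dots> \<le> ((4 * C) powr p + 2 * C * (8 * C * A) powr (p - 1)) * (1 + j)"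
      by (rule mult_left_mono) (use nn assms in auto)
    finally show ?thesis .
  next
    case False
    define q where "q = 8 * C * A"
    have q: "0 < q" using assms by (simp add: q_def)
    define m where "m = a / q"
    have a: "0 < a" using False assms by linarith
    have m: "0 < m" using a q by (simp add: m_def)
    have "C * (2 * (m * A)) = a / 4" using assms by (simp add: m_def q_def)
    then have "a / 2 \<le> C * (m powr (1 - p) * j)"
      using le[OF m] False by (simp add: distrib_left)
    then have "a / 2 * m powr (p - 1) \<le> C * (m powr (1 - p) * j) * m powr (p - 1)"
      by (intro mult_right_mono) auto
    also have "\<dots> = C * j" using m by (simp add: powr_diff)
    finally have "a * m powr (p - 1) \<le> 2 * C * j" by simp
    moreover have "a * m powr (p - 1) = a powr p / q powr (p - 1)"
      using a q by (simp add: m_def powr_divide powr_diff)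
    ultimately have "a powr p \<le> 2 * C * q powr (p - 1) * j"
      using q by (simp add: field_simps)
    also have "\<dots> \<le> ((4 * C) powr p + 2 * C * q powr (p - 1)) * (1 + j)"
      using nn assms(5) unfolding q_def by (intro mult_mono) auto
    finally show ?thesis by (simp add: q_def)
  qed
qed

lemma nn_integral_split_powr:
  fixes z w :: "'b::euclidean_space \<Rightarrow> real"
  assumes [measurable]: "z \<in> borel_measurable borel" "(\<lambda>y. ennreal (w y) * indicator S y) \<in> borel_measurable borel"
    and z: "\<And>y. 0 \<le> z y" and m: "0 < m" and p: "1 \<le> p"
    and A: "(\<integral>\<^sup>+y\<in>S. ennreal (w y) \<partial>lborel) \<le> ennreal A"
  shows "(\<integral>\<^sup>+y\<in>S. ennreal (z y * w y) \<partial>lborel)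
    \<le> ennreal m * ennreal A + ennreal (m powr (1 - p)) * (\<integral>\<^sup>+y. ennreal (z y powr p) * (ennreal (w y) * indicator S y) \<partial>lborel)"
proof -
  have "(\<integral>\<^sup>+y\<in>S. ennreal (z y * w y) \<partial>lborel) = (\<integral>\<^sup>+y. ennreal (z y) * (ennreal (w y) * indicator S y) \<partial>lborel)"
    using z by (simp add: ennreal_mult' mult.assoc)
  also have "\<dots> \<le> (\<integral>\<^sup>+y. (ennreal m + ennreal (m powr (1 - p)) * ennreal (z y powr p)) * (ennreal (w y) * indicator S y) \<partial>lborel)"
  proof (intro nn_integral_mono mult_right_mono)
    fix y
    have "ennreal (z y) \<le> ennreal (m + m powr (1 - p) * z y powr p)"
      by (intro ennreal_leI le_add_powr_split z m p)
    then show "ennreal (z y) \<le> ennreal m + ennreal (m powr (1 - p)) * ennreal (z y powr p)"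
      using m by (simp add: ennreal_mult')
  qed simp
  also have "\<dots> = ennreal m * (\<integral>\<^sup>+y\<in>S. ennreal (w y) \<partial>lborel)
      + ennreal (m powr (1 - p)) * (\<integral>\<^sup>+y. ennreal (z y powr p) * (ennreal (w y) * indicator S y) \<partial>lborel)"
    by (simp add: distrib_right nn_integral_add nn_integral_cmult mult.assoc)
  also have "\<dots> \<le> ennreal m * ennreal A + ennreal (m powr (1 - p)) * (\<integral>\<^sup>+y. ennreal (z y powr p) * (ennreal (w y) * indicator S y) \<partial>lborel)"
    by (intro add_right_mono mult_left_mono A) simp
  finally show ?thesis .
qed

context heat_supersolution
begin

lemma measurable_u:
  "(\<lambda>p. ennreal (u (fst p) (snd p) powr q) * indicator (cball 0 r \<times> {0<..<1}) p) \<in> borel_measurable borel"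
  "(\<lambda>p. ennreal (heat_op u (fst p) (snd p)) * indicator (cball 0 r \<times> {0<..<1}) p) \<in> borel_measurable borel"
proof -
  have S: "cball (0::'a) r \<times> {0<..<1::real} \<in> sets borel" by (simp add: borel_prod[symmetric])
  show "(\<lambda>p. ennreal (heat_op u (fst p) (snd p)) * indicator (cball 0 r \<times> {0<..<1}) p) \<in> borel_measurable borel"
    by (rule borel_measurable_restrict_continuous[OF _ S], rule continuous_on_derivatives) auto
  have "(\<lambda>p. indicator (cball 0 r \<times> {0<..<1}) p *\<^sub>R u (fst p) (snd p)) \<in> borel_measurable borel"
    by (rule borel_measurable_continuous_on_indicator[OF S], rule continuous_on_derivatives) auto
  then have "(\<lambda>p. ennreal ((indicator (cball 0 r \<times> {0<..<1}) p *\<^sub>R u (fst p) (snd p)) powr q)) \<in> borel_measurable borel"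
    by measurable
  moreover have "(\<lambda>p. ennreal ((indicator (cball 0 r \<times> {0<..<1}) p *\<^sub>R u (fst p) (snd p)) powr q))
     = (\<lambda>p. ennreal (u (fst p) (snd p) powr q) * indicator (cball 0 r \<times> {0<..<1}) p)"
    by (auto simp: indicator_def)
  ultimately show "(\<lambda>p. ennreal (u (fst p) (snd p) powr q) * indicator (cball 0 r \<times> {0<..<1}) p) \<in> borel_measurable borel"
    by (simp only:)
qed

lemma measurable_u_slice:
  assumes "0 < s" "s < 16"
  shows "(\<lambda>y. ennreal (u y s) * indicator (cball 0 r) y) \<in> borel_measurable borel"
proof (rule borel_measurable_restrict_continuous)
  have "continuous_on UNIV (\<lambda>y. u y s)"
    by (rule continuous_on_slices(1)[where S="{0<..<16}"])
      (use assms continuous_on_derivatives(1) in \<open>auto simp: case_prod_beta\<close>)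
  then show "continuous_on (cball 0 r) (\<lambda>y. u y s)" by (rule continuous_on_subset) simp
qed simp

text \<open>The potential of a finite measure inherits the space-time integrability of
  \<open>\<Phi>^p\<close>. The slice measure at time \<open>\<tau>\<close> has mass bounded
  independently of \<open>\<tau>\<close>, so the estimate survives \<open>\<tau>\<close> tending to
  0.\<close>

lemma local_Lp_bound:
  assumes p: "1 \<le> p" "p < (real DIM('a) + 2) / real DIM('a)"
  shows "(\<integral>\<^sup>+z\<in>cball 0 2 \<times> {0<..<1}. ennreal (u (fst z) (snd z) powr p) \<partial>lborel) < \<infinity>"
proof -
  obtain A where A: "0 < A" "\<And>s. 0 < s \<Longrightarrow> s \<le> 1 \<Longrightarrow> (\<integral>\<^sup>+y\<in>cball 0 3. ennreal (u y s) \<partial>lborel) \<le> ennreal A"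
    "(\<integral>\<^sup>+p\<in>cball 0 3 \<times> {0<..<1}. ennreal (heat_op u (fst p) (snd p)) \<partial>lborel) \<le> ennreal A"
    by (rule mass_bounds) blast
  obtain C where C: "0 < C" "\<And>x \<tau> t. norm x \<le> 2 \<Longrightarrow> 0 < \<tau> \<Longrightarrow> \<tau> < t \<Longrightarrow> t \<le> 1 \<Longrightarrow>
    ennreal (u x t) \<le> ennreal C * (1 + (\<integral>\<^sup>+y\<in>cball 0 3. ennreal (heat_kernel (x - y) (t - \<tau>) * u y \<tau>) \<partial>lborel)
      + (\<integral>\<^sup>+p\<in>cball 0 3 \<times> {0<..<1}. ennreal (heat_kernel (x - fst p) (t - snd p) * heat_op u (fst p) (snd p)) \<partial>lborel))"
    by (rule representation_bound) blast
  \<comment> \<open>All positive time lags that occur are below 1, so the truncation loses nothing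
    and makes the total integral finite.\<close>
  define k :: "'a \<times> real \<Rightarrow> ennreal" where
    "k z = ennreal (heat_kernel (fst z) (snd z) powr p) * indicator (UNIV \<times> {0<..<1}) z" for z
  have [measurable]: "UNIV \<times> {0<..<1::real} \<in> sets (borel :: ('a \<times> real) measure)"
    by (intro borel_open open_Times) auto
  have km[measurable]: "k \<in> borel_measurable borel" unfolding k_def by measurable
  define G where "G = (\<integral>\<^sup>+z. k z \<partial>lborel)"
  have G: "G < \<infinity>"
    unfolding G_def k_def by (rule nn_integral_heat_kernel_powr_space_time_finite) (use p in auto)
  define h1 where "h1 \<tau> y = ennreal (u y \<tau>) * indicator (cball 0 3) y" for \<tau> y
  define h2 where "h2 q = ennreal (heat_op u (fst q) (snd q)) * indicator (cball 0 3 \<times> {0<..<1}) q" for q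
  have h1[measurable]: "h1 \<tau> \<in> borel_measurable borel" if "0 < \<tau>" "\<tau> < 1" for \<tau>
    unfolding h1_def by (rule measurable_u_slice) (use that in auto)
  have h2[measurable]: "h2 \<in> borel_measurable borel" unfolding h2_def by (rule measurable_u(2))
  define J1 where "J1 \<tau> z = (\<integral>\<^sup>+y. k (z - (y, \<tau>)) * h1 \<tau> y \<partial>lborel)" for \<tau> z
  define J2 where "J2 z = (\<integral>\<^sup>+q. k (z - q) * h2 q \<partial>lborel)" for z
  have J1m[measurable]: "J1 \<tau> \<in> borel_measurable borel" if "0 < \<tau>" "\<tau> < 1" for \<tau>
    unfolding J1_def using h1[OF that] by measurable
  have J2m[measurable]: "J2 \<in> borel_measurable borel"
    unfolding J2_def by measurable
  have intJ1: "(\<integral>\<^sup>+z. J1 \<tau> z \<partial>lborel) \<le> G * ennreal A" if "0 < \<tau>" "\<tau> < 1" for \<tau>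
  proof -
    have "(\<integral>\<^sup>+z. J1 \<tau> z \<partial>lborel) = G * (\<integral>\<^sup>+y. h1 \<tau> y \<partial>lborel)"
      unfolding J1_def G_def by (rule nn_integral_translated_kernel[OF km borel_measurable_continuous_onI h1[OF that]]) (intro continuous_intros)
    also have "\<dots> \<le> G * ennreal A" unfolding h1_def using A(2)[of \<tau>] that by (intro mult_left_mono) auto
    finally show ?thesis .
  qed
  have intJ2: "(\<integral>\<^sup>+z. J2 z \<partial>lborel) \<le> G * ennreal A"
  proof -
    have "(\<integral>\<^sup>+z. J2 z \<partial>lborel) = G * (\<integral>\<^sup>+q. h2 q \<partial>lborel)"
      unfolding J2_def G_def by (intro nn_integral_translated_kernel) auto
    also have "\<dots> \<le> G * ennreal A" unfolding h2_def using A(3) by (intro mult_left_mono) auto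
    finally show ?thesis .
  qed
  define D where "D = (4 * C) powr p + 2 * C * (8 * C * A) powr (p - 1)"
  have D: "0 \<le> D" using C by (simp add: D_def)
  have pointwise: "ennreal (u x t powr p) \<le> ennreal D * (1 + (J1 \<tau> (x, t) + J2 (x, t)))"
    if x: "norm x \<le> 2" and \<tau>: "0 < \<tau>" "\<tau> < t" and t: "t < 1" for x \<tau> t
  proof (cases "J1 \<tau> (x, t) + J2 (x, t) = \<infinity>")
    case True
    \<comment> \<open>In \<open>ennreal\<close> the product of 0 and infinity is 0, so the trivial
      case requires strict positivity of \<open>D\<close>.\<close>
    have "0 < D" using C A by (simp add: D_def add_pos_pos)
    then show ?thesis unfolding True by (simp add: ennreal_mult_top)
  next
    case False
    then obtain j where j: "0 \<le> j" "J1 \<tau> (x, t) + J2 (x, t) = ennreal j"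
      by (cases "J1 \<tau> (x, t) + J2 (x, t)") auto
    have "u x t \<le> C * (1 + 2 * (m * A) + m powr (1 - p) * j)" if m: "0 < m" for m
    proof -
      let ?X1 = "\<integral>\<^sup>+y\<in>cball 0 3. ennreal (heat_kernel (x - y) (t - \<tau>) * u y \<tau>) \<partial>lborel"
      let ?X2 = "\<integral>\<^sup>+p\<in>cball 0 3 \<times> {0<..<1}. ennreal (heat_kernel (x - fst p) (t - snd p) * heat_op u (fst p) (snd p)) \<partial>lborel"
      have hk1: "(\<lambda>y. heat_kernel (x - y) (t - \<tau>)) \<in> borel_measurable borel"
        unfolding heat_kernel_def by measurable
      have hk2: "(\<lambda>q. heat_kernel (x - fst q) (t - snd q)) \<in> borel_measurable borel"
        unfolding heat_kernel_def borel_prod[symmetric] by measurable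
      have "?X1 \<le> ennreal m * ennreal A + ennreal (m powr (1 - p)) *
          (\<integral>\<^sup>+y. ennreal (heat_kernel (x - y) (t - \<tau>) powr p) * (ennreal (u y \<tau>) * indicator (cball 0 3) y) \<partial>lborel)"
        by (rule nn_integral_split_powr[OF hk1 measurable_u_slice _ m p(1) A(2)]) (use \<tau> t in auto)
      also have "(\<integral>\<^sup>+y. ennreal (heat_kernel (x - y) (t - \<tau>) powr p) * (ennreal (u y \<tau>) * indicator (cball 0 3) y) \<partial>lborel) = J1 \<tau> (x, t)"
        unfolding J1_def h1_def k_def using \<tau> t by (intro nn_integral_cong) auto
      finally have 1: "?X1 \<le> ennreal m * ennreal A + ennreal (m powr (1 - p)) * J1 \<tau> (x, t)" .
      have "?X2 \<le> ennreal m * ennreal A + ennreal (m powr (1 - p)) *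
          (\<integral>\<^sup>+q. ennreal (heat_kernel (x - fst q) (t - snd q) powr p) * (ennreal (heat_op u (fst q) (snd q)) * indicator (cball 0 3 \<times> {0<..<1}) q) \<partial>lborel)"
        by (rule nn_integral_split_powr[OF hk2 measurable_u(2) _ m p(1) A(3)]) auto
      also have "(\<integral>\<^sup>+q. ennreal (heat_kernel (x - fst q) (t - snd q) powr p) * (ennreal (heat_op u (fst q) (snd q)) * indicator (cball 0 3 \<times> {0<..<1}) q) \<partial>lborel) = J2 (x, t)"
        unfolding J2_def h2_def k_def using t by (intro nn_integral_cong) (auto simp: indicator_def)
      finally have 2: "?X2 \<le> ennreal m * ennreal A + ennreal (m powr (1 - p)) * J2 (x, t)" .
      have "ennreal (u x t) \<le> ennreal C * (1 + ?X1 + ?X2)" using C(2)[OF x \<tau>] t by simp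
      also have "\<dots> \<le> ennreal C * (1 + (ennreal m * ennreal A + ennreal (m powr (1 - p)) * J1 \<tau> (x, t))
         + (ennreal m * ennreal A + ennreal (m powr (1 - p)) * J2 (x, t)))"
        by (intro mult_left_mono add_mono 1 2) auto
      also have "\<dots> = ennreal C * (1 + (ennreal m * ennreal A + ennreal m * ennreal A)
         + ennreal (m powr (1 - p)) * (J1 \<tau> (x, t) + J2 (x, t)))"
        by (simp add: distrib_left add_ac)
      also have "\<dots> = ennreal (C * (1 + 2 * (m * A) + m powr (1 - p) * j))"
      proof -
        have *: "ennreal (1 + 2 * a + b) = 1 + (ennreal a + ennreal a) + ennreal b" if "0 \<le> a" "0 \<le> b" for a b
        proof -
          have "ennreal (1 + 2 * a + b) = ennreal (1 + (a + a) + b)" by (simp only: mult_2)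
          also have "\<dots> = ennreal 1 + (ennreal a + ennreal a) + ennreal b"
            using that by (simp only: ennreal_plus add_nonneg_nonneg zero_le_one)
          finally show ?thesis by simp
        qed
        have "ennreal (C * (1 + 2 * (m * A) + m powr (1 - p) * j)) = ennreal C * ennreal (1 + 2 * (m * A) + m powr (1 - p) * j)"
          using C(1) by (simp only: ennreal_mult' less_imp_le)
        then show ?thesis unfolding j(2) using m A j by (subst (asm) *) (simp_all add: ennreal_mult')
      qed
      finally show ?thesis
        using C(1) m A(1) j(1) by (subst (asm) ennreal_le_iff) (auto intro!: mult_nonneg_nonneg add_nonneg_nonneg)
    qed
    then have "u x t powr p \<le> D * (1 + j)"
      unfolding D_def using C(1) A(1) p(1) j(1) nonneg[of t x] \<tau> t by (intro powr_bound_by_absorption) auto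
    then have "ennreal (u x t powr p) \<le> ennreal (D * (1 + j))" by (rule ennreal_leI)
    also have "\<dots> = ennreal D * (1 + ennreal j)" using j D by (simp add: ennreal_mult')
    finally show ?thesis unfolding j(2) .
  qed
  define V where "V = emeasure lborel (cball (0::'a) 2 \<times> {0<..<1::real})"
  have V: "V < \<infinity>"
    unfolding V_def by (intro emeasure_bounded_finite bounded_Times) auto
  have Sm[measurable]: "cball (0::'a) 2 \<times> {0<..<1::real} \<in> sets borel" by (simp add: borel_prod[symmetric])
  have "(\<integral>\<^sup>+z\<in>cball 0 2 \<times> {0<..<1}. ennreal (u (fst z) (snd z) powr p) \<partial>lborel) \<le> ennreal D * (V + (G * ennreal A + G * ennreal A))"
  proof (rule nn_integral_time_exhaustion)
    show "(\<lambda>q. ennreal (u (fst q) (snd q) powr p) * indicator (cball 0 2 \<times> {0<..<1}) q) \<in> borel_measurable borel"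
      by (rule measurable_u(1))
    fix \<tau> :: real assume \<tau>: "0 < \<tau>" "\<tau> < 1"
    note [measurable] = J1m[OF \<tau>]
    have "(\<integral>\<^sup>+z\<in>cball 0 2 \<times> {\<tau><..<1}. ennreal (u (fst z) (snd z) powr p) \<partial>lborel)
      \<le> (\<integral>\<^sup>+z. ennreal D * (indicator (cball 0 2 \<times> {0<..<1}) z + (J1 \<tau> z + J2 z)) \<partial>lborel)"
    proof (rule nn_integral_mono)
      fix z :: "'a \<times> real"
      show "ennreal (u (fst z) (snd z) powr p) * indicator (cball 0 2 \<times> {\<tau><..<1}) z
        \<le> ennreal D * (indicator (cball 0 2 \<times> {0<..<1}) z + (J1 \<tau> z + J2 z))"
        using pointwise[of "fst z" \<tau> "snd z"] \<tau> by (cases z) (auto simp: indicator_def)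
    qed
    also have "\<dots> = ennreal D * (V + ((\<integral>\<^sup>+z. J1 \<tau> z \<partial>lborel) + (\<integral>\<^sup>+z. J2 z \<partial>lborel)))"
      unfolding V_def by (simp add: nn_integral_cmult nn_integral_add)
    also have "\<dots> \<le> ennreal D * (V + (G * ennreal A + G * ennreal A))"
      by (intro mult_left_mono add_mono intJ1[OF \<tau>] intJ2) auto
    finally show "(\<integral>\<^sup>+z\<in>cball 0 2 \<times> {\<tau><..<1}. ennreal (u (fst z) (snd z) powr p) \<partial>lborel) \<le> ennreal D * (V + (G * ennreal A + G * ennreal A))" .
  qed
  also have "\<dots> < \<infinity>" using V G by (simp add: ennreal_mult_less_top)
  finally show ?thesis .
qed

end

section \<open>The nonlocal factor\<close>

lemma lborel_nn_integral_reflect: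
  fixes g :: "'a::euclidean_space \<Rightarrow> ennreal"
  assumes [measurable]: "g \<in> borel_measurable borel"
  shows "(\<integral>\<^sup>+x. g (c - x) \<partial>lborel) = (\<integral>\<^sup>+x. g x \<partial>lborel)"
proof -
  have "lborel = density (distr lborel borel (\<lambda>x::'a. c + (-1) *\<^sub>R x)) (\<lambda>_. ennreal (\<bar>-1\<bar> ^ DIM('a)))"
    by (rule lborel_affine) simp
  then have "lborel = distr lborel borel (\<lambda>x::'a. c - x)" by (simp add: density_1)
  then have "(\<integral>\<^sup>+x. g x \<partial>lborel) = (\<integral>\<^sup>+x. g x \<partial>distr lborel borel (\<lambda>x::'a. c - x))" by (simp only:)
  also have "\<dots> = (\<integral>\<^sup>+x. g (c - x) \<partial>lborel)" by (rule nn_integral_distr) auto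
  finally show ?thesis ..
qed

text \<open>A crude Young inequality: both factors are at most the corresponding power of
  \<open>max X Y\<close>, and the exponents add up to 1.\<close>

lemma powr_mult_powr_le_add:
  fixes X Y r q :: real
  assumes "0 \<le> X" "0 \<le> Y" "0 < r" "0 < q" "r + q = 1"
  shows "X powr r * Y powr q \<le> X + Y"
proof -
  define M where "M = max X Y"
  have "X powr r * Y powr q \<le> M powr r * M powr q"
    using assms by (intro mult_mono powr_mono2) (auto simp: M_def)
  also have "\<dots> = M" using assms by (simp add: powr_add[symmetric] M_def max_def)
  also have "\<dots> \<le> X + Y" using assms by (simp add: M_def)
  finally show ?thesis .
qed

lemma powr_le_one_add_powr:
  fixes v :: real
  assumes "0 \<le> v" "0 \<le> p" "p \<le> q"
  shows "v powr p \<le> 1 + v powr q"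
proof (cases "v \<le> 1")
  case True
  then have "v powr p \<le> 1" using assms by (intro powr_le1) auto
  then show ?thesis by (simp add: add_increasing2)
next
  case False
  then have "v powr p \<le> v powr q" using assms by (intro powr_mono) auto
  then show ?thesis by simp
qed

text \<open>Continuity from above of a finite measure along the layers
  \<open>(0, 1 / (k + 4))\<close>, whose intersection is empty because time 0 is excluded.\<close>

lemma nn_integral_small_initial_layer:
  fixes h :: "'a::euclidean_space \<times> real \<Rightarrow> ennreal"
  assumes m: "(\<lambda>p. h p * indicator (S \<times> {0<..<1}) p) \<in> borel_measurable borel"
    and fin: "(\<integral>\<^sup>+p\<in>S \<times> {0<..<1}. h p \<partial>lborel) < \<infinity>" and "0 < \<epsilon>"
  obtains T where "0 < T" "T \<le> 1/4" "(\<integral>\<^sup>+p\<in>S \<times> {0<..<T}. h p \<partial>lborel) \<le> ennreal \<epsilon>"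
proof -
  let ?g = "\<lambda>p. h p * indicator (S \<times> {0<..<1}) p"
  let ?A = "\<lambda>k::nat. (UNIV :: 'a set) \<times> {0<..<1 / (real k + 4)}"
  let ?M = "density lborel ?g"
  have A: "?A k \<in> sets borel" for k by (intro borel_open open_Times) auto
  have em: "emeasure ?M (?A k) = (\<integral>\<^sup>+p\<in>S \<times> {0<..<1 / (real k + 4)}. h p \<partial>lborel)" for k
  proof -
    have lt: "1 / (real k + 4) < 1" by simp
    have "emeasure ?M (?A k) = (\<integral>\<^sup>+p. ?g p * indicator (?A k) p \<partial>lborel)"
      by (rule emeasure_density) (use m A in simp_all)
    also have "\<dots> = (\<integral>\<^sup>+p\<in>S \<times> {0<..<1 / (real k + 4)}. h p \<partial>lborel)"
    proof (rule nn_integral_cong)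
      fix p :: "'a \<times> real"
      have "b < 1" if "b < 1 / (real k + 4)" for b using that lt by (rule less_trans)
      then have "(indicator (S \<times> {0<..<1}) p * indicator (?A k) p :: ennreal) = indicator (S \<times> {0<..<1 / (real k + 4)}) p"
        by (cases p) (auto simp: indicator_def)
      then show "?g p * indicator (?A k) p = h p * indicator (S \<times> {0<..<1 / (real k + 4)}) p"
        by (simp only: mult.assoc)
    qed
    finally show ?thesis .
  qed
  have "(\<lambda>k. emeasure ?M (?A k)) \<longlonglongrightarrow> emeasure ?M (\<Inter>k. ?A k)"
  proof (rule Lim_emeasure_decseq)
    show "range ?A \<subseteq> sets ?M" using A by auto
    show "decseq ?A" by (intro decseq_SucI) (auto intro: less_le_trans simp: field_simps)
    fix k
    have "emeasure ?M (?A k) \<le> emeasure ?M (space ?M)" by (rule emeasure_space)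
    also have "\<dots> = (\<integral>\<^sup>+p. ?g p * indicator UNIV p \<partial>lborel)"
      using m by (subst emeasure_density) auto
    also have "\<dots> < \<infinity>" using fin by simp
    finally show "emeasure ?M (?A k) \<noteq> \<infinity>" by simp
  qed
  moreover have "(\<Inter>k. ?A k) = {}"
  proof -
    have small: "\<exists>k::nat. 1 / (real k + 4) \<le> b" if "0 < b" for b :: real
    proof -
      obtain k :: nat where "1 / b < real k" using reals_Archimedean2 by blast
      then have "1 < real k * b" using that by (simp add: field_simps)
      then have "1 \<le> (real k + 4) * b" using that by (simp add: distrib_right)
      then show ?thesis using that by (intro exI[of _ k]) (simp add: field_simps)
    qed
    show ?thesis
    proof (rule equals0I)
      fix z assume z: "z \<in> (\<Inter>k. ?A k)"
      then have "z \<in> ?A 0" by blast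
      then have "0 < snd z" by (simp add: mem_Times_iff)
      then obtain k :: nat where k: "1 / (real k + 4) \<le> snd z" using small by blast
      have "z \<in> ?A k" using z by blast
      then show False using k by (simp add: mem_Times_iff)
    qed
  qed
  ultimately have "(\<lambda>k. emeasure ?M (?A k)) \<longlonglongrightarrow> 0" by simp
  then have "\<forall>\<^sub>F k in sequentially. emeasure ?M (?A k) < ennreal \<epsilon>"
    using assms(3) by (intro order_tendstoD(2)) auto
  then obtain k where "emeasure ?M (?A k) < ennreal \<epsilon>" by (auto simp: eventually_sequentially)
  then show thesis using that[of "1 / (real k + 4)"] unfolding em by (auto simp: field_simps)
qed

context heat_supersolution
begin

text \<open>For \<open>y\<close> within radius 2, Young's inequality separates a power of the kernel
  from a power of \<open>u\<close>, both locally integrable. Farther out the kernel is bounded and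
  the global integrability of \<open>u^lam\<close> takes over.\<close>

lemma nonlocal_term_bounded:
  fixes \<alpha> lam :: real
  assumes alpha: "0 < \<alpha>" "\<alpha> < real DIM('a) + 2"
    and hlam: "0 < lam" "lam < (real DIM('a) + 2 - \<alpha>) / real DIM('a)"
    and Llam: "set_integrable lborel (UNIV \<times> {0<..<16}) (\<lambda>p. u (fst p) (snd p) powr lam)"
  obtains C where "0 \<le> C" and "\<And>x t. norm x \<le> 3/2 \<Longrightarrow> 0 < t \<Longrightarrow> t < 1 \<Longrightarrow>
    (\<integral>\<^sup>+p\<in>UNIV \<times> {0<..<16}. ennreal (heat_kernel (x - fst p) (t - snd p) powr (\<alpha> / real DIM('a)) * u (fst p) (snd p) powr lam) \<partial>lborel)
     \<le> ennreal C"
proof -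
  let ?n = "real DIM('a)"
  have n: "0 < ?n" by simp
  \<comment> \<open>The upper bound on \<open>lam\<close> is equivalent to \<open>a + b < 1\<close>.
    Splitting the slack evenly gives exponents \<open>a + e\<close> and \<open>b + e\<close> with
    sum 1, and puts \<open>\<beta>\<close> and \<open>p\<close> strictly below
    \<open>(n + 2) / n\<close>.\<close>
  define a where "a = \<alpha> / (?n + 2)"
  define b where "b = ?n * lam / (?n + 2)"
  define e where "e = (1 - a - b) / 2"
  have "?n * lam < ?n + 2 - \<alpha>" using hlam n by (simp add: field_simps)
  then have ab: "a + b < 1" unfolding a_def b_def by (simp add: add_divide_distrib[symmetric])
  then have e: "0 < e" by (simp add: e_def)
  have sum1: "a + e + (b + e) = 1" by (simp add: e_def)
  have a: "0 < a" "0 < b" using alpha hlam n by (auto simp: a_def b_def)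
  define \<beta> where "\<beta> = \<alpha> / ?n / (a + e)"
  define p where "p = lam / (b + e)"
  \<comment> \<open>The local bound needs an exponent of at least 1; raising \<open>p\<close> costs
    only an additive constant on a bounded set.\<close>
  define p' where "p' = max 1 p"
  have \<beta>: "0 < \<beta>" using alpha a e n by (simp add: \<beta>_def)
  have "\<alpha> < (a + e) * (?n + 2)"
    using e n by (simp add: a_def distrib_right)
  then have "\<alpha> / (a + e) < ?n + 2" using a e by (simp add: pos_divide_less_eq mult.commute)
  then have \<beta>2: "\<beta> < (?n + 2) / ?n"
    using n divide_strict_right_mono[of "\<alpha> / (a + e)" "?n + 2" ?n] by (simp add: \<beta>_def mult.commute)
  have p: "0 < p" using hlam a e by (simp add: p_def)
  have "?n * lam < (b + e) * (?n + 2)"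
    using e n by (simp add: b_def distrib_right)
  then have "?n * lam / (b + e) < ?n + 2" using a e by (simp add: pos_divide_less_eq mult.commute)
  then have "p < (?n + 2) / ?n" using n by (simp add: p_def pos_less_divide_eq mult.commute)
  then have p': "1 \<le> p'" "p' < (?n + 2) / ?n" "p \<le> p'" by (auto simp: p'_def)
  obtain H0 where H0: "0 < H0" "\<And>\<rho> (x::'a) s. 0 < \<rho> \<Longrightarrow> \<rho> \<le> norm x \<or> \<rho>\<^sup>2 \<le> s \<Longrightarrow> heat_kernel x s \<le> H0 * \<rho> powr (- ?n)"
    by (rule heat_kernel_off_diagonal) blast
  \<comment> \<open>The kernel at spatial distance at least \<open>1/2\<close>, which is the
    situation for \<open>norm x \<le> 3/2\<close> and \<open>norm y > 2\<close>.\<close>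
  define H where "H = (H0 * (1/2) powr (- ?n)) powr (\<alpha> / ?n)"
  define k :: "'a \<times> real \<Rightarrow> ennreal" where
    "k z = ennreal (heat_kernel (fst z) (snd z) powr \<beta>) * indicator (UNIV \<times> {0<..<1}) z" for z
  have [measurable]: "UNIV \<times> {0<..<1::real} \<in> sets (borel :: ('a \<times> real) measure)"
    by (intro borel_open open_Times) auto
  have km[measurable]: "k \<in> borel_measurable borel" unfolding k_def by measurable
  define f2 where "f2 z = indicator (cball 0 2 \<times> {0<..<1}) z + ennreal (u (fst z) (snd z) powr p') * indicator (cball 0 2 \<times> {0<..<1}) z" for z
  define f3 where "f3 z = ennreal (u (fst z) (snd z) powr lam) * indicator (UNIV \<times> {0<..<16}) z" for z
  have Sm: "cball (0::'a) 2 \<times> {0<..<1::real} \<in> sets borel" by (simp add: borel_prod[symmetric])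
  have f2m[measurable]: "f2 \<in> borel_measurable borel"
    unfolding f2_def by (intro borel_measurable_add measurable_u(1) borel_measurable_indicator Sm)
  have Li: "integrable lborel (\<lambda>z. indicator (UNIV \<times> {0<..<16}) z *\<^sub>R (u (fst z) (snd z) powr lam))"
    using Llam by (simp only: set_integrable_def)
  have f3_eq: "f3 = (\<lambda>z. ennreal (norm (indicator (UNIV \<times> {0<..<16}) z *\<^sub>R (u (fst z) (snd z) powr lam))))"
    by (auto simp: f3_def indicator_def fun_eq_iff)
  have f3m[measurable]: "f3 \<in> borel_measurable borel"
    unfolding f3_eq using borel_measurable_integrable[OF Li] by simp
  define G where "G = (\<integral>\<^sup>+z. k z \<partial>lborel) + ((\<integral>\<^sup>+z. f2 z \<partial>lborel) + ennreal H * (\<integral>\<^sup>+z. f3 z \<partial>lborel))"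
  have "(\<integral>\<^sup>+z. k z \<partial>lborel) < \<infinity>"
    unfolding k_def by (rule nn_integral_heat_kernel_powr_space_time_finite[OF \<beta> \<beta>2])
  moreover have "(\<integral>\<^sup>+z. f2 z \<partial>lborel) < \<infinity>"
  proof -
    have "(\<integral>\<^sup>+z. f2 z \<partial>lborel) = emeasure lborel (cball (0::'a) 2 \<times> {0<..<1::real})
        + (\<integral>\<^sup>+z\<in>cball 0 2 \<times> {0<..<1}. ennreal (u (fst z) (snd z) powr p') \<partial>lborel)"
      unfolding f2_def using measurable_u(1)[of p' 2] Sm by (subst nn_integral_add) auto
    moreover have "emeasure lborel (cball (0::'a) 2 \<times> {0<..<1::real}) < \<infinity>"
      by (intro emeasure_bounded_finite bounded_Times) auto
    ultimately show ?thesis using local_Lp_bound[OF p'(1,2)] by simp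
  qed
  moreover have "(\<integral>\<^sup>+z. f3 z \<partial>lborel) < \<infinity>"
    unfolding f3_eq using Li unfolding integrable_iff_bounded by blast
  ultimately have G: "G < \<infinity>" by (simp add: G_def ennreal_mult_less_top)
  have bound: "(\<integral>\<^sup>+z\<in>UNIV \<times> {0<..<16}. ennreal (heat_kernel (x - fst z) (t - snd z) powr (\<alpha> / ?n) * u (fst z) (snd z) powr lam) \<partial>lborel) \<le> G"
    if x: "norm x \<le> 3/2" and t: "0 < t" "t < 1" for x t
  proof -
    have "(\<integral>\<^sup>+z\<in>UNIV \<times> {0<..<16}. ennreal (heat_kernel (x - fst z) (t - snd z) powr (\<alpha> / ?n) * u (fst z) (snd z) powr lam) \<partial>lborel)
      \<le> (\<integral>\<^sup>+z. k ((x, t) - z) + (f2 z + ennreal H * f3 z) \<partial>lborel)"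
    proof (rule nn_integral_mono)
      fix z :: "'a \<times> real"
      obtain y s where z: "z = (y, s)" by fastforce
      let ?K = "heat_kernel (x - y) (t - s)"
      \<comment> \<open>In the first two cases the left side is 0, because of the indicator or
        because the kernel vanishes at nonpositive time.\<close>
      consider "s \<notin> {0<..<16}" | "t \<le> s" | "0 < s" "s < t" "norm y \<le> 2" | "0 < s" "s < t" "2 < norm y"
        by fastforce
      then have "ennreal (?K powr (\<alpha> / ?n) * u y s powr lam) * indicator (UNIV \<times> {0<..<16}) (y, s)
        \<le> k (x - y, t - s) + (f2 (y, s) + ennreal H * f3 (y, s))"
      proof cases
        case 3
        have u: "0 \<le> u y s" using nonneg 3 t by simp
        have "?K powr (\<alpha> / ?n) * u y s powr lam = (?K powr \<beta>) powr (a + e) * (u y s powr p) powr (b + e)"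
          using a e by (simp add: powr_powr \<beta>_def p_def)
        also have "\<dots> \<le> ?K powr \<beta> + u y s powr p"
          by (rule powr_mult_powr_le_add) (use a e sum1 in auto)
        also have "\<dots> \<le> ?K powr \<beta> + (1 + u y s powr p')"
          using powr_le_one_add_powr[OF u, of p p'] p p' by simp
        finally have "ennreal (?K powr (\<alpha> / ?n) * u y s powr lam) \<le> ennreal (?K powr \<beta> + (1 + u y s powr p'))"
          by (rule ennreal_leI)
        also have "\<dots> = ennreal (?K powr \<beta>) + (1 + ennreal (u y s powr p'))" by (simp add: ennreal_plus)
        also have "\<dots> = k (x - y, t - s) + f2 (y, s)" using 3 t by (simp add: k_def f2_def)
        also have "\<dots> \<le> k (x - y, t - s) + (f2 (y, s) + ennreal H * f3 (y, s))" by (simp add: add_left_mono)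
        finally show ?thesis using 3 t by simp
      next
        case 4
        have "1/2 \<le> norm (x - y)" using x 4 norm_triangle_ineq2[of y x] by (simp add: norm_minus_commute)
        then have "?K \<le> H0 * (1/2) powr (- ?n)" by (intro H0(2)) auto
        then have "?K powr (\<alpha> / ?n) \<le> H" unfolding H_def using alpha n by (intro powr_mono2) auto
        then have "ennreal (?K powr (\<alpha> / ?n) * u y s powr lam) \<le> ennreal (H * u y s powr lam)"
          by (intro ennreal_leI mult_right_mono) auto
        also have "\<dots> = ennreal H * f3 (y, s)" using 4 t by (simp add: f3_def ennreal_mult' H_def)
        also have "\<dots> \<le> k (x - y, t - s) + (f2 (y, s) + ennreal H * f3 (y, s))"
          by (simp add: add_increasing)
        finally show ?thesis using 4 t by simp
      qed auto
      then show "ennreal (heat_kernel (x - fst z) (t - snd z) powr (\<alpha> / ?n) * u (fst z) (snd z) powr lam) * indicator (UNIV \<times> {0<..<16}) z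
        \<le> k ((x, t) - z) + (f2 z + ennreal H * f3 z)" by (simp add: z)
    qed
    also have "\<dots> = (\<integral>\<^sup>+z. k ((x, t) - z) \<partial>lborel) + ((\<integral>\<^sup>+z. f2 z \<partial>lborel) + ennreal H * (\<integral>\<^sup>+z. f3 z \<partial>lborel))"
      by (simp add: nn_integral_add nn_integral_cmult)
    also have "\<dots> = G" unfolding G_def by (simp add: lborel_nn_integral_reflect)
    finally show ?thesis .
  qed
  show thesis
  proof (rule that[of "enn2real G"])
    show "(\<integral>\<^sup>+z\<in>UNIV \<times> {0<..<16}. ennreal (heat_kernel (x - fst z) (t - snd z) powr (\<alpha> / ?n) * u (fst z) (snd z) powr lam) \<partial>lborel) \<le> ennreal (enn2real G)"
      if "norm x \<le> 3/2" "0 < t" "t < 1" for x t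
      using bound[OF that] G by simp
  qed simp
qed

end

section \<open>Growth with a critical source\<close>

context heat_supersolution
begin

text \<open>The exponent \<open>(n + 2) / n\<close> is scale invariant, so the gain has to come from the small mass of the source.
  At a maximum point of \<open>u * d ^ n\<close> with \<open>u = M\<close>, the source potential is split at parabolic distance
  \<open>\<kappa> * M powr (- 1 / n)\<close>: inside, maximality bounds the source, and outside, its mass is small.\<close>

lemma critical_source_growth:
  assumes C2: "0 \<le> C2" and src: "\<And>x t. norm x \<le> 3/2 \<Longrightarrow> 0 < t \<Longrightarrow> t < 1 \<Longrightarrow>
    heat_op u x t \<le> C2 * (1 + u x t powr ((real DIM('a) + 2) / real DIM('a)))"
  obtains K T where "0 < T" "T < 1" and "\<And>x t. norm x \<le> 1 \<Longrightarrow> 0 < t \<Longrightarrow> t < T \<Longrightarrow> u x t \<le> K * t powr (- real DIM('a) / 2)"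
proof -
  let ?n = "real DIM('a)"
  have n: "0 < ?n" by simp
  obtain A where A: "0 < A" "\<And>s. 0 < s \<Longrightarrow> s \<le> 1 \<Longrightarrow> (\<integral>\<^sup>+y\<in>cball 0 3. ennreal (u y s) \<partial>lborel) \<le> ennreal A"
    "(\<integral>\<^sup>+p\<in>cball 0 3 \<times> {0<..<1}. ennreal (heat_op u (fst p) (snd p)) \<partial>lborel) \<le> ennreal A"
    by (rule mass_bounds) blast
  obtain C where C: "0 < C" "\<And>x \<tau> t. norm x \<le> 2 \<Longrightarrow> 0 < \<tau> \<Longrightarrow> \<tau> < t \<Longrightarrow> t \<le> 1 \<Longrightarrow>
    ennreal (u x t) \<le> ennreal C * (1 + (\<integral>\<^sup>+y\<in>cball 0 3. ennreal (heat_kernel (x - y) (t - \<tau>) * u y \<tau>) \<partial>lborel)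
      + (\<integral>\<^sup>+p\<in>cball 0 3 \<times> {0<..<1}. ennreal (heat_kernel (x - fst p) (t - snd p) * heat_op u (fst p) (snd p)) \<partial>lborel))"
    by (rule representation_bound) blast
  obtain C4 where C4: "0 < C4" "\<And>\<rho> (x::'a) s. 0 < \<rho> \<Longrightarrow> \<rho> \<le> norm x \<or> \<rho>\<^sup>2 \<le> s \<Longrightarrow> heat_kernel x s \<le> C4 * \<rho> powr (- ?n)"
    by (rule heat_kernel_off_diagonal) blast
  \<comment> \<open>Near the maximum point \<open>u\<close> will be at most \<open>2^n * M\<close>,
    and \<open>2^n\<close> to the power \<open>(n + 2) / n\<close> is
    \<open>2^(n + 2)\<close>.\<close>
  define C3 where "C3 = C2 * (1 + 2 powr (?n + 2))"
  have C3: "0 \<le> C3" using C2 by (simp add: C3_def)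
  \<comment> \<open>Small enough for the near part of the potential to be at most
    \<open>M / 4\<close>; the summand 2 also gives \<open>\<kappa> \<le> 1/2\<close>, which keeps
    the near cylinder inside \<open>Q\<close>.\<close>
  define \<kappa> where "\<kappa> = 1 / (4 * (C * C3) + 2)"
  have CC3: "0 \<le> C * C3" using C(1) C3 by simp
  have \<kappa>: "0 < \<kappa>" "\<kappa> \<le> 1/2" "C * C3 * \<kappa> \<le> 1/4"
    using CC3 unfolding \<kappa>_def by (auto simp: field_simps)
  have \<kappa>2: "C * (C3 * \<kappa>\<^sup>2) \<le> 1/4"
  proof -
    have "C * (C3 * \<kappa>\<^sup>2) = (C * C3 * \<kappa>) * \<kappa>" by (simp add: power2_eq_square)
    also have "\<dots> \<le> (C * C3 * \<kappa>) * 1" using CC3 \<kappa> by (intro mult_left_mono) auto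
    finally show ?thesis using \<kappa>(3) by linarith
  qed
  \<comment> \<open>Calibrated so that the far part of the potential is at most
    \<open>M / 4\<close>. The time \<open>T\<close> is chosen afterwards to make the source mass
    this small.\<close>
  define \<epsilon> where "\<epsilon> = \<kappa> powr ?n / (4 * C * C4)"
  have \<epsilon>: "0 < \<epsilon>" using \<kappa> C(1) C4(1) by (simp add: \<epsilon>_def)
  have \<epsilon>2: "C * (C4 * \<kappa> powr (- ?n) * \<epsilon>) = 1/4"
    using \<kappa> C(1) C4(1) by (simp add: \<epsilon>_def powr_minus field_simps)
  obtain T where T: "0 < T" "T \<le> 1/4"
    "(\<integral>\<^sup>+p\<in>cball 0 3 \<times> {0<..<T}. ennreal (heat_op u (fst p) (snd p)) \<partial>lborel) \<le> ennreal \<epsilon>"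
  proof (rule nn_integral_small_initial_layer[OF measurable_u(2)[of 3] _ \<epsilon>])
    show "(\<integral>\<^sup>+p\<in>cball 0 3 \<times> {0<..<1}. ennreal (heat_op u (fst p) (snd p)) \<partial>lborel) < \<infinity>"
      using A(3) by (rule order.strict_trans1) simp
  qed blast
  define C5 where "C5 = C * (1 + A)"
  have C5: "0 < C5" using C(1) A(1) by (simp add: C5_def)
  define J where "J x t = (\<integral>\<^sup>+p\<in>cball 0 3 \<times> {0<..<T}. ennreal (heat_kernel (x - fst p) (t - snd p) * heat_op u (fst p) (snd p)) \<partial>lborel)" for x t
  \<comment> \<open>Starting at time \<open>t / 2\<close>, the first potential is at most the height
    of the kernel, of order \<open>t^(- n / 2)\<close>, times the mass \<open>A\<close>: this is the
    source of the final rate. Only source times below \<open>t\<close>, hence below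
    \<open>T\<close>, contribute.\<close>
  have repr: "ennreal (u x t) \<le> ennreal (C5 * t powr (- ?n / 2)) + ennreal C * J x t"
    if x: "norm x \<le> 2" and t: "0 < t" "t < T" for x t
  proof -
    let ?X = "\<integral>\<^sup>+y\<in>cball 0 3. ennreal (heat_kernel (x - y) (t - t / 2) * u y (t / 2)) \<partial>lborel"
    have t1: "t < 1" using t T by simp
    have "?X \<le> (\<integral>\<^sup>+y. ennreal (t powr (- ?n / 2)) * (ennreal (u y (t / 2)) * indicator (cball 0 3) y) \<partial>lborel)"
    proof (rule nn_integral_mono)
      fix y :: 'a
      have "heat_kernel (x - y) (t - t / 2) \<le> (4 * pi * (t - t / 2)) powr (- ?n / 2)"
        by (rule heat_kernel_le_time) (use t in simp)
      also have "\<dots> \<le> t powr (- ?n / 2)"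
        using t pi_gt3 by (intro powr_mono2') (auto simp: field_simps)
      finally have "heat_kernel (x - y) (t - t / 2) * u y (t / 2) \<le> t powr (- ?n / 2) * u y (t / 2)"
        using nonneg[of "t / 2" y] t t1 by (intro mult_right_mono) auto
      then have "ennreal (heat_kernel (x - y) (t - t / 2) * u y (t / 2)) \<le> ennreal (t powr (- ?n / 2)) * ennreal (u y (t / 2))"
        by (simp add: ennreal_leI flip: ennreal_mult')
      then show "ennreal (heat_kernel (x - y) (t - t / 2) * u y (t / 2)) * indicator (cball 0 3) y
          \<le> ennreal (t powr (- ?n / 2)) * (ennreal (u y (t / 2)) * indicator (cball 0 3) y)"
        by (auto simp: indicator_def)
    qed
    also have "\<dots> = ennreal (t powr (- ?n / 2)) * (\<integral>\<^sup>+y\<in>cball 0 3. ennreal (u y (t / 2)) \<partial>lborel)"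
      by (rule nn_integral_cmult) (use measurable_u_slice[of "t / 2" 3] t t1 in simp)
    also have "\<dots> \<le> ennreal (t powr (- ?n / 2)) * ennreal A"
      using A(2)[of "t / 2"] t t1 by (intro mult_left_mono) auto
    also have "\<dots> = ennreal (t powr (- ?n / 2) * A)" using A(1) by (simp add: ennreal_mult')
    finally have X: "?X \<le> ennreal (t powr (- ?n / 2) * A)" .
    have "1 powr (- ?n / 2) \<le> t powr (- ?n / 2)" using t t1 by (intro powr_mono2') auto
    then have one: "1 \<le> ennreal (t powr (- ?n / 2))" by simp
    have "(\<integral>\<^sup>+p\<in>cball 0 3 \<times> {0<..<1}. ennreal (heat_kernel (x - fst p) (t - snd p) * heat_op u (fst p) (snd p)) \<partial>lborel) = J x t"
      unfolding J_def
    proof (rule nn_integral_cong)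
      fix p :: "'a \<times> real"
      show "ennreal (heat_kernel (x - fst p) (t - snd p) * heat_op u (fst p) (snd p)) * indicator (cball 0 3 \<times> {0<..<1}) p
        = ennreal (heat_kernel (x - fst p) (t - snd p) * heat_op u (fst p) (snd p)) * indicator (cball 0 3 \<times> {0<..<T}) p"
        using t T(1,2) by (cases "snd p < T") (auto simp: indicator_def mem_Times_iff)
    qed
    then have "ennreal (u x t) \<le> ennreal C * (1 + ?X + J x t)"
      using C(2)[OF x, of "t / 2" t] t t1 by simp
    also have "\<dots> \<le> ennreal C * (ennreal (t powr (- ?n / 2)) + ennreal (t powr (- ?n / 2) * A) + J x t)"
      by (intro mult_left_mono add_mono X one) auto
    also have "\<dots> = ennreal (C5 * t powr (- ?n / 2)) + ennreal C * J x t"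
    proof -
      have "ennreal (t powr (- ?n / 2)) + ennreal (t powr (- ?n / 2) * A) = ennreal (t powr (- ?n / 2) * (1 + A))"
        using A(1) by (simp add: distrib_left)
      moreover have "ennreal C * ennreal (t powr (- ?n / 2) * (1 + A)) = ennreal (C5 * t powr (- ?n / 2))"
        using C(1) by (simp add: C5_def mult_ac flip: ennreal_mult')
      ultimately show ?thesis by (simp add: distrib_left)
    qed
    finally show ?thesis .
  qed
  have main: "u x0 t0 * (sqrt t0 / 2) ^ DIM('a) \<le> 1 + 2 * C5" if x0: "norm x0 \<le> 1" and t0: "0 < t0" "t0 < T" for x0 t0
  proof -
    \<comment> \<open>A parabolic distance to the side and bottom of the cylinder \<open>Q\<close>.
      It vanishes there and equals \<open>sqrt t0 / 2\<close> at \<open>(x0, t0)\<close>.\<close>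
    define d where "d x t = min (sqrt t0 / 2 - norm (x - x0)) (sqrt (t - t0 / 2))" for x t
    define Q where "Q = cball x0 (sqrt t0 / 2) \<times> {t0 / 2..t0}"
    have t01: "t0 \<le> 1/4" using t0 T by simp
    have st0: "sqrt t0 \<le> 1/2" using t01 real_sqrt_le_mono[of t0 "1/4"] by (simp add: real_sqrt_divide)
    have d_nonneg: "0 \<le> d x t" if "(x, t) \<in> Q" for x t
      using that by (auto simp: d_def Q_def dist_norm norm_minus_commute)
    have "continuous_on Q (\<lambda>z. u (fst z) (snd z))"
      by (rule continuous_on_derivatives) (use t0 t01 in \<open>auto simp: Q_def\<close>)
    moreover have "continuous_on Q (\<lambda>z. d (fst z) (snd z))"
      unfolding d_def by (intro continuous_intros)
    ultimately have cont: "continuous_on Q (\<lambda>z. u (fst z) (snd z) * d (fst z) (snd z) ^ DIM('a))"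
      by (intro continuous_intros)
    have "compact Q" unfolding Q_def by (intro compact_Times) auto
    moreover have x0Q: "(x0, t0) \<in> Q" using t0 by (auto simp: Q_def)
    ultimately obtain z where z: "z \<in> Q" "\<And>w. w \<in> Q \<Longrightarrow> u (fst w) (snd w) * d (fst w) (snd w) ^ DIM('a) \<le> u (fst z) (snd z) * d (fst z) (snd z) ^ DIM('a)"
      using continuous_attains_sup[OF _ _ cont] by blast
    obtain x t where zxt: "z = (x, t)" by fastforce
    define M where "M = u x t"
    define \<delta>0 where "\<delta>0 = d x t"
    have max: "u y s * d y s ^ DIM('a) \<le> M * \<delta>0 ^ DIM('a)" if "(y, s) \<in> Q" for y s
      using z(2)[OF that] by (simp add: zxt M_def \<delta>0_def)
    have xt: "norm (x - x0) \<le> sqrt t0 / 2" "t0 / 2 \<le> t" "t \<le> t0"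
      using z(1) by (auto simp: zxt Q_def dist_norm norm_minus_commute)
    have d0: "d x0 t0 = sqrt t0 / 2"
    proof -
      have "sqrt t0 / 2 = sqrt (t0 / 4)" by (simp add: real_sqrt_divide)
      also have "\<dots> \<le> sqrt (t0 - t0 / 2)" using t0 by (intro real_sqrt_le_mono) auto
      finally show ?thesis by (simp add: d_def)
    qed
    have M0: "0 \<le> M" using nonneg[of t x] xt t0 t01 by (simp add: M_def)
    have \<delta>0: "0 \<le> \<delta>0" "\<delta>0 \<le> sqrt t0 / 2 - norm (x - x0)" "\<delta>0 \<le> sqrt (t - t0 / 2)"
      using d_nonneg[of x t] z(1) by (auto simp: \<delta>0_def d_def zxt)
    have \<delta>0sq: "\<delta>0\<^sup>2 \<le> t - t0 / 2"
    proof -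
      have "\<delta>0\<^sup>2 \<le> (sqrt (t - t0 / 2))\<^sup>2" using \<delta>0 by (intro power_mono) auto
      then show ?thesis using xt by simp
    qed
    have "M * \<delta>0 ^ DIM('a) \<le> 1 + 2 * C5"
    proof (cases "M * \<delta>0 ^ DIM('a) \<le> 1")
      case True
      then show ?thesis using C5 by simp
    next
      case False
      have dpos: "0 < \<delta>0" using False \<delta>0(1) by (cases "\<delta>0 = 0") (auto simp: power_0_left)
      have dle: "\<delta>0 \<le> 1" using \<delta>0(2) st0 norm_ge_zero[of "x - x0"] by linarith
      have M1: "1 < M"
      proof (rule ccontr)
        assume "\<not> 1 < M"
        then have "M * \<delta>0 ^ DIM('a) \<le> 1 * 1" using M0 dpos dle by (intro mult_mono power_le_one) auto
        then show False using False by simp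
      qed
      \<comment> \<open>At this scale both parts of the potential are proportional to
        \<open>M\<close>: \<open>M^((n + 2) / n) * \<delta>^2 = \<kappa>^2 * M\<close> and
        \<open>\<delta>^(- n) = \<kappa>^(- n) * M\<close>.\<close>
      define \<delta> where "\<delta> = \<kappa> * M powr (- 1 / ?n)"
      have \<delta>: "0 < \<delta>" using \<kappa> M1 by (simp add: \<delta>_def)
      have Mn: "(M powr (- 1 / ?n)) powr ?n = 1 / M"
        unfolding powr_powr using M1 n by (simp add: powr_neg_one)
      \<comment> \<open>The failure of \<open>M * \<delta>0^n \<le> 1\<close> says exactly that the
        length scale of \<open>M\<close> is shorter than the distance to the boundary.\<close>
      have "M powr (- 1 / ?n) < \<delta>0"
      proof (rule ccontr)
        assume "\<not> M powr (- 1 / ?n) < \<delta>0"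
        then have "\<delta>0 powr ?n \<le> (M powr (- 1 / ?n)) powr ?n" using dpos n by (intro powr_mono2) auto
        then have "\<delta>0 ^ DIM('a) \<le> 1 / M" unfolding Mn using dpos by (simp add: powr_realpow)
        then have "M * \<delta>0 ^ DIM('a) \<le> 1" using M1 by (simp add: field_simps)
        then show False using False by simp
      qed
      then have "\<delta> \<le> \<kappa> * \<delta>0" unfolding \<delta>_def using \<kappa> by (intro mult_left_mono) auto
      also have "\<dots> \<le> 1/2 * \<delta>0" using \<kappa> dpos by (intro mult_right_mono) auto
      finally have \<delta>half: "\<delta> \<le> \<delta>0 / 2" by simp
      define B where "B = C3 * M powr ((?n + 2) / ?n)"
      have B: "0 \<le> B" using C3 by (simp add: B_def)
      \<comment> \<open>As \<open>\<delta> \<le> \<delta>0 / 2\<close>, the distance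
        \<open>d\<close> is still at least \<open>\<delta>0 / 2\<close> in this cylinder, and
        maximality of \<open>u * d^n\<close> gives \<open>u \<le> 2^n * M\<close>.\<close>
      have src_near: "heat_op u y s \<le> B" if y: "norm (x - y) < \<delta>" and s: "s < t" "t - s < \<delta>\<^sup>2" for y s
      proof -
        have "norm (y - x0) \<le> norm (x - y) + norm (x - x0)"
          using norm_triangle_ineq4[of "x - x0" "x - y"] by simp
        then have dy: "\<delta>0 / 2 \<le> sqrt t0 / 2 - norm (y - x0)" using \<delta>half \<delta>0(2) y by linarith
        have "\<delta>\<^sup>2 \<le> (\<delta>0 / 2)\<^sup>2" using \<delta>half \<delta> by (intro power_mono) auto
        then have s2: "(\<delta>0 / 2)\<^sup>2 \<le> s - t0 / 2"
          using s \<delta>0sq zero_le_power2[of \<delta>0] by (simp add: power_divide)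
        then have "\<delta>0 / 2 \<le> sqrt (s - t0 / 2)" by (rule real_le_rsqrt)
        with dy have d: "\<delta>0 / 2 \<le> d y s" by (simp add: d_def)
        have spos: "t0 / 2 \<le> s" using s2 zero_le_power2[of "\<delta>0 / 2"] by linarith
        have "norm (y - x0) \<le> sqrt t0 / 2" using dy dpos by linarith
        then have yQ: "(y, s) \<in> Q" using spos s xt by (auto simp: Q_def dist_norm norm_minus_commute)
        have un: "0 \<le> u y s" using nonneg[of s y] spos s xt t0 t01 by simp
        have "u y s * (\<delta>0 / 2) ^ DIM('a) \<le> u y s * d y s ^ DIM('a)"
          using d dpos un by (intro mult_left_mono power_mono) auto
        also have "\<dots> \<le> M * \<delta>0 ^ DIM('a)" by (rule max[OF yQ])
        finally have "u y s \<le> 2 ^ DIM('a) * M" using dpos by (simp add: power_divide field_simps)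
        then have "u y s powr ((?n + 2) / ?n) \<le> (2 ^ DIM('a) * M) powr ((?n + 2) / ?n)"
          using un by (intro powr_mono2) auto
        also have "\<dots> = 2 powr (?n + 2) * M powr ((?n + 2) / ?n)"
          using M1 n by (simp add: powr_mult powr_realpow[symmetric] powr_powr)
        finally have "1 + u y s powr ((?n + 2) / ?n) \<le> (1 + 2 powr (?n + 2)) * M powr ((?n + 2) / ?n)"
          using ge_one_powr_ge_zero[of M "(?n + 2) / ?n"] M1 by (simp add: distrib_right)
        then have "C2 * (1 + u y s powr ((?n + 2) / ?n)) \<le> B"
          unfolding B_def C3_def mult.assoc using C2 by (intro mult_left_mono) auto
        moreover have "norm y \<le> 3/2"
          using norm_triangle_ineq[of "y - x0" x0] \<open>norm (y - x0) \<le> sqrt t0 / 2\<close> st0 x0 by simp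
        moreover have "0 < s" "s < 1" using spos t0 t01 xt s by auto
        ultimately show ?thesis using src[of y s] by linarith
      qed
      define h where "h p = ennreal (heat_op u (fst p) (snd p)) * indicator (cball 0 3 \<times> {0<..<T}) p" for p
      define k :: "'a \<times> real \<Rightarrow> ennreal" where "k p = ennreal (heat_kernel (fst p) (snd p)) * indicator (UNIV \<times> {0<..<\<delta>\<^sup>2}) p" for p
      have "UNIV \<times> {0<..<\<delta>\<^sup>2} \<in> sets (borel :: ('a \<times> real) measure)" by (intro borel_open open_Times) auto
      then have km[measurable]: "k \<in> borel_measurable borel" unfolding k_def by measurable
      have hm[measurable]: "h \<in> borel_measurable borel"
        unfolding h_def
        by (rule borel_measurable_restrict_continuous, rule continuous_on_derivatives) (use T in \<open>auto simp: borel_prod[symmetric]\<close>)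
      have "J x t \<le> (\<integral>\<^sup>+p. ennreal B * k ((x, t) - p) + ennreal (C4 * \<delta> powr (- ?n)) * h p \<partial>lborel)"
        unfolding J_def
      proof (rule nn_integral_mono)
        fix p :: "'a \<times> real"
        obtain y s where p: "p = (y, s)" by fastforce
        let ?K = "heat_kernel (x - y) (t - s)"
        consider "(y, s) \<notin> cball 0 3 \<times> {0<..<T}" | "t \<le> s"
          | "norm y \<le> 3" "0 < s" "s < T" "s < t" "norm (x - y) < \<delta>" "t - s < \<delta>\<^sup>2"
          | "norm y \<le> 3" "0 < s" "s < T" "s < t" "\<delta> \<le> norm (x - y) \<or> \<delta>\<^sup>2 \<le> t - s"
          by fastforce
        then have "ennreal (?K * heat_op u y s) * indicator (cball 0 3 \<times> {0<..<T}) (y, s)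
            \<le> ennreal B * k (x - y, t - s) + ennreal (C4 * \<delta> powr (- ?n)) * h (y, s)"
        proof cases
          case 3
          have "?K * heat_op u y s \<le> B * ?K" using mult_left_mono[OF src_near[OF 3(5,4,6)], of ?K] by (simp add: mult.commute)
          then have "ennreal (?K * heat_op u y s) \<le> ennreal B * ennreal ?K"
            using B by (simp add: ennreal_leI flip: ennreal_mult')
          also have "\<dots> = ennreal B * k (x - y, t - s)" using 3 by (simp add: k_def)
          also have "\<dots> \<le> ennreal B * k (x - y, t - s) + ennreal (C4 * \<delta> powr (- ?n)) * h (y, s)" by simp
          finally show ?thesis using 3 by simp
        next
          case 4
          have f: "0 \<le> heat_op u y s" using 4 T by (intro heat_op_nonneg) auto
          have "?K * heat_op u y s \<le> C4 * \<delta> powr (- ?n) * heat_op u y s"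
            by (intro mult_right_mono C4(2) \<delta> 4 f)
          then have "ennreal (?K * heat_op u y s) \<le> ennreal (C4 * \<delta> powr (- ?n)) * ennreal (heat_op u y s)"
            using C4(1) by (simp add: ennreal_leI flip: ennreal_mult')
          also have "\<dots> = ennreal (C4 * \<delta> powr (- ?n)) * h (y, s)" using 4 by (simp add: h_def)
          also have "\<dots> \<le> ennreal B * k (x - y, t - s) + ennreal (C4 * \<delta> powr (- ?n)) * h (y, s)" by simp
          finally show ?thesis using 4 by simp
        qed auto
        then show "ennreal (heat_kernel (x - fst p) (t - snd p) * heat_op u (fst p) (snd p)) * indicator (cball 0 3 \<times> {0<..<T}) p
            \<le> ennreal B * k ((x, t) - p) + ennreal (C4 * \<delta> powr (- ?n)) * h p"
          by (simp add: p)
      qed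
      also have "\<dots> = ennreal B * (\<integral>\<^sup>+p. k p \<partial>lborel) + ennreal (C4 * \<delta> powr (- ?n)) * (\<integral>\<^sup>+p. h p \<partial>lborel)"
        by (simp add: nn_integral_add nn_integral_cmult lborel_nn_integral_reflect)
      also have "\<dots> \<le> ennreal B * ennreal (\<delta>\<^sup>2) + ennreal (C4 * \<delta> powr (- ?n)) * ennreal \<epsilon>"
        unfolding k_def h_def
        by (intro add_mono mult_left_mono T(3) eq_refl[OF nn_integral_heat_kernel_space_time]) auto
      also have "\<dots> = ennreal (B * \<delta>\<^sup>2 + C4 * \<delta> powr (- ?n) * \<epsilon>)"
        using B C4(1) \<epsilon> by (simp add: ennreal_mult')
      finally have "ennreal C * J x t \<le> ennreal C * ennreal (B * \<delta>\<^sup>2 + C4 * \<delta> powr (- ?n) * \<epsilon>)"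
        by (intro mult_left_mono) auto
      also have "\<dots> = ennreal (C * (B * \<delta>\<^sup>2 + C4 * \<delta> powr (- ?n) * \<epsilon>))"
        using C(1) by (simp add: ennreal_mult')
      also have "C * (B * \<delta>\<^sup>2 + C4 * \<delta> powr (- ?n) * \<epsilon>) = C * (C3 * \<kappa>\<^sup>2) * M + C * (C4 * \<kappa> powr (- ?n) * \<epsilon>) * M"
      proof -
        have "(M powr (- 1 / ?n))\<^sup>2 = M powr (- 2 / ?n)"
          using M1 by (simp add: power2_eq_square powr_add[symmetric])
        moreover have "M powr ((?n + 2) / ?n) * M powr (- 2 / ?n) = M"
          using M1 n by (simp add: powr_add[symmetric] add_divide_distrib)
        ultimately have 1: "B * \<delta>\<^sup>2 = C3 * \<kappa>\<^sup>2 * M"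
          by (simp add: B_def \<delta>_def power_mult_distrib mult_ac)
        have "\<delta> powr (- ?n) = \<kappa> powr (- ?n) * M"
          using \<kappa>(1) M1 n by (simp add: \<delta>_def powr_mult powr_powr)
        then show ?thesis using 1 by (simp add: distrib_left mult_ac)
      qed
      \<comment> \<open>The whole potential is at most half of \<open>M\<close>, so it can be
        absorbed into the left side of the representation bound.\<close>
      also have "\<dots> \<le> 1/4 * M + 1/4 * M"
        using \<kappa>2 \<epsilon>2 M1 by (intro add_mono mult_right_mono) auto
      finally have CJ: "ennreal C * J x t \<le> ennreal (M / 2)" by (simp add: ennreal_leI)
      have "norm x \<le> 2" using norm_triangle_ineq[of "x - x0" x0] xt(1) st0 x0 by simp
      then have "ennreal M \<le> ennreal (C5 * t powr (- ?n / 2)) + ennreal C * J x t"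
        unfolding M_def by (rule repr) (use xt t0 in auto)
      also have "\<dots> \<le> ennreal (C5 * t powr (- ?n / 2)) + ennreal (M / 2)" by (intro add_left_mono CJ)
      also have "\<dots> = ennreal (C5 * t powr (- ?n / 2) + M / 2)" using C5 M0 by simp
      finally have "M \<le> C5 * t powr (- ?n / 2) + M / 2"
        using C5 M0 by (subst (asm) ennreal_le_iff) auto
      then have M: "M \<le> 2 * C5 * t powr (- ?n / 2)" by simp
      have tpos: "0 < t" using xt t0 by simp
      \<comment> \<open>Since \<open>\<delta>0^2 \<le> t\<close>, the weight
        \<open>\<delta>0^n\<close> cancels \<open>t^(- n / 2)\<close> and leaves a constant
        independent of \<open>t0\<close>.\<close>
      have "\<delta>0 ^ DIM('a) = (\<delta>0\<^sup>2) powr (?n / 2)"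
        using dpos powr_powr[of \<delta>0 2 "?n / 2"] by (simp add: powr_numeral powr_realpow)
      also have "\<dots> \<le> t powr (?n / 2)" using \<delta>0sq t0 by (intro powr_mono2) auto
      finally have "M * \<delta>0 ^ DIM('a) \<le> (2 * C5 * t powr (- ?n / 2)) * t powr (?n / 2)"
        using M C5 dpos by (intro mult_mono) auto
      also have "\<dots> = 2 * C5" using tpos by (simp add: powr_minus)
      finally show ?thesis by simp
    qed
    then show ?thesis using max[OF x0Q] unfolding d0 by linarith
  qed
  show thesis
  proof (rule that[of T "(1 + 2 * C5) * 2 ^ DIM('a)"])
    fix x :: 'a and t assume *: "norm x \<le> 1" "0 < t" "t < T"
    have "(sqrt t / 2) ^ DIM('a) = t powr (?n / 2) / 2 ^ DIM('a)"
      using *(2) by (simp add: power_divide powr_half_sqrt[symmetric] powr_realpow[symmetric] powr_powr)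
    then show "u x t \<le> (1 + 2 * C5) * 2 ^ DIM('a) * t powr (- ?n / 2)"
      using main[OF *] *(2) by (simp add: powr_minus field_simps)
  qed (use T in auto)
qed

end

theorem theorem3p1:
  fixes u :: "'a::euclidean_space \<Rightarrow> real \<Rightarrow> real"
    and \<alpha> lam \<sigma> :: real
  assumes alpha: "0 < \<alpha>" "\<alpha> < real DIM('a) + 2"
    and hlam: "0 < lam" "lam < (real DIM('a) + 2 - \<alpha>) / real DIM('a)"
    and sig: "0 \<le> \<sigma>" "\<sigma> \<le> (real DIM('a) + 2) / real DIM('a)"
    and nonneg: "\<And>x t. 0 < t \<Longrightarrow> t < 16 \<Longrightarrow> 0 \<le> u x t"
    and reg: "C21 u (UNIV \<times> {0<..<16})"
    and Llam: "set_integrable lborel (UNIV \<times> {0<..<16}) (\<lambda>p. u (fst p) (snd p) powr lam)"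
    and lower: "\<And>x t. x \<in> ball 0 4 \<Longrightarrow> 0 < t \<Longrightarrow> t < 16 \<Longrightarrow> 0 \<le> dt u x t - lap u x t"
    and upper: "\<And>x t. x \<in> ball 0 4 \<Longrightarrow> 0 < t \<Longrightarrow> t < 16 \<Longrightarrow>
       ennreal (dt u x t - lap u x t) \<le>
         (\<integral>\<^sup>+ p \<in> UNIV \<times> {0<..<16}.
             ennreal (heat_kernel (x - fst p) (t - snd p) powr (\<alpha> / real DIM('a))
                      * u (fst p) (snd p) powr lam) \<partial>lborel)
         * ennreal (nnpow (u x t) \<sigma>)"
  shows "(\<lambda>t. SUP x\<in>cball 0 1. u x t) \<in> O[at_right 0](\<lambda>t. t powr (- real DIM('a) / 2))"
proof -
  let ?n = "real DIM('a)"
  interpret heat_supersolution u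
    by unfold_locales (use nonneg reg lower in \<open>auto simp: heat_op_def\<close>)
  obtain C where C: "0 \<le> C" "\<And>x t. norm x \<le> 3/2 \<Longrightarrow> 0 < t \<Longrightarrow> t < 1 \<Longrightarrow>
    (\<integral>\<^sup>+p\<in>UNIV \<times> {0<..<16}. ennreal (heat_kernel (x - fst p) (t - snd p) powr (\<alpha> / ?n) * u (fst p) (snd p) powr lam) \<partial>lborel)
     \<le> ennreal C"
    by (rule nonlocal_term_bounded[OF alpha hlam Llam]) blast
  have src: "heat_op u x t \<le> C * (1 + u x t powr ((?n + 2) / ?n))" if "norm x \<le> 3/2" "0 < t" "t < 1" for x t
  proof -
    have un: "0 \<le> u x t" by (rule nonneg) (use that in auto)
    have "ennreal (heat_op u x t) \<le> (\<integral>\<^sup>+p\<in>UNIV \<times> {0<..<16}. ennreal (heat_kernel (x - fst p) (t - snd p) powr (\<alpha> / ?n) * u (fst p) (snd p) powr lam) \<partial>lborel)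
        * ennreal (nnpow (u x t) \<sigma>)"
      unfolding heat_op_def by (rule upper) (use that in auto)
    also have "\<dots> \<le> ennreal C * ennreal (nnpow (u x t) \<sigma>)" by (intro mult_right_mono C that) simp
    also have "\<dots> = ennreal (C * nnpow (u x t) \<sigma>)" using C(1) by (simp add: ennreal_mult')
    finally have "heat_op u x t \<le> C * nnpow (u x t) \<sigma>"
      using C(1) by (subst (asm) ennreal_le_iff) (auto simp: nnpow_def)
    \<comment> \<open>Every admissible exponent reduces to the critical one; the summand 1 also
      covers \<open>\<sigma> = 0\<close>, where \<open>nnpow\<close> is 1 even at 0.\<close>
    also have "nnpow (u x t) \<sigma> \<le> 1 + u x t powr ((?n + 2) / ?n)"
      unfolding nnpow_def using powr_le_one_add_powr[OF un sig] by auto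
    finally show ?thesis using C(1) by (simp add: mult_left_mono)
  qed
  obtain K T where T: "0 < T" "T < 1" and K: "\<And>x t. norm x \<le> 1 \<Longrightarrow> 0 < t \<Longrightarrow> t < T \<Longrightarrow> u x t \<le> K * t powr (- ?n / 2)"
    by (rule critical_source_growth[OF C(1) src]) blast+
  show ?thesis
  proof (rule bigoI[where c=K])
    have "norm (SUP x\<in>cball 0 1. u x t) \<le> K * norm (t powr (- ?n / 2))" if t: "0 < t" "t < T" for t
    proof -
      have le: "(SUP x\<in>cball 0 1. u x t) \<le> K * t powr (- ?n / 2)"
        using K[OF _ t] by (intro cSUP_least) auto
      \<comment> \<open>A real-valued supremum dominates its members only for a bounded set.
        Comparison with the nonnegative value at the origin then removes the norm.\<close>
      have "bdd_above ((\<lambda>x. u x t) ` cball 0 1)"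
        using K[OF _ t] by (intro bdd_aboveI2[of _ _ "K * t powr (- ?n / 2)"]) auto
      then have "u 0 t \<le> (SUP x\<in>cball 0 1. u x t)" by (intro cSUP_upper) auto
      moreover have "0 \<le> u 0 t" using t T by (intro nonneg) auto
      ultimately show ?thesis using le by simp
    qed
    then show "\<forall>\<^sub>F t in at_right 0. norm (SUP x\<in>cball 0 1. u x t) \<le> K * norm (t powr (- ?n / 2))"
      unfolding eventually_at_right_field using T by auto
  qed
qed

end
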